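(* For every fixed $k$, there is a randomized algorithm with running time $O^*\big(2^{\,n-\frac{n}{2k}+\frac{n}{2k^2}}\cdot T(n)\big)$ that takes as input any $k$-CNF formula in variables $x_1,\dots,x_n$ and a $T(n)$-easy Boolean constraint $C(x_1,x_2,\ldots,x_n)$, and computes an assignment satisfying both the formula and $C$ (if one exists).
   Context: A $k$-CNF formula is a conjunction of clauses, each a disjunction of at most $k$ literals. A Boolean constraint $C(x_1,\dots,x_n)$ is called $T(n)$-easy if there is a $T(n)$ time-bounded algorithm that, given a partial assignment to the variables $x_1,\dots,x_n$, searches for an extension of it to a full assignment satisfying $C$ (it outputs such an extension if one exists, and otherwise reports that none exists). This algorithm is available to the main algorithm. Notation: $O^*(f)$ suppresses factors polynomial in $n$ ($k$ is a fixed constant). A randomized algorithm here is one that, whenever a common satisfying assignment exists, outputs one with probability at least a positive constant (e.g. $2/3$), and never outputs an incorrect assignment. *)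

theory Defs
  imports "HOL-Probability.SPMF"
begin

section \<open>The machine model\<close>

text \<open>
  Algorithms are programs of a While language over binary trees (in the style of Jones),
  extended by a fair coin and by a call to a subroutine that the program does not contain.
  A program is a fixed finite object, so one program is a uniform algorithm for inputs of all
  lengths.  Each node of an evaluated expression and each executed command costs one unit of time.
  The basic operations are pointer operations (trees may share subtrees), so these costs are
  realistic; conversely, a random access to a memory of size \<open>m\<close> takes time polynomial in \<open>m\<close>.
\<close>

datatype dat = Leaf | Node dat dat

datatype exp = Var nat | LeafE | NodeE exp exp | LeftE exp | RightE exp

datatype com =
    Assign nat exp
  | Flip nat
  | Call nat exp
  | Seq com com
  | Cond exp com com
  | While exp com

type_synonym store = "nat \<Rightarrow> dat"

fun left :: "dat \<Rightarrow> dat" where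
  "left Leaf = Leaf"
| "left (Node a b) = a"

fun right :: "dat \<Rightarrow> dat" where
  "right Leaf = Leaf"
| "right (Node a b) = b"

primrec val :: "exp \<Rightarrow> store \<Rightarrow> dat" where
  "val (Var x) s = s x"
| "val LeafE s = Leaf"
| "val (NodeE e f) s = Node (val e s) (val f s)"
| "val (LeftE e) s = left (val e s)"
| "val (RightE e) s = right (val e s)"

primrec cost :: "exp \<Rightarrow> nat" where
  "cost (Var x) = 1"
| "cost LeafE = 1"
| "cost (NodeE e f) = 1 + cost e + cost f"
| "cost (LeftE e) = 1 + cost e"
| "cost (RightE e) = 1 + cost e"

primrec enc_bool :: "bool \<Rightarrow> dat" where
  "enc_bool False = Leaf"
| "enc_bool True = Node Leaf Leaf"

text \<open>
  A subprobability distribution on pairs of a result and a running time describes a randomized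
  computation; the missing mass is the probability of divergence.
\<close>

definition bind_time ::
  "('a \<times> nat) spmf \<Rightarrow> ('a \<Rightarrow> ('b \<times> nat) spmf) \<Rightarrow> ('b \<times> nat) spmf" where
  "bind_time p f =
     bind_spmf p (\<lambda>(a, t). bind_spmf (f a) (\<lambda>(b, u). return_spmf (b, t + u)))"

lemma bind_time_mono [partial_function_mono]:
  assumes "mono_spmf p" and "\<And>a. mono_spmf (\<lambda>g. f a g)"
  shows "mono_spmf (\<lambda>g. bind_time (p g) (\<lambda>a. f a g))"
  unfolding bind_time_def split_def
  by (intro bind_spmf_mono assms spmf.const_mono)

partial_function (spmf) while_time ::
  "exp \<Rightarrow> (store \<Rightarrow> (store \<times> nat) spmf) \<Rightarrow> store \<Rightarrow> (store \<times> nat) spmf" where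
  "while_time e body s =
     bind_time (return_spmf (s, 1 + cost e))
       (\<lambda>s. if val e s \<noteq> Leaf then bind_time (body s) (while_time e body)
            else return_spmf (s, 0))"

text \<open>The parameter \<open>q\<close> is the meaning of the subroutine.  A call is charged with the
  running time of the subroutine.\<close>

primrec exec ::
  "(dat \<Rightarrow> (dat \<times> nat) spmf) \<Rightarrow> com \<Rightarrow> store \<Rightarrow> (store \<times> nat) spmf" where
  "exec q (Assign x e) s = return_spmf (s(x := val e s), 1 + cost e)"
| "exec q (Flip x) s = map_spmf (\<lambda>b. (s(x := enc_bool b), 1)) coin_spmf"
| "exec q (Call x e) s = map_spmf (\<lambda>(v, t). (s(x := v), 1 + cost e + t)) (q (val e s))"
| "exec q (Seq c d) s = bind_time (exec q c s) (exec q d)"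
| "exec q (Cond e c d) s =
     bind_time (return_spmf (s, 1 + cost e))
       (\<lambda>s. if val e s \<noteq> Leaf then exec q c s else exec q d s)"
| "exec q (While e c) s = while_time e (exec q c) s"

text \<open>Input and output are passed in variable 0.\<close>

definition run :: "(dat \<Rightarrow> (dat \<times> nat) spmf) \<Rightarrow> com \<Rightarrow> dat \<Rightarrow> (dat \<times> nat) spmf" where
  "run q c v = map_spmf (\<lambda>(s, t). (s 0, t)) (exec q c ((\<lambda>_. Leaf)(0 := v)))"

primrec deterministic :: "com \<Rightarrow> bool" where
  "deterministic (Assign x e) \<longleftrightarrow> True"
| "deterministic (Flip x) \<longleftrightarrow> False"
| "deterministic (Call x e) \<longleftrightarrow> False"
| "deterministic (Seq c d) \<longleftrightarrow> deterministic c \<and> deterministic d"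
| "deterministic (Cond e c d) \<longleftrightarrow> deterministic c \<and> deterministic d"
| "deterministic (While e c) \<longleftrightarrow> deterministic c"

text \<open>A deterministic program has no calls, so the meaning of its subroutine is immaterial.\<close>

definition run_det :: "com \<Rightarrow> dat \<Rightarrow> (dat \<times> nat) spmf" where
  "run_det c = run (\<lambda>_. return_pmf None) c"


section \<open>Formulas, constraints and their encodings\<close>

text \<open>
  The variables are \<open>0, \<dots>, n - 1\<close>, and a full assignment is a Boolean list of
  length \<open>n\<close>.  The literal \<open>(i, b)\<close> is true iff variable \<open>i\<close> has value \<open>b\<close>.
\<close>

type_synonym literal = "nat \<times> bool"
type_synonym cnf = "literal set set"

definition is_kcnf :: "nat \<Rightarrow> nat \<Rightarrow> cnf \<Rightarrow> bool" where
  "is_kcnf k n \<Phi> \<longleftrightarrow> (\<forall>c\<in>\<Phi>. finite c \<and> card c \<le> k \<and> (\<forall>(i, b)\<in>c. i < n))"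

definition satisfies :: "bool list \<Rightarrow> cnf \<Rightarrow> bool" where
  "satisfies a \<Phi> \<longleftrightarrow> (\<forall>c\<in>\<Phi>. \<exists>(i, b)\<in>c. a ! i = b)"

definition extends :: "bool list \<Rightarrow> bool option list \<Rightarrow> bool" where
  "extends a \<rho> \<longleftrightarrow>
     length a = length \<rho> \<and> (\<forall>i<length \<rho>. \<rho> ! i = None \<or> \<rho> ! i = Some (a ! i))"

definition enc_list :: "('a \<Rightarrow> dat) \<Rightarrow> 'a list \<Rightarrow> dat" where
  "enc_list f xs = foldr (\<lambda>x. Node (f x)) xs Leaf"

primrec enc_option :: "('a \<Rightarrow> dat) \<Rightarrow> 'a option \<Rightarrow> dat" where
  "enc_option f None = Leaf"
| "enc_option f (Some x) = Node (f x) Leaf"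

primrec enc_nat :: "nat \<Rightarrow> dat" where
  "enc_nat 0 = Leaf"
| "enc_nat (Suc n) = Node Leaf (enc_nat n)"

definition enc_literal :: "literal \<Rightarrow> dat" where
  "enc_literal = (\<lambda>(i, b). Node (enc_nat i) (enc_bool b))"

definition enc_partial :: "bool option list \<Rightarrow> dat" where
  "enc_partial = enc_list (enc_option enc_bool)"

definition enc_result :: "bool list option \<Rightarrow> dat" where
  "enc_result = enc_option (enc_list enc_bool)"

text \<open>
  A formula is written down as a list, in any order, of its clauses, and these as lists of their
  literals.  Nothing is listed twice, so that for fixed \<open>k\<close> the size of the input is polynomial
  in \<open>n\<close>.
\<close>

definition lists_cnf :: "literal list list \<Rightarrow> cnf \<Rightarrow> bool" where
  "lists_cnf F \<Phi> \<longleftrightarrow>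
     set ` set F = \<Phi> \<and> distinct (map set F) \<and> (\<forall>c\<in>set F. distinct c)"

definition enc_input :: "nat \<Rightarrow> literal list list \<Rightarrow> dat" where
  "enc_input n F = Node (enc_nat n) (enc_list (enc_list enc_literal) F)"


section \<open>Easy constraints\<close>

text \<open>
  \<open>extension_search t n C Q\<close>: the program \<open>Q\<close> solves the extension problem of the constraint
  \<open>C\<close> on \<open>n\<close> variables in time at most \<open>t\<close>; so \<open>C\<close> is \<open>t\<close>-easy iff such a \<open>Q\<close> exists.  The values of \<open>C\<close> on lists of other lengths
  play no role.
\<close>

definition extension_search :: "real \<Rightarrow> nat \<Rightarrow> (bool list \<Rightarrow> bool) \<Rightarrow> com \<Rightarrow> bool" where
  "extension_search t n C Q \<longleftrightarrow> deterministic Q \<and>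
     (\<forall>\<rho>. length \<rho> = n \<longrightarrow>
        (\<exists>r u. run_det Q (enc_partial \<rho>) = return_spmf (enc_result r, u) \<and> real u \<le> t \<and>
           (case r of
              Some a \<Rightarrow> extends a \<rho> \<and> C a
            | None \<Rightarrow> \<not> (\<exists>a. extends a \<rho> \<and> C a))))"


section \<open>Randomized search algorithms\<close>

text \<open>
  \<open>D\<close> is the distribution of output and running time, and \<open>S\<close> is the set of solutions.  The time
  bound holds for all coin flips, the algorithm never outputs a wrong solution, and it finds a
  solution with probability at least 2/3 if there is one.
\<close>

definition randomized_search :: "(dat \<times> nat) spmf \<Rightarrow> real \<Rightarrow> bool list set \<Rightarrow> bool" where
  "randomized_search D t S \<longleftrightarrow>
     lossless_spmf D \<and>
     (\<forall>(v, u)\<in>set_spmf D. real u \<le> t \<and> (v = enc_result None \<or> (\<exists>a\<in>S. v = enc_result (Some a)))) \<and>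
     (S \<noteq> {} \<longrightarrow>
        measure (measure_spmf D) {(v, u). \<exists>a\<in>S. v = enc_result (Some a)} \<ge> 2 / 3)"

end

theory Submission
  imports Defs
begin

text \<open>
  One round assigns to every variable an independent word \<open>(key, guess)\<close> with a uniform key below
  \<open>A = 2 ^ m\<close>.  Variables with key below \<open>S\<close> are left unassigned and their literals are deleted.  The
  others are processed in the order of their keys as in the algorithm of Paturi, Pudlak and Zane: a
  variable in a unit clause is set accordingly, any other variable gets its guess.  One call then
  extends the resulting partial assignment to satisfy \<open>C\<close>, and the answer is checked.

  Fix a solution \<open>a\<close>.  The sets \<open>J\<close> such that \<open>a\<close> restricted to the complement of \<open>J\<close> still satisfies the
  formula form a down-set.  If \<open>J\<close> is the set of unassigned variables, a variable \<open>x\<close> for which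
  \<open>insert x J\<close> leaves the down-set is critical in the remaining formula, hence forced with
  probability about \<open>1 / k\<close>.  By Jensen's inequality and an induction over the ground set of
  the down-set, a round outputs a solution with probability at least \<open>((A + S) / (2 * A)) ^ n\<close> provided that
  \<open>(A + S) / (A - S) \<le> 2 powr (1 / k)\<close>, up to an arbitrarily small error in \<open>1 / k\<close>.  In the limit
  \<open>(A + S) / (2 * A)\<close> is \<open>1 / (1 + 2 powr (- 1 / k))\<close>, which by a bound on \<open>cosh\<close> is larger than
  \<open>2 powr ((k - 1) / (2 * k\<^sup>2) - 1)\<close>.  Repeating the round about as often as the
  inverse of the success probability gives the theorem.
\<close>

section \<open>Polynomially bounded functions\<close>

text \<open>The classical analysis of the Paturi-Pudlak-Zane algorithm sums over all satisfying
  assignments, so that many solutions make up for few critical variables. Here \<open>C\<close> may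
  exclude all of them but one, and a single \<open>a\<close> has to be hit. The other solutions are
  replaced by the subcubes through \<open>a\<close> on which the formula stays true: their free
  directions can be left to the call and cost no guess.

  Put \<open>K = A - S\<close>. A set \<open>J\<close> is left open by
  \<open>S ^ card J * K ^ (n - card J)\<close> choices of keys, and the guesses on \<open>J\<close>
  are then arbitrary, as are those of forced variables. So the good ones among all
  \<open>(2 * A) ^ n\<close> words are counted by a sum over the down-set with a factor
  \<open>2 * S / K\<close> per open variable and about \<open>2 powr (1 / k)\<close> per critical
  one. The condition on \<open>(A + S) / (A - S)\<close> says that a direction that is blocked gains
  at least as much as one that can be opened.

  Time is bounded for all coin flips, so keys come from a finite range of dyadic size. Ties between
  keys count as failures; they cause the error in \<open>1 / k\<close>. The number of rounds is
  exponential in \<open>n\<close>, so it must not be written in unary; a tree with shared subtrees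
  represents it.\<close>

definition poly_bounded :: "(nat \<Rightarrow> nat) \<Rightarrow> bool" where
  "poly_bounded p \<longleftrightarrow> (\<exists>c d. \<forall>n. p n \<le> c * (n + 1) ^ d)"

lemma poly_bounded_const: "poly_bounded (\<lambda>n. a)"
  unfolding poly_bounded_def by (rule exI[of _ a], rule exI[of _ 0]) simp

lemma poly_bounded_id: "poly_bounded (\<lambda>n. n)"
  unfolding poly_bounded_def by (rule exI[of _ 1], rule exI[of _ 1]) simp

lemma poly_bounded_add:
  assumes "poly_bounded p" and "poly_bounded r"
  shows "poly_bounded (\<lambda>n. p n + r n)"
proof -
  obtain c d c' d' where p: "\<And>n. p n \<le> c * (n + 1) ^ d" and r: "\<And>n. r n \<le> c' * (n + 1) ^ d'"
    using assms unfolding poly_bounded_def by blast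
  have "p n + r n \<le> (c + c') * (n + 1) ^ (d + d')" for n
  proof -
    have "c * (n + 1) ^ d \<le> c * (n + 1) ^ (d + d')" "c' * (n + 1) ^ d' \<le> c' * (n + 1) ^ (d + d')"
      by (intro mult_left_mono power_increasing; simp)+
    then show ?thesis using p[of n] r[of n] unfolding add_mult_distrib by linarith
  qed
  then show ?thesis unfolding poly_bounded_def by blast
qed

lemma poly_bounded_mult:
  assumes "poly_bounded p" and "poly_bounded r"
  shows "poly_bounded (\<lambda>n. p n * r n)"
proof -
  obtain c d c' d' where p: "\<And>n. p n \<le> c * (n + 1) ^ d" and r: "\<And>n. r n \<le> c' * (n + 1) ^ d'"
    using assms unfolding poly_bounded_def by blast
  have "p n * r n \<le> (c * c') * (n + 1) ^ (d + d')" for n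
    using mult_mono[OF p[of n] r[of n]] by (simp add: power_add algebra_simps)
  then show ?thesis unfolding poly_bounded_def by blast
qed

lemma poly_bounded_power: "poly_bounded p \<Longrightarrow> poly_bounded (\<lambda>n. p n ^ j)"
  by (induction j) (simp_all add: poly_bounded_const poly_bounded_mult)

lemmas poly_bounded_intros =
  poly_bounded_const poly_bounded_id poly_bounded_add poly_bounded_mult poly_bounded_power


section \<open>Deterministic execution\<close>

text \<open>The meaning of the subroutine is quantified inside, so facts about call-free parts can
  be used in the randomized program, where calls mean \<open>Q\<close>.\<close>

definition det_exec :: "com \<Rightarrow> store \<Rightarrow> store \<Rightarrow> nat \<Rightarrow> bool" where
  "det_exec c s s' t \<longleftrightarrow> (\<forall>q. exec q c s = return_spmf (s', t))"

lemma bind_time_return [simp]: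
  "bind_time (return_spmf (a, t)) f = map_spmf (\<lambda>(b, u). (b, t + u)) (f a)"
  by (simp add: bind_time_def map_spmf_conv_bind_spmf split_def)

lemma det_Assign: "det_exec (Assign x e) s (s(x := val e s)) (1 + cost e)"
  by (simp add: det_exec_def)

lemma det_Seq:
  "det_exec c s s' t \<Longrightarrow> det_exec d s' s'' u \<Longrightarrow> det_exec (Seq c d) s s'' (t + u)"
  by (simp add: det_exec_def)

lemma det_Cond:
  "det_exec (if val e s \<noteq> Leaf then c else d) s s' t \<Longrightarrow> det_exec (Cond e c d) s s' (1 + cost e + t)"
  by (simp add: det_exec_def split: if_splits)

text \<open>Phrases the unfolding of a loop through \<open>exec\<close> alone, so that
  \<open>while_time\<close> does not occur in any later argument.\<close>

lemma exec_While:
  "exec q (While e c) s = bind_time (return_spmf (s, 1 + cost e))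
       (\<lambda>s. if val e s \<noteq> Leaf then bind_time (exec q c s) (exec q (While e c))
            else return_spmf (s, 0))"
proof -
  have w: "exec q (While e c) = while_time e (exec q c)" by (rule ext) (simp only: exec.simps)
  show ?thesis unfolding w by (rule while_time.simps)
qed

lemma det_While_false: "val e s = Leaf \<Longrightarrow> det_exec (While e c) s s (1 + cost e)"
  unfolding det_exec_def by (rule allI, subst exec_While) simp

lemma det_While_true:
  assumes "val e s \<noteq> Leaf" and "det_exec c s s' t" and "det_exec (While e c) s' s'' u"
  shows "det_exec (While e c) s s'' (1 + cost e + (t + u))"
proof -
  have "exec q (While e c) s = return_spmf (s'', 1 + cost e + (t + u))" for q
    using assms by (subst exec_While) (simp add: det_exec_def)
  then show ?thesis unfolding det_exec_def by blast
qed

section \<open>A calculus of polynomial-time programs\<close>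

definition enc_pair :: "('a \<Rightarrow> dat) \<Rightarrow> ('b \<Rightarrow> dat) \<Rightarrow> 'a \<times> 'b \<Rightarrow> dat" where
  "enc_pair ea eb p = Node (ea (fst p)) (eb (snd p))"

lemma enc_list_simps [simp]:
  "enc_list f [] = Leaf" "enc_list f (x # xs) = Node (f x) (enc_list f xs)"
  by (simp_all add: enc_list_def)

lemma enc_list_eq_Leaf [simp]: "enc_list f xs = Leaf \<longleftrightarrow> xs = []"
  by (cases xs) simp_all

lemma enc_bool_eq_Leaf [simp]: "enc_bool b = Leaf \<longleftrightarrow> \<not> b"
  by (cases b) simp_all

text \<open>
  \<open>ptime ea V f eb\<close>: for inputs of size parameter \<open>n\<close> satisfying \<open>V n\<close>, the function \<open>f\<close> is
  computed, with respect to the encodings \<open>ea\<close> and \<open>eb\<close>, in time polynomial in \<open>n\<close>.  Since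
  input and output sit in an arbitrary register \<open>m\<close> and the registers below \<open>m\<close> are preserved,
  such programs compose.
\<close>

definition ptime ::
  "('a \<Rightarrow> dat) \<Rightarrow> (nat \<Rightarrow> 'a \<Rightarrow> bool) \<Rightarrow> ('a \<Rightarrow> 'b) \<Rightarrow> ('b \<Rightarrow> dat) \<Rightarrow> bool" where
  "ptime ea V f eb \<longleftrightarrow> (\<forall>m. \<exists>c p. poly_bounded p \<and>
     (\<forall>n a s. V n a \<longrightarrow> s m = ea a \<longrightarrow>
        (\<exists>s' t. det_exec c s s' t \<and> s' m = eb (f a) \<and> (\<forall>j<m. s' j = s j) \<and> t \<le> p n)))"

lemma ptimeI:
  assumes "poly_bounded p"
    and "\<And>n a s. V n a \<Longrightarrow> s m = ea a \<Longrightarrow>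
       \<exists>s' t. det_exec (c m) s s' t \<and> s' m = eb (f a) \<and> (\<forall>j<m. s' j = s j) \<and> t \<le> p n"
  shows "\<exists>c p. poly_bounded p \<and>
     (\<forall>n a s. V n a \<longrightarrow> s m = ea a \<longrightarrow>
        (\<exists>s' t. det_exec c s s' t \<and> s' m = eb (f a) \<and> (\<forall>j<m. s' j = s j) \<and> t \<le> p n))"
  by (rule exI[of _ "c m"], rule exI[of _ p], intro conjI allI impI)
    (rule assms, assumption?)+

lemma ptimeE:
  assumes "ptime ea V f eb"
  obtains c p where "poly_bounded p"
    and "\<And>n a s. V n a \<Longrightarrow> s m = ea a \<Longrightarrow>
       \<exists>s' t. det_exec c s s' t \<and> s' m = eb (f a) \<and> (\<forall>j<m. s' j = s j) \<and> t \<le> p n"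
proof -
  from assms[unfolded ptime_def, THEN spec, of m] show thesis
    by (elim exE conjE) (rule that, assumption, blast)
qed

text \<open>The program stays the same and only the reading of its output changes. Options, lists
  and unary numbers are obtained in this way from pairs and lists that are encoded by the same
  tree.\<close>

lemma ptime_recode:
  assumes f: "ptime ea V f eb" and "\<And>n a. W n a \<Longrightarrow> V n a \<and> eb (f a) = ec (g a)"
  shows "ptime ea W g ec"
  unfolding ptime_def
proof
  fix m
  obtain c p where p: "poly_bounded p" and c: "\<And>n a s. V n a \<Longrightarrow> s m = ea a \<Longrightarrow>
       \<exists>s' t. det_exec c s s' t \<and> s' m = eb (f a) \<and> (\<forall>j<m. s' j = s j) \<and> t \<le> p n"
    by (rule ptimeE[OF f, of m]) (rule that)
  show "\<exists>c p. poly_bounded p \<and> (\<forall>n a s. W n a \<longrightarrow> s m = ea a \<longrightarrow>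
      (\<exists>s' t. det_exec c s s' t \<and> s' m = ec (g a) \<and> (\<forall>j<m. s' j = s j) \<and> t \<le> p n))"
  proof (rule ptimeI[OF p])
    fix n a and s :: store
    assume "W n a" "s m = ea a"
    then show "\<exists>s' t. det_exec c s s' t \<and> s' m = ec (g a) \<and> (\<forall>j<m. s' j = s j) \<and> t \<le> p n"
      using c[of n a s] assms(2) by simp
  qed
qed

lemma ptime_comp:
  assumes f: "ptime ea V f eb" and g: "ptime eb W g ec" and VW: "\<And>n a. V n a \<Longrightarrow> W n (f a)"
  shows "ptime ea V (\<lambda>a. g (f a)) ec"
  unfolding ptime_def
proof
  fix m
  obtain c p where p: "poly_bounded p" and c: "\<And>n a s. V n a \<Longrightarrow> s m = ea a \<Longrightarrow>
       \<exists>s' t. det_exec c s s' t \<and> s' m = eb (f a) \<and> (\<forall>j<m. s' j = s j) \<and> t \<le> p n"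
    by (rule ptimeE[OF f, of m]) (rule that)
  obtain d r where r: "poly_bounded r" and d: "\<And>n a s. W n a \<Longrightarrow> s m = eb a \<Longrightarrow>
       \<exists>s' t. det_exec d s s' t \<and> s' m = ec (g a) \<and> (\<forall>j<m. s' j = s j) \<and> t \<le> r n"
    by (rule ptimeE[OF g, of m]) (rule that)
  show "\<exists>c p. poly_bounded p \<and> (\<forall>n a s. V n a \<longrightarrow> s m = ea a \<longrightarrow>
      (\<exists>s' t. det_exec c s s' t \<and> s' m = ec (g (f a)) \<and> (\<forall>j<m. s' j = s j) \<and> t \<le> p n))"
  proof (rule ptimeI[of "\<lambda>n. p n + r n" _ _ _ "\<lambda>m. Seq c d"])
    show "poly_bounded (\<lambda>n. p n + r n)" using p r by (rule poly_bounded_add)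
    fix n a and s :: store
    assume a: "V n a" "s m = ea a"
    obtain s1 t where 1: "det_exec c s s1 t" "s1 m = eb (f a)" "\<forall>j<m. s1 j = s j" "t \<le> p n"
      using c[of n a s, OF a] by blast
    obtain s2 u where 2: "det_exec d s1 s2 u" "s2 m = ec (g (f a))" "\<forall>j<m. s2 j = s1 j" "u \<le> r n"
      using d[of n "f a" s1, OF VW[OF a(1)] 1(2)] by blast
    show "\<exists>s' t. det_exec (Seq c d) s s' t \<and> s' m = ec (g (f a)) \<and> (\<forall>j<m. s' j = s j) \<and> t \<le> p n + r n"
      by (rule exI[of _ s2], rule exI[of _ "t + u"])
        (use 1 2 det_Seq[OF 1(1) 2(1)] in auto)
  qed
qed

lemma ptime_expr:
  assumes "\<And>m n a s. V n a \<Longrightarrow> s m = ea a \<Longrightarrow> val (e m) s = eb (f a)"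
    and "\<And>m. cost (e m) \<le> l"
  shows "ptime ea V f eb"
  unfolding ptime_def
proof
  fix m
  show "\<exists>c p. poly_bounded p \<and> (\<forall>n a s. V n a \<longrightarrow> s m = ea a \<longrightarrow>
      (\<exists>s' t. det_exec c s s' t \<and> s' m = eb (f a) \<and> (\<forall>j<m. s' j = s j) \<and> t \<le> p n))"
  proof (rule ptimeI[of "\<lambda>n. 1 + l" _ _ _ "\<lambda>m. Assign m (e m)"])
    show "poly_bounded (\<lambda>n. 1 + l)" by (rule poly_bounded_const)
    fix n a and s :: store
    assume a: "V n a" "s m = ea a"
    show "\<exists>s' t. det_exec (Assign m (e m)) s s' t \<and> s' m = eb (f a) \<and> (\<forall>j<m. s' j = s j) \<and> t \<le> 1 + l"
      by (rule exI, rule exI, rule conjI[OF det_Assign]) (use assms a in auto)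
  qed
qed

lemma ptime_id: "ptime ea V (\<lambda>a. a) ea"
  by (rule ptime_expr[where e = "\<lambda>m. Var m" and l = 1]) simp_all

primrec const_exp :: "dat \<Rightarrow> exp" where
  "const_exp Leaf = LeafE"
| "const_exp (Node a b) = NodeE (const_exp a) (const_exp b)"

lemma val_const_exp [simp]: "val (const_exp d) s = d"
  by (induction d) simp_all

lemma ptime_const: "ptime ea V (\<lambda>_. d) eb"
  by (rule ptime_expr[where e = "\<lambda>_. const_exp (eb d)" and l = "cost (const_exp (eb d))"]) simp_all

lemma ptime_fst: "ptime ea V f (enc_pair e1 e2) \<Longrightarrow> ptime ea V (\<lambda>a. fst (f a)) e1"
  by (rule ptime_comp[where W = "\<lambda>_ _. True" and g = fst and f = f],
      assumption, rule ptime_expr[where e = "\<lambda>m. LeftE (Var m)" and l = 2])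
    (simp_all add: enc_pair_def)

lemma ptime_snd: "ptime ea V f (enc_pair e1 e2) \<Longrightarrow> ptime ea V (\<lambda>a. snd (f a)) e2"
  by (rule ptime_comp[where W = "\<lambda>_ _. True" and g = snd and f = f],
      assumption, rule ptime_expr[where e = "\<lambda>m. RightE (Var m)" and l = 2])
    (simp_all add: enc_pair_def)

text \<open>The second program runs at base register \<open>m + 2\<close> and hence preserves both
  the input in \<open>m\<close> and the first result in \<open>m + 1\<close>.\<close>

lemma ptime_Pair:
  assumes f: "ptime ea V f eb" and g: "ptime ea V g ec"
  shows "ptime ea V (\<lambda>a. (f a, g a)) (enc_pair eb ec)"
  unfolding ptime_def
proof
  fix m
  obtain c p where p: "poly_bounded p" and c: "\<And>n a s. V n a \<Longrightarrow> s (Suc m) = ea a \<Longrightarrow>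
       \<exists>s' t. det_exec c s s' t \<and> s' (Suc m) = eb (f a) \<and> (\<forall>j<Suc m. s' j = s j) \<and> t \<le> p n"
    by (rule ptimeE[OF f, of "Suc m"]) (rule that)
  obtain d r where r: "poly_bounded r" and d: "\<And>n a s. V n a \<Longrightarrow> s (Suc (Suc m)) = ea a \<Longrightarrow>
       \<exists>s' t. det_exec d s s' t \<and> s' (Suc (Suc m)) = ec (g a) \<and> (\<forall>j<Suc (Suc m). s' j = s j) \<and> t \<le> r n"
    by (rule ptimeE[OF g, of "Suc (Suc m)"]) (rule that)
  let ?c = "Seq (Assign (Suc m) (Var m)) (Seq c (Seq (Assign (Suc (Suc m)) (Var m)) (Seq d
    (Assign m (NodeE (Var (Suc m)) (Var (Suc (Suc m))))))))"
  show "\<exists>c p. poly_bounded p \<and> (\<forall>n a s. V n a \<longrightarrow> s m = ea a \<longrightarrow>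
      (\<exists>s' t. det_exec c s s' t \<and> s' m = enc_pair eb ec (f a, g a) \<and> (\<forall>j<m. s' j = s j) \<and> t \<le> p n))"
  proof (rule ptimeI[of "\<lambda>n. p n + r n + 8" _ _ _ "\<lambda>m. ?c"])
    show "poly_bounded (\<lambda>n. p n + r n + 8)" using p r by (intro poly_bounded_intros)
    fix n a and s :: store
    assume a: "V n a" "s m = ea a"
    let ?s = "s(Suc m := val (Var m) s)"
    obtain s1 t where 1: "det_exec c ?s s1 t" "s1 (Suc m) = eb (f a)" "\<forall>j<Suc m. s1 j = ?s j" "t \<le> p n"
      using c[OF a(1), of ?s] a by auto
    let ?s1 = "s1(Suc (Suc m) := val (Var m) s1)"
    obtain s2 u where 2: "det_exec d ?s1 s2 u" "s2 (Suc (Suc m)) = ec (g a)"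
        "\<forall>j<Suc (Suc m). s2 j = ?s1 j" "u \<le> r n"
      using d[OF a(1), of ?s1] a 1 by auto
    note D = det_Seq[OF det_Assign det_Seq[OF 1(1) det_Seq[OF det_Assign det_Seq[OF 2(1) det_Assign]]]]
    show "\<exists>s' t. det_exec ?c s s' t \<and> s' m = enc_pair eb ec (f a, g a) \<and> (\<forall>j<m. s' j = s j) \<and>
        t \<le> p n + r n + 8"
      by (rule exI, rule exI, rule conjI[OF D]) (use 1 2 in \<open>auto simp: enc_pair_def\<close>)
  qed
qed

text \<open>\<open>Cond\<close> only asks whether a tree is \<open>Leaf\<close>, so a list or an
  option can be the test without being converted to a Boolean first.\<close>

lemma ptime_branch:
  assumes b: "ptime ea V b ed" and f: "ptime ea V f eb" and g: "ptime ea V g eb"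
  shows "ptime ea V (\<lambda>a. if ed (b a) \<noteq> Leaf then f a else g a) eb"
  unfolding ptime_def
proof
  fix m
  obtain cb pb where pb: "poly_bounded pb" and cb: "\<And>n a s. V n a \<Longrightarrow> s (Suc m) = ea a \<Longrightarrow>
       \<exists>s' t. det_exec cb s s' t \<and> s' (Suc m) = ed (b a) \<and> (\<forall>j<Suc m. s' j = s j) \<and> t \<le> pb n"
    by (rule ptimeE[OF b, of "Suc m"]) (rule that)
  obtain c p where p: "poly_bounded p" and c: "\<And>n a s. V n a \<Longrightarrow> s m = ea a \<Longrightarrow>
       \<exists>s' t. det_exec c s s' t \<and> s' m = eb (f a) \<and> (\<forall>j<m. s' j = s j) \<and> t \<le> p n"
    by (rule ptimeE[OF f, of m]) (rule that)
  obtain d r where r: "poly_bounded r" and d: "\<And>n a s. V n a \<Longrightarrow> s m = ea a \<Longrightarrow>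
       \<exists>s' t. det_exec d s s' t \<and> s' m = eb (g a) \<and> (\<forall>j<m. s' j = s j) \<and> t \<le> r n"
    by (rule ptimeE[OF g, of m]) (rule that)
  let ?c = "Seq (Assign (Suc m) (Var m)) (Seq cb (Cond (Var (Suc m)) c d))"
  show "\<exists>c p. poly_bounded p \<and> (\<forall>n a s. V n a \<longrightarrow> s m = ea a \<longrightarrow>
      (\<exists>s' t. det_exec c s s' t \<and> s' m = eb (if ed (b a) \<noteq> Leaf then f a else g a) \<and> (\<forall>j<m. s' j = s j) \<and> t \<le> p n))"
  proof (rule ptimeI[of "\<lambda>n. pb n + p n + r n + 4" _ _ _ "\<lambda>m. ?c"])
    show "poly_bounded (\<lambda>n. pb n + p n + r n + 4)" using pb p r by (intro poly_bounded_intros)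
    fix n a and s :: store
    assume a: "V n a" "s m = ea a"
    let ?s = "s(Suc m := val (Var m) s)"
    obtain s1 t where 1: "det_exec cb ?s s1 t" "s1 (Suc m) = ed (b a)" "\<forall>j<Suc m. s1 j = ?s j"
        "t \<le> pb n"
      using cb[OF a(1), of ?s] a by auto
    have s1: "s1 m = ea a" using 1 a by auto
    have "\<exists>s2 u. det_exec (if val (Var (Suc m)) s1 \<noteq> Leaf then c else d) s1 s2 u \<and>
        s2 m = eb (if ed (b a) \<noteq> Leaf then f a else g a) \<and> (\<forall>j<m. s2 j = s1 j) \<and> u \<le> p n + r n"
      using c[of n a s1, OF a(1) s1] d[of n a s1, OF a(1) s1] 1(2) by (cases "ed (b a) = Leaf") (auto intro: trans_le_add1 trans_le_add2)
    then obtain s2 u where 2: "det_exec (if val (Var (Suc m)) s1 \<noteq> Leaf then c else d) s1 s2 u"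
        "s2 m = eb (if ed (b a) \<noteq> Leaf then f a else g a)" "\<forall>j<m. s2 j = s1 j" "u \<le> p n + r n" by blast
    note D = det_Seq[OF det_Assign det_Seq[OF 1(1) det_Cond[OF 2(1)]]]
    show "\<exists>s' t. det_exec ?c s s' t \<and> s' m = eb (if ed (b a) \<noteq> Leaf then f a else g a) \<and> (\<forall>j<m. s' j = s j) \<and>
        t \<le> pb n + p n + r n + 4"
      by (rule exI, rule exI, rule conjI[OF D]) (use 1 2 in auto)
  qed
qed

lemma ptime_if:
  assumes "ptime ea V b enc_bool" and "ptime ea V f eb" and "ptime ea V g eb"
  shows "ptime ea V (\<lambda>a. if b a then f a else g a) eb"
  by (rule ptime_recode[OF ptime_branch[OF assms]]) simp

lemma ptime_not_Leaf:
  assumes "ptime ea V f ed"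
  shows "ptime ea V (\<lambda>a. ed (f a) \<noteq> Leaf) enc_bool"
  by (rule ptime_recode[OF ptime_branch[OF assms ptime_const[of _ _ True enc_bool] ptime_const[of _ _ False enc_bool]]])
    simp

definition poly_length :: "(nat \<Rightarrow> 'a \<Rightarrow> bool) \<Rightarrow> ('a \<Rightarrow> 'b list) \<Rightarrow> bool" where
  "poly_length V xs \<longleftrightarrow> (\<exists>p. poly_bounded p \<and> (\<forall>n a. V n a \<longrightarrow> length (xs a) \<le> p n))"

lemma ptime_foldl:
  assumes init: "ptime ea V init es" and lst: "ptime ea V lst (enc_list ex)"
    and step: "ptime (enc_pair ea (enc_pair es ex))
      (\<lambda>n e. V n (fst e) \<and> I n (fst e) (fst (snd e)) \<and> snd (snd e) \<in> set (lst (fst e)))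
      (\<lambda>e. h (fst e) (fst (snd e)) (snd (snd e))) es"
    and len: "poly_length V lst"
    and I0: "\<And>n a. V n a \<Longrightarrow> I n a (init a)"
    and IS: "\<And>n a s x. V n a \<Longrightarrow> I n a s \<Longrightarrow> x \<in> set (lst a) \<Longrightarrow> I n a (h a s x)"
  shows "ptime ea V (\<lambda>a. foldl (h a) (init a) (lst a)) es"
  unfolding ptime_def
proof
  fix m
  define m1 where "m1 = Suc m"
  define m2 where "m2 = Suc m1"
  define m3 where "m3 = Suc m2"
  obtain ci pi where pi: "poly_bounded pi" and ci: "\<And>n a s. V n a \<Longrightarrow> s m1 = ea a \<Longrightarrow>
       \<exists>s' t. det_exec ci s s' t \<and> s' m1 = es (init a) \<and> (\<forall>j<m1. s' j = s j) \<and> t \<le> pi n"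
    by (rule ptimeE[OF init, of m1]) (rule that)
  obtain cl pl where pl: "poly_bounded pl" and cl: "\<And>n a s. V n a \<Longrightarrow> s m2 = ea a \<Longrightarrow>
       \<exists>s' t. det_exec cl s s' t \<and> s' m2 = enc_list ex (lst a) \<and> (\<forall>j<m2. s' j = s j) \<and> t \<le> pl n"
    by (rule ptimeE[OF lst, of m2]) (rule that)
  obtain ch ph where ph: "poly_bounded ph" and ch0: "\<And>n e s. V n (fst e) \<and> I n (fst e) (fst (snd e)) \<and>
       snd (snd e) \<in> set (lst (fst e)) \<Longrightarrow> s m3 = enc_pair ea (enc_pair es ex) e \<Longrightarrow>
       \<exists>s' t. det_exec ch s s' t \<and> s' m3 = es (h (fst e) (fst (snd e)) (snd (snd e))) \<and>
         (\<forall>j<m3. s' j = s j) \<and> t \<le> ph n"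
    by (rule ptimeE[OF step, of m3]) (rule that)
  have ch: "\<exists>s' t. det_exec ch s s' t \<and> s' m3 = es (h a st x) \<and> (\<forall>j<m3. s' j = s j) \<and> t \<le> ph n"
    if "V n a" "I n a st" "x \<in> set (lst a)" "s m3 = Node (ea a) (Node (es st) (ex x))" for n a st x s
    using ch0[of n "(a, st, x)" s] that by (simp add: enc_pair_def)
  obtain q where q: "poly_bounded q" "\<And>n a. V n a \<Longrightarrow> length (lst a) \<le> q n"
    using len unfolding poly_length_def by blast
  let ?body = "Seq (Assign m3 (NodeE (Var m) (NodeE (Var m1) (LeftE (Var m2)))))
    (Seq ch (Seq (Assign m1 (Var m3)) (Assign m2 (RightE (Var m2)))))"
  let ?c = "Seq (Assign m1 (Var m)) (Seq ci (Seq (Assign m2 (Var m)) (Seq cl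
    (Seq (While (Var m2) ?body) (Assign m (Var m1))))))"
  \<comment> \<open>Each iteration costs 2 for the guard and 7 + 2 + 3 for the assignments; the last
    2 pays for the failing guard. Register \<open>m\<close> itself is preserved too, since the body
    rereads the input from it.\<close>
  have loop: "\<exists>s' t. det_exec (While (Var m2) ?body) s s' t \<and> s' m1 = es (foldl (h a) st xs) \<and>
      (\<forall>j\<le>m. s' j = s j) \<and> t \<le> length xs * (ph n + 14) + 2"
    if "V n a" "I n a st" "set xs \<subseteq> set (lst a)" "s m = ea a" "s m1 = es st" "s m2 = enc_list ex xs"
    for n a st xs and s :: store
    using that
  proof (induction xs arbitrary: st s)
    case Nil
    have "det_exec (While (Var m2) ?body) s s (1 + cost (Var m2))"
      using Nil by (intro det_While_false) simp
    then show ?case using Nil by (intro exI[of _ s] exI[of _ "1 + cost (Var m2)"]) simp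
  next
    case (Cons x xs)
    let ?s = "s(m3 := val (NodeE (Var m) (NodeE (Var m1) (LeftE (Var m2)))) s)"
    obtain s1 t where 1: "det_exec ch ?s s1 t" "s1 m3 = es (h a st x)" "\<forall>j<m3. s1 j = ?s j" "t \<le> ph n"
      using ch[OF Cons.prems(1,2), of x ?s] Cons.prems by auto
    let ?s1 = "s1(m1 := val (Var m3) s1)"
    let ?s2 = "?s1(m2 := val (RightE (Var m2)) ?s1)"
    have ne: "m \<noteq> m1" "m \<noteq> m2" "m \<noteq> m3" "m1 \<noteq> m2" "m1 \<noteq> m3" "m2 \<noteq> m3" "m < m3" "m1 < m3" "m2 < m3"
      unfolding m1_def m2_def m3_def by simp_all
    have s2: "?s2 m = ea a" "?s2 m1 = es (h a st x)" "?s2 m2 = enc_list ex xs"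
      using 1 Cons.prems ne by (auto)
    have less: "\<And>j. j \<le> m \<Longrightarrow> j < m3 \<and> j < m1 \<and> j < m2" unfolding m1_def m2_def m3_def by simp
    have s2': "\<forall>j\<le>m. ?s2 j = s j" using 1(3) less by fastforce
    obtain s3 u where 3: "det_exec (While (Var m2) ?body) ?s2 s3 u"
        "s3 m1 = es (foldl (h a) (h a st x) xs)" "\<forall>j\<le>m. s3 j = ?s2 j" "u \<le> length xs * (ph n + 14) + 2"
      using Cons.IH[OF Cons.prems(1) IS[OF Cons.prems(1,2)] _ s2] Cons.prems(3)
      by (simp del: fun_upd_apply) blast
    note D = det_While_true[OF _ det_Seq[OF det_Assign det_Seq[OF 1(1) det_Seq[OF det_Assign det_Assign]]] 3(1)]
    show ?case
      by (rule exI, rule exI, rule conjI[OF D]) (use 1(4) 3 s2' Cons.prems in auto)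
  qed
  show "\<exists>c p. poly_bounded p \<and> (\<forall>n a s. V n a \<longrightarrow> s m = ea a \<longrightarrow>
      (\<exists>s' t. det_exec c s s' t \<and> s' m = es (foldl (h a) (init a) (lst a)) \<and> (\<forall>j<m. s' j = s j) \<and> t \<le> p n))"
  proof (rule ptimeI[of "\<lambda>n. pi n + pl n + q n * (ph n + 14) + 8" _ _ _ "\<lambda>m. ?c"])
    show "poly_bounded (\<lambda>n. pi n + pl n + q n * (ph n + 14) + 8)"
      using pi pl q(1) ph by (intro poly_bounded_intros)
    fix n a and s :: store
    assume a: "V n a" "s m = ea a"
    have ne: "m \<noteq> m1" "m \<noteq> m2" "m1 \<noteq> m2" "m < m1" "m1 < m2" "m < m2"
      unfolding m1_def m2_def by simp_all
    let ?s = "s(m1 := val (Var m) s)"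
    obtain s1 t where 1: "det_exec ci ?s s1 t" "s1 m1 = es (init a)" "\<forall>j<m1. s1 j = ?s j" "t \<le> pi n"
      using ci[OF a(1), of ?s] a by auto
    let ?s1 = "s1(m2 := val (Var m) s1)"
    have "?s1 m2 = ea a" using 1(3) a ne by auto
    then obtain s2 u where 2: "det_exec cl ?s1 s2 u" "s2 m2 = enc_list ex (lst a)"
        "\<forall>j<m2. s2 j = ?s1 j" "u \<le> pl n"
      using cl[OF a(1), of ?s1] by auto
    have s2: "s2 m = ea a" "s2 m1 = es (init a)" using 1 2 a ne by auto
    obtain s3 v where 3: "det_exec (While (Var m2) ?body) s2 s3 v" "s3 m1 = es (foldl (h a) (init a) (lst a))"
      "\<forall>j\<le>m. s3 j = s2 j" "v \<le> length (lst a) * (ph n + 14) + 2"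
      using loop[OF a(1) I0[OF a(1)] order_refl s2 2(2)] by blast
    have v: "v \<le> q n * (ph n + 14) + 2"
      using 3(4) mult_le_mono1[OF q(2)[OF a(1)], of "ph n + 14"] by linarith
    note D = det_Seq[OF det_Assign det_Seq[OF 1(1) det_Seq[OF det_Assign det_Seq[OF 2(1)
      det_Seq[OF 3(1) det_Assign]]]]]
    have less: "\<And>j. j < m \<Longrightarrow> j < m1 \<and> j < m2" unfolding m1_def m2_def by simp
    show "\<exists>s' t. det_exec ?c s s' t \<and> s' m = es (foldl (h a) (init a) (lst a)) \<and> (\<forall>j<m. s' j = s j) \<and>
        t \<le> pi n + pl n + q n * (ph n + 14) + 8"
      by (rule exI, rule exI, rule conjI[OF D]) (use 1 2 3 v less in \<open>auto simp: less_imp_le\<close>)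
  qed
qed

lemma ptime_projections:
  "ptime (enc_pair e1 e2) V1 fst e1"
  "ptime (enc_pair e1 e2) V2 snd e2"
  "ptime (enc_pair (enc_pair e1 e2) e3) V3 (\<lambda>e. fst (fst e)) e1"
  "ptime (enc_pair (enc_pair e1 e2) e3) V4 (\<lambda>e. snd (fst e)) e2"
  "ptime (enc_pair e1 (enc_pair e2 e3)) V5 (\<lambda>e. fst (snd e)) e2"
  "ptime (enc_pair e1 (enc_pair e2 e3)) V6 (\<lambda>e. snd (snd e)) e3"
  by (rule ptime_id ptime_fst ptime_snd)+

lemma ptime_not: "ptime ea V b enc_bool \<Longrightarrow> ptime ea V (\<lambda>a. \<not> b a) enc_bool"
  by (rule ptime_recode[OF ptime_if[where f = "\<lambda>_. False" and g = "\<lambda>_. True" and b = b and eb = enc_bool and V = V]])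
    (auto intro: ptime_const)

lemma ptime_conj:
  "ptime ea V b enc_bool \<Longrightarrow> ptime ea V c enc_bool \<Longrightarrow> ptime ea V (\<lambda>a. b a \<and> c a) enc_bool"
  by (rule ptime_recode[OF ptime_if[where f = c and g = "\<lambda>_. False" and b = b and eb = enc_bool and V = V]])
    (auto intro: ptime_const)

lemma ptime_disj:
  "ptime ea V b enc_bool \<Longrightarrow> ptime ea V c enc_bool \<Longrightarrow> ptime ea V (\<lambda>a. b a \<or> c a) enc_bool"
  by (rule ptime_recode[OF ptime_if[where f = "\<lambda>_. True" and g = c and b = b and eb = enc_bool and V = V]])
    (auto intro: ptime_const)

lemma ptime_bool_eq:
  "ptime ea V b enc_bool \<Longrightarrow> ptime ea V c enc_bool \<Longrightarrow> ptime ea V (\<lambda>a. b a = c a) enc_bool"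
  by (rule ptime_recode[OF ptime_if[where f = c and g = "\<lambda>a. \<not> c a" and b = b and eb = enc_bool and V = V]])
    (auto intro: ptime_not)

lemma ptime_Some:
  assumes "ptime ea V f eb" shows "ptime ea V (\<lambda>a. Some (f a)) (enc_option eb)"
  by (rule ptime_recode[OF ptime_Pair[OF assms ptime_const[of _ _ Leaf "\<lambda>d. d"]]])
    (simp add: enc_pair_def)

lemma ptime_Cons:
  assumes "ptime ea V x ex" "ptime ea V xs (enc_list ex)"
  shows "ptime ea V (\<lambda>a. x a # xs a) (enc_list ex)"
  by (rule ptime_recode[OF ptime_Pair[OF assms]]) (simp add: enc_pair_def)

lemma ptime_tl:
  assumes "ptime ea V xs (enc_list ex)"
  shows "ptime ea V (\<lambda>a. tl (xs a)) (enc_list ex)"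
proof (rule ptime_comp[where W = "\<lambda>_ _. True", OF assms])
  have "right (enc_list ex ys) = enc_list ex (tl ys)" for ys by (cases ys) simp_all
  then show "ptime (enc_list ex) (\<lambda>_ _. True) tl (enc_list ex)"
    by (intro ptime_expr[where e = "\<lambda>m. RightE (Var m)" and l = 2]) simp_all
qed simp

lemma ptime_hd:
  assumes "ptime ea V xs (enc_list ex)" and "\<And>n a. V n a \<Longrightarrow> xs a \<noteq> []"
  shows "ptime ea V (\<lambda>a. hd (xs a)) ex"
proof (rule ptime_comp[where W = "\<lambda>_ ys. ys \<noteq> []", OF assms(1)])
  have "left (enc_list ex ys) = ex (hd ys)" if "ys \<noteq> []" for ys using that by (cases ys) simp_all
  then show "ptime (enc_list ex) (\<lambda>_ ys. ys \<noteq> []) hd ex"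
    by (intro ptime_expr[where e = "\<lambda>m. LeftE (Var m)" and l = 2]) simp_all
qed (rule assms)

lemma ptime_Nil: "ptime ea V xs (enc_list ex) \<Longrightarrow> ptime ea V (\<lambda>a. xs a = []) enc_bool"
  using ptime_not[OF ptime_not_Leaf[of ea V xs "enc_list ex"]] by simp

lemma ptime_rev:
  assumes xs: "ptime ea V xs (enc_list ex)" and len: "poly_length V xs"
  shows "ptime ea V (\<lambda>a. rev (xs a)) (enc_list ex)"
proof -
  have rev: "foldl (\<lambda>s x. x # s) ys zs = rev zs @ ys" for ys zs :: "'b list"
    by (induction zs arbitrary: ys) simp_all
  have "ptime ea V (\<lambda>a. foldl (\<lambda>s x. x # s) [] (xs a)) (enc_list ex)"
    by (rule ptime_foldl[where I = "\<lambda>_ _ _. True", OF ptime_const xs _ len])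
      (auto intro!: ptime_Cons intro: ptime_projections)
  then show ?thesis by (simp add: rev)
qed

lemma poly_length_rev [simp]: "poly_length V (\<lambda>a. rev (xs a)) \<longleftrightarrow> poly_length V xs"
  by (simp add: poly_length_def)

lemma ptime_map:
  assumes xs: "ptime ea V xs (enc_list ex)" and len: "poly_length V xs"
    and h: "ptime (enc_pair ea ex) (\<lambda>n e. V n (fst e) \<and> snd e \<in> set (xs (fst e)))
      (\<lambda>e. h (fst e) (snd e)) ey"
  shows "ptime ea V (\<lambda>a. map (h a) (xs a)) (enc_list ey)"
proof -
  have rev: "foldl (\<lambda>s x. g x # s) ys zs = map g (rev zs) @ ys" for ys zs and g :: "'b \<Rightarrow> 'c"
    by (induction zs arbitrary: ys) simp_all
  have h': "ptime (enc_pair ea (enc_pair (enc_list ey) ex))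
      (\<lambda>n e. V n (fst e) \<and> snd (snd e) \<in> set (xs (fst e)))
      (\<lambda>e. h (fst e) (snd (snd e))) ey"
    by (rule ptime_comp[OF _ h, where f = "\<lambda>e. (fst e, snd (snd e))", simplified])
      (auto intro!: ptime_Pair intro: ptime_projections)
  have "ptime ea V (\<lambda>a. foldl (\<lambda>s x. h a x # s) [] (rev (xs a))) (enc_list ey)"
    by (rule ptime_foldl[where I = "\<lambda>_ _ _. True" and h = "\<lambda>a s x. h a x # s", OF ptime_const ptime_rev[OF xs len]])
      (auto intro!: ptime_Cons h' intro: ptime_projections simp: len)
  then show ?thesis by (simp add: rev)
qed

lemma ptime_list_ex:
  assumes xs: "ptime ea V xs (enc_list ex)" and len: "poly_length V xs"
    and h: "ptime (enc_pair ea ex) (\<lambda>n e. V n (fst e) \<and> snd e \<in> set (xs (fst e)))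
      (\<lambda>e. h (fst e) (snd e)) enc_bool"
  shows "ptime ea V (\<lambda>a. \<exists>x\<in>set (xs a). h a x) enc_bool"
proof -
  have ex: "foldl (\<lambda>s x. s \<or> g x) s zs \<longleftrightarrow> s \<or> (\<exists>x\<in>set zs. g x)" for s zs and g :: "'b \<Rightarrow> bool"
    by (induction zs arbitrary: s) auto
  have h': "ptime (enc_pair ea (enc_pair enc_bool ex))
      (\<lambda>n e. V n (fst e) \<and> snd (snd e) \<in> set (xs (fst e)))
      (\<lambda>e. h (fst e) (snd (snd e))) enc_bool"
    by (rule ptime_comp[OF _ h, where f = "\<lambda>e. (fst e, snd (snd e))", simplified])
      (auto intro!: ptime_Pair intro: ptime_projections)
  have "ptime ea V (\<lambda>a. foldl (\<lambda>s x. s \<or> h a x) False (xs a)) enc_bool"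
    by (rule ptime_foldl[where I = "\<lambda>_ _ _. True" and h = "\<lambda>a s x. s \<or> h a x", OF ptime_const xs _ len])
      (auto intro!: ptime_disj h' intro: ptime_projections)
  then show ?thesis by (simp add: ex)
qed

lemma ptime_list_all:
  assumes xs: "ptime ea V xs (enc_list ex)" and len: "poly_length V xs"
    and h: "ptime (enc_pair ea ex) (\<lambda>n e. V n (fst e) \<and> snd e \<in> set (xs (fst e)))
      (\<lambda>e. h (fst e) (snd e)) enc_bool"
  shows "ptime ea V (\<lambda>a. \<forall>x\<in>set (xs a). h a x) enc_bool"
  using ptime_not[OF ptime_list_ex[OF xs len ptime_not[OF h]]] by simp

section \<open>Unary numbers and random access to lists\<close>

lemma enc_nat_conv_list: "enc_nat i = enc_list (\<lambda>_. Leaf) (replicate i ())"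
  by (induction i) simp_all

lemma ptime_nat_list:
  "ptime ea V i enc_nat \<Longrightarrow> ptime ea V (\<lambda>a. replicate (i a) ()) (enc_list (\<lambda>_. Leaf))"
  by (erule ptime_recode) (simp add: enc_nat_conv_list)

definition poly_size :: "(nat \<Rightarrow> 'a \<Rightarrow> bool) \<Rightarrow> ('a \<Rightarrow> nat) \<Rightarrow> bool" where
  "poly_size V i \<longleftrightarrow> (\<exists>p. poly_bounded p \<and> (\<forall>n a. V n a \<longrightarrow> i a \<le> p n))"

lemma poly_length_conv_size: "poly_length V xs \<longleftrightarrow> poly_size V (\<lambda>a. length (xs a))"
  by (simp add: poly_length_def poly_size_def)

lemma poly_sizeI: "poly_bounded p \<Longrightarrow> (\<And>n a. V n a \<Longrightarrow> i a \<le> p n) \<Longrightarrow> poly_size V i"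
  unfolding poly_size_def by blast

text \<open>A unary number is the same tree as a list of units, so iteration is a fold that ignores
  the elements. The step has to be polynomial in \<open>n\<close> for every state, whatever its
  size.\<close>

lemma ptime_iterate:
  assumes i: "ptime ea V i enc_nat" and bd: "poly_size V i" and f: "ptime ea V f es"
    and h: "ptime (enc_pair ea es) (\<lambda>n e. V n (fst e)) (\<lambda>e. h (fst e) (snd e)) es"
  shows "ptime ea V (\<lambda>a. ((h a) ^^ i a) (f a)) es"
proof -
  have iter: "foldl (\<lambda>s _. g s) s (replicate j ()) = (g ^^ j) s" for g :: "'b \<Rightarrow> 'b" and s j
    by (induction j arbitrary: s) (simp_all add: funpow_swap1)
  have h': "ptime (enc_pair ea (enc_pair es (\<lambda>_. Leaf)))
      (\<lambda>n e. V n (fst e) \<and> True \<and> snd (snd e) \<in> set (replicate (i (fst e)) ()))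
      (\<lambda>e. h (fst e) (fst (snd e))) es"
    by (rule ptime_comp[OF _ h, where f = "\<lambda>e. (fst e, fst (snd e))", simplified])
      (auto intro!: ptime_Pair intro: ptime_projections)
  have "ptime ea V (\<lambda>a. foldl (\<lambda>s _. h a s) (f a) (replicate (i a) ())) es"
    by (rule ptime_foldl[where I = "\<lambda>_ _ _. True" and h = "\<lambda>a s _. h a s", OF f ptime_nat_list[OF i] h'])
      (use bd in \<open>simp_all add: poly_length_conv_size\<close>)
  then show ?thesis by (simp add: iter)
qed

lemma funpow_tl: "(tl ^^ i) xs = drop i xs"
  by (induction i arbitrary: xs) (simp_all add: drop_Suc tl_drop)

lemma ptime_drop:
  assumes "ptime ea V xs (enc_list ex)" "ptime ea V i enc_nat" "poly_size V i"
  shows "ptime ea V (\<lambda>a. drop (i a) (xs a)) (enc_list ex)"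
  using ptime_iterate[OF assms(2,3,1), of "\<lambda>_. tl"]
  by (simp add: funpow_tl ptime_tl ptime_snd[OF ptime_id])

lemma ptime_nth:
  assumes "ptime ea V xs (enc_list ex)" "ptime ea V i enc_nat" "poly_length V xs"
    and i: "\<And>n a. V n a \<Longrightarrow> i a < length (xs a)"
  shows "ptime ea V (\<lambda>a. xs a ! i a) ex"
proof -
  have "poly_size V i"
    using assms(3) i unfolding poly_length_def poly_size_def by (metis less_imp_le order_trans)
  then have "ptime ea V (\<lambda>a. hd (drop (i a) (xs a))) ex"
    by (rule ptime_hd[OF ptime_drop[OF assms(1,2)]]) (use i in \<open>simp add: not_le\<close>)
  then show ?thesis by (rule ptime_recode) (use i in \<open>simp add: hd_drop_conv_nth\<close>)
qed

lemma ptime_Suc: "ptime ea V i enc_nat \<Longrightarrow> ptime ea V (\<lambda>a. Suc (i a)) enc_nat"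
  by (rule ptime_recode[where V = V, OF ptime_Pair[OF ptime_const[of _ _ Leaf "\<lambda>d. d"], where g = i and ec = enc_nat]])
    (auto simp: enc_pair_def)

lemma ptime_nat_eq:
  assumes i: "ptime ea V i enc_nat" and j: "ptime ea V j enc_nat" and bd: "poly_size V i"
  shows "ptime ea V (\<lambda>a. i a = j a) enc_bool"
proof -
  \<comment> \<open>Removing \<open>i\<close> out of \<open>j + 1\<close> units leaves exactly one
    unit iff \<open>i = j\<close>. Only \<open>i\<close> counts iterations, hence only
    \<open>i\<close> needs a bound.\<close>
  let ?z = "\<lambda>a. drop (i a) (replicate (Suc (j a)) ())"
  have z: "ptime ea V ?z (enc_list (\<lambda>_. Leaf))"
    by (rule ptime_drop[OF ptime_nat_list[OF ptime_Suc[OF j]] i bd])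
  have "ptime ea V (\<lambda>a. \<not> ?z a = [] \<and> tl (?z a) = []) enc_bool"
    by (intro ptime_conj ptime_not ptime_Nil[OF z] ptime_Nil[OF ptime_tl[OF z]])
  moreover have "(\<not> ?z a = [] \<and> tl (?z a) = []) = (i a = j a)" for a by (auto simp: tl_drop)
  ultimately show ?thesis by simp
qed

lemma ptime_replicate:
  assumes i: "ptime ea V i enc_nat" and bd: "poly_size V i" and x: "ptime ea V x ex"
  shows "ptime ea V (\<lambda>a. replicate (i a) (x a)) (enc_list ex)"
proof -
  have "((\<lambda>xs. y # xs) ^^ j) [] = replicate j y" for y :: 'b and j by (induction j) simp_all
  moreover have "ptime ea V (\<lambda>a. ((\<lambda>xs. x a # xs) ^^ i a) []) (enc_list ex)"
    by (rule ptime_iterate[where h = "\<lambda>a xs. x a # xs", OF i bd ptime_const])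
      (intro ptime_Cons ptime_snd[OF ptime_id] ptime_comp[OF ptime_fst[OF ptime_id] x])
  ultimately show ?thesis by simp
qed

lemma ptime_upt:
  assumes i: "ptime ea V i enc_nat" and bd: "poly_size V i"
  shows "ptime ea V (\<lambda>a. [0..<i a]) (enc_list enc_nat)"
proof -
  have "((\<lambda>(j, xs). (j + 1, j # xs)) ^^ m) (0, []) = (m, rev [0..<m])" for m :: nat
    by (induction m) simp_all
  then have iter: "((\<lambda>p. (Suc (fst p), fst p # snd p)) ^^ m) (0, []) = (m, rev [0..<m])" for m
    by (simp add: case_prod_beta')
  have "ptime ea V (\<lambda>a. ((\<lambda>p. (Suc (fst p), fst p # snd p)) ^^ i a) (0, [])) (enc_pair enc_nat (enc_list enc_nat))"
    by (rule ptime_iterate[where h = "\<lambda>a p. (Suc (fst p), fst p # snd p)", OF i bd ptime_const])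
      (intro ptime_Pair ptime_Suc ptime_Cons; auto intro: ptime_projections)
  then have "ptime ea V (\<lambda>a. rev [0..<i a]) (enc_list enc_nat)"
    unfolding iter by (auto dest: ptime_snd)
  from ptime_rev[OF this] show ?thesis using bd by (simp add: poly_length_conv_size)
qed

text \<open>The list is rebuilt by a map over all its indices; this is why its length has to be
  available as an encoded number \<open>l\<close>.\<close>

lemma ptime_list_update:
  assumes "ptime ea V xs (enc_list ex)" "ptime ea V i enc_nat" "ptime ea V y ex"
    "ptime ea V l enc_nat" and bd: "poly_size V l" and l: "\<And>n a. V n a \<Longrightarrow> length (xs a) = l a"
  shows "ptime ea V (\<lambda>a. (xs a)[i a := y a]) (enc_list ex)"
proof -
  let ?W = "\<lambda>n e. V n (fst e) \<and> snd e \<in> set [0..<l (fst e)]"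
  obtain p where p: "poly_bounded p" "\<And>n a. V n a \<Longrightarrow> l a \<le> p n"
    using bd unfolding poly_size_def by blast
  have lift: "ptime (enc_pair ea enc_nat) ?W (\<lambda>e. f (fst e)) eb" if "ptime ea V f eb"
    for f and eb :: "'c \<Rightarrow> dat"
    by (rule ptime_comp[OF ptime_fst[OF ptime_id] that]) simp
  have "ptime (enc_pair ea enc_nat) ?W
      (\<lambda>e. if snd e = i (fst e) then y (fst e) else xs (fst e) ! snd e) ex"
  proof (intro ptime_if ptime_nat_eq ptime_nth)
    show "poly_size ?W snd" using p by (intro poly_sizeI[of p]) (auto dest!: p(2))
    show "poly_length ?W (\<lambda>e. xs (fst e))"
      unfolding poly_length_conv_size using p l by (intro poly_sizeI[of p]) auto
  qed (auto simp: l intro: ptime_snd[OF ptime_id] ptime_comp[OF ptime_fst[OF ptime_id] assms(1)]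
        ptime_comp[OF ptime_fst[OF ptime_id] assms(2)] ptime_comp[OF ptime_fst[OF ptime_id] assms(3)])
  then have "ptime ea V (\<lambda>a. map (\<lambda>j. if j = i a then y a else xs a ! j) [0..<l a]) (enc_list ex)"
    by (intro ptime_map[where h = "\<lambda>a j. if j = i a then y a else xs a ! j", OF ptime_upt[OF assms(4) bd]])
      (simp_all add: poly_length_conv_size bd)
  then show ?thesis
  proof (rule ptime_recode)
    fix n a assume V: "V n a"
    have "map (\<lambda>j. if j = i a then y a else xs a ! j) [0..<l a] = (xs a)[i a := y a]"
      by (rule nth_equalityI) (auto simp: l[OF V] nth_list_update)
    then show "V n a \<and> enc_list ex (map (\<lambda>j. if j = i a then y a else xs a ! j) [0..<l a]) =
        enc_list ex ((xs a)[i a := y a])" using V by simp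
  qed
qed

text \<open>Compares \<open>i\<close> with each member of a constant list. In these equality tests
  the bounded side is the list element, so \<open>i\<close> may be arbitrarily large.\<close>

lemma ptime_less_const:
  assumes i: "ptime ea V i enc_nat"
  shows "ptime ea V (\<lambda>a. i a < N) enc_bool"
proof -
  have "ptime ea V (\<lambda>a. \<exists>v\<in>set [0..<N]. v = i a) enc_bool"
  proof (rule ptime_list_ex[OF ptime_const])
    show "poly_length V (\<lambda>_. [0..<N])"
      unfolding poly_length_conv_size by (rule poly_sizeI[OF poly_bounded_const[of N]]) simp
    show "ptime (enc_pair ea enc_nat) (\<lambda>n e. V n (fst e) \<and> snd e \<in> set [0..<N])
        (\<lambda>e. snd e = i (fst e)) enc_bool"
      by (rule ptime_nat_eq[OF _ ptime_comp[OF ptime_projections(1) i]], rule ptime_projections, simp,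
          rule poly_sizeI[OF poly_bounded_const[of N]], simp)
  qed
  then show ?thesis by simp
qed

lemma ptime_eq_Some:
  assumes f: "ptime ea V f (enc_option enc_bool)" and b: "ptime ea V b enc_bool"
  shows "ptime ea V (\<lambda>a. f a = Some (b a)) enc_bool"
proof -
  have N: "enc_option enc_bool x \<noteq> Leaf \<longleftrightarrow> x \<noteq> None" for x :: "bool option" by (cases x) simp_all
  \<comment> \<open>As \<open>left Leaf = Leaf\<close>, this yields false for \<open>None\<close> as
    well as for \<open>Some False\<close>, which is why a separate test for \<open>None\<close>
    accompanies it below.\<close>
  have L: "left (enc_option enc_bool x) = enc_bool (x = Some True)" for x
    by (cases x) simp_all
  have T: "ptime ea V (\<lambda>a. f a = Some True) enc_bool"
    by (rule ptime_comp[where W = "\<lambda>_ _. True", OF f],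
        rule ptime_expr[where e = "\<lambda>m. LeftE (Var m)" and l = 2]) (simp_all add: L)
  have "ptime ea V (\<lambda>a. f a \<noteq> None \<and> (f a = Some True) = b a) enc_bool"
    using ptime_not_Leaf[OF f] T b unfolding N by (intro ptime_conj ptime_bool_eq)
  moreover have "(f a \<noteq> None \<and> (f a = Some True) = b a) = (f a = Some (b a))" for a
    by (cases "f a") auto
  ultimately show ?thesis by simp
qed

lemma enc_literal_conv_pair: "enc_literal = enc_pair enc_nat enc_bool"
  by (auto simp: enc_literal_def enc_pair_def)

section \<open>Decoding random words\<close>

definition consistent :: "literal list \<Rightarrow> bool" where
  "consistent c \<longleftrightarrow> (\<forall>l\<in>set c. \<forall>l'\<in>set c. fst l \<noteq> fst l' \<or> snd l = snd l')"

type_synonym word = "nat \<times> bool"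

text \<open>
  Under a word \<open>(key, guess)\<close> for each variable, the variables with key less than \<open>S\<close> stay
  unassigned and are treated as making no literal true.  Tautological clauses are skipped, since
  with such a variable they would wrongly become unit clauses.
\<close>

definition unit_clause ::
  "nat \<Rightarrow> literal list \<Rightarrow> word list \<Rightarrow> bool option list \<Rightarrow> nat \<Rightarrow> bool \<Rightarrow> bool" where
  "unit_clause S c w \<rho> i b \<longleftrightarrow> consistent c \<and> (\<exists>l\<in>set c. fst l = i \<and> snd l = b) \<and>
     (\<forall>l\<in>set c. (fst l = i \<and> snd l = b) \<or> fst (w ! fst l) < S \<or> \<rho> ! fst l = Some (\<not> snd l))"

definition forced ::
  "nat \<Rightarrow> literal list list \<Rightarrow> word list \<Rightarrow> bool option list \<Rightarrow> nat \<Rightarrow> bool \<Rightarrow> bool" where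
  "forced S F w \<rho> i b \<longleftrightarrow> (\<exists>c\<in>set F. unit_clause S c w \<rho> i b)"

definition set_var ::
  "nat \<Rightarrow> literal list list \<Rightarrow> word list \<Rightarrow> bool option list \<Rightarrow> nat \<Rightarrow> bool option list" where
  "set_var S F w \<rho> i = \<rho>[i := Some
     (if forced S F w \<rho> i True then True else if forced S F w \<rho> i False then False else snd (w ! i))]"

definition set_vars ::
  "nat \<Rightarrow> nat \<Rightarrow> literal list list \<Rightarrow> word list \<Rightarrow> bool option list \<Rightarrow> nat \<Rightarrow> bool option list" where
  "set_vars S n F w \<rho> v =
     foldl (\<lambda>\<rho> i. if fst (w ! i) = v then set_var S F w \<rho> i else \<rho>) \<rho> [0..<n]"

text \<open>The number of key values is a constant, so one sweep over all variables per value takes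
  the place of sorting. Within a sweep equal keys are handled by index; the analysis relies on
  strictly smaller keys only.\<close>

definition decode :: "nat \<Rightarrow> nat \<Rightarrow> nat \<Rightarrow> literal list list \<Rightarrow> word list \<Rightarrow> bool option list" where
  "decode S A n F w = foldl (set_vars S n F w) (replicate n None) [S..<A]"

definition sat_list :: "literal list list \<Rightarrow> bool list \<Rightarrow> bool" where
  "sat_list F a \<longleftrightarrow> (\<forall>c\<in>set F. \<exists>l\<in>set c. a ! fst l = snd l)"

lemma length_set_var [simp]: "length (set_var S F w \<rho> i) = length \<rho>"
  by (simp add: set_var_def)

lemma length_foldl_invariant:
  "(\<And>s x. length (f s x) = length s) \<Longrightarrow> length (foldl f s xs) = length s"
  by (induction xs arbitrary: s) simp_all

lemma length_set_vars [simp]: "length (set_vars S n F w \<rho> v) = length \<rho>"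
  unfolding set_vars_def by (rule length_foldl_invariant) simp

lemma length_decode [simp]: "length (decode S A n F w) = n"
  unfolding decode_def by (subst length_foldl_invariant) simp_all


section \<open>Polynomial running time of decoding and of the final check\<close>

definition clause_ok :: "nat \<Rightarrow> nat \<Rightarrow> literal list \<Rightarrow> bool" where
  "clause_ok k n c \<longleftrightarrow> length c \<le> k \<and> (\<forall>l\<in>set c. fst l < n)"

abbreviation "enc_word \<equiv> enc_pair enc_nat enc_bool"
abbreviation "enc_clause \<equiv> enc_list (enc_pair enc_nat enc_bool)"
abbreviation "enc_rho \<equiv> enc_list (enc_option enc_bool)"

lemma fst_nth_le: "\<forall>x\<in>set w. fst x < A \<Longrightarrow> i < length w \<Longrightarrow> fst (w ! i) \<le> (A::nat)"
  by (simp add: less_imp_le)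

lemma ptime_consistent: "ptime enc_clause (clause_ok k) consistent enc_bool"
proof -
  have len: "poly_length W f" if "\<And>n a. W n a \<Longrightarrow> length (f a) \<le> k" for W and f :: "'x \<Rightarrow> literal list"
    unfolding poly_length_conv_size by (rule poly_sizeI[OF poly_bounded_const[of k] that])
  show ?thesis unfolding consistent_def
  proof (intro ptime_list_all ptime_disj ptime_not ptime_nat_eq ptime_bool_eq)
    let ?V = "\<lambda>n e. (clause_ok k n (fst (fst e)) \<and> snd (fst e) \<in> set (fst (fst e))) \<and> snd e \<in> set (fst (fst e))"
    show "poly_size ?V (\<lambda>a. fst (snd (fst a)))"
      by (rule poly_sizeI[OF poly_bounded_id]) (auto simp: clause_ok_def intro: less_imp_le)
  qed ((rule ptime_id ptime_fst ptime_snd)+ | (rule len, simp add: clause_ok_def))+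
qed

lemma ptime_unit_clause:
  "ptime (enc_pair enc_clause (enc_pair (enc_list enc_word) (enc_pair enc_rho (enc_pair enc_nat enc_bool))))
    (\<lambda>n (c, w, \<rho>, i, b). clause_ok k n c \<and> length w = n \<and> (\<forall>x\<in>set w. fst x < A) \<and> length \<rho> = n \<and> i < n)
    (\<lambda>e. unit_clause S (fst e) (fst (snd e)) (fst (snd (snd e))) (fst (snd (snd (snd e)))) (snd (snd (snd (snd e)))))
    enc_bool"
  (is "ptime ?e ?V _ _")
proof -
  let ?W = "\<lambda>n e. ?V n (fst e) \<and> snd e \<in> set (fst (fst e))"
  have len: "poly_length ?V fst"
    unfolding poly_length_conv_size
    by (rule poly_sizeI[OF poly_bounded_const[of k]]) (auto simp: clause_ok_def)
  have sz: "poly_size ?W (\<lambda>e. fst (snd e))"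
    by (rule poly_sizeI[OF poly_bounded_id]) (auto simp: clause_ok_def intro: less_imp_le)
  have lw: "poly_length ?W (\<lambda>e. fst (snd (fst e)))" "poly_length ?W (\<lambda>e. fst (snd (snd (fst e))))"
    unfolding poly_length_conv_size by (rule poly_sizeI[OF poly_bounded_id], auto)+
  show ?thesis unfolding unit_clause_def
  proof (intro ptime_conj ptime_list_all ptime_list_ex ptime_disj ptime_nat_eq ptime_bool_eq
      ptime_less_const ptime_eq_Some ptime_not len sz)
    show "ptime ?e ?V (\<lambda>a. consistent (fst a)) enc_bool"
      by (rule ptime_comp[OF ptime_projections(1) ptime_consistent]) auto
    show "ptime (enc_pair ?e enc_word) ?W (\<lambda>e. fst (fst (snd (fst e)) ! fst (snd e))) enc_nat"
      by (rule ptime_fst, rule ptime_nth[OF _ _ lw(1)], (rule ptime_id ptime_fst ptime_snd)+)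
        (auto simp: clause_ok_def, force)
    show "ptime (enc_pair ?e enc_word) ?W (\<lambda>e. fst (snd (snd (fst e))) ! fst (snd e)) (enc_option enc_bool)"
      by (rule ptime_nth[OF _ _ lw(2)], (rule ptime_id ptime_fst ptime_snd)+)
        (auto simp: clause_ok_def, force)
  qed (rule ptime_id ptime_fst ptime_snd)+
qed

text \<open>\<open>L\<close> bounds the number of clauses. It stays abstract here; the main theorem
  instantiates it with a polynomial that bounds the number of different clauses of size at most
  \<open>k\<close>.\<close>

definition formula_ok :: "nat \<Rightarrow> (nat \<Rightarrow> nat) \<Rightarrow> nat \<Rightarrow> literal list list \<Rightarrow> bool" where
  "formula_ok k L n F \<longleftrightarrow> length F \<le> L n \<and> (\<forall>c\<in>set F. clause_ok k n c)"

lemma ptime_forced: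
  assumes L: "poly_bounded L"
  shows "ptime (enc_pair (enc_list enc_clause) (enc_pair (enc_list enc_word) (enc_pair enc_rho (enc_pair enc_nat enc_bool))))
    (\<lambda>n (F, w, \<rho>, i, b). formula_ok k L n F \<and> length w = n \<and> (\<forall>x\<in>set w. fst x < A) \<and> length \<rho> = n \<and> i < n)
    (\<lambda>e. forced S (fst e) (fst (snd e)) (fst (snd (snd e))) (fst (snd (snd (snd e)))) (snd (snd (snd (snd e)))))
    enc_bool"
  (is "ptime ?e ?V _ _")
  unfolding forced_def
proof (rule ptime_list_ex)
  show "poly_length ?V fst"
    unfolding poly_length_conv_size by (rule poly_sizeI[OF L]) (auto simp: formula_ok_def)
  show "ptime (enc_pair ?e enc_clause) (\<lambda>n e. ?V n (fst e) \<and> snd e \<in> set (fst (fst e)))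
     (\<lambda>e. unit_clause S (snd e) (fst (snd (fst e))) (fst (snd (snd (fst e))))
        (fst (snd (snd (snd (fst e))))) (snd (snd (snd (snd (fst e)))))) enc_bool"
    by (rule ptime_comp[OF _ ptime_unit_clause[of k A S], where f = "\<lambda>e. (snd e, snd (fst e))", simplified])
      ((rule ptime_Pair ptime_projections)+, auto simp: formula_ok_def)
qed (rule ptime_projections)

definition state_ok :: "nat \<Rightarrow> (nat \<Rightarrow> nat) \<Rightarrow> nat \<Rightarrow> nat \<Rightarrow> (nat \<times> literal list list) \<times> word list \<Rightarrow> bool" where
  "state_ok k L A n e \<longleftrightarrow> fst (fst e) = n \<and> formula_ok k L n (snd (fst e)) \<and>
     length (snd e) = n \<and> (\<forall>x\<in>set (snd e). fst x < A)"

abbreviation "enc_state \<equiv> enc_pair (enc_pair enc_nat (enc_list enc_clause)) (enc_list enc_word)"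

lemma ptime_set_var:
  assumes L: "poly_bounded L"
  shows "ptime (enc_pair enc_state (enc_pair enc_rho enc_nat))
    (\<lambda>n (e, \<rho>, i). state_ok k L A n e \<and> length \<rho> = n \<and> i < n)
    (\<lambda>e. set_var S (snd (fst (fst e))) (snd (fst e)) (fst (snd e)) (snd (snd e))) enc_rho"
  (is "ptime ?e ?V _ _")
proof -
  have forced: "ptime ?e ?V (\<lambda>e. forced S (snd (fst (fst e))) (snd (fst e)) (fst (snd e)) (snd (snd e)) b) enc_bool" for b
    by (rule ptime_comp[OF _ ptime_forced[OF L, of k A S],
          where f = "\<lambda>e. (snd (fst (fst e)), snd (fst e), fst (snd e), snd (snd e), b)", simplified])
      ((rule ptime_id ptime_const ptime_fst ptime_snd ptime_Pair)+, auto simp: state_ok_def)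
  show ?thesis unfolding set_var_def
  proof (rule ptime_list_update[where l = "\<lambda>e. fst (fst (fst e))"])
    show "ptime ?e ?V (\<lambda>e. Some (if forced S (snd (fst (fst e))) (snd (fst e)) (fst (snd e)) (snd (snd e)) True then True
        else if forced S (snd (fst (fst e))) (snd (fst e)) (fst (snd e)) (snd (snd e)) False then False
        else snd (snd (fst e) ! snd (snd e)))) (enc_option enc_bool)"
    proof (intro ptime_Some ptime_if forced ptime_const ptime_snd[OF ptime_nth])
      show "poly_length ?V (\<lambda>e. snd (fst e))"
        unfolding poly_length_conv_size by (rule poly_sizeI[OF poly_bounded_id]) (auto simp: state_ok_def)
    qed ((rule ptime_id ptime_fst ptime_snd)+, auto simp: state_ok_def)
    show "poly_size ?V (\<lambda>e. fst (fst (fst e)))"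
      by (rule poly_sizeI[OF poly_bounded_id]) (auto simp: state_ok_def)
  qed ((rule ptime_id ptime_fst ptime_snd)+ | auto simp: state_ok_def)+
qed

lemma ptime_set_vars:
  assumes L: "poly_bounded L"
  shows "ptime (enc_pair enc_state (enc_pair enc_rho enc_nat))
    (\<lambda>n (e, \<rho>, v). state_ok k L A n e \<and> length \<rho> = n)
    (\<lambda>e. set_vars S (fst (fst (fst e))) (snd (fst (fst e))) (snd (fst e)) (fst (snd e)) (snd (snd e))) enc_rho"
  (is "ptime ?e ?V _ _")
  unfolding set_vars_def
proof (rule ptime_foldl[where I = "\<lambda>n a \<rho>. length \<rho> = n"])
  have sz: "poly_size ?V (\<lambda>e. fst (fst (fst e)))"
    by (rule poly_sizeI[OF poly_bounded_id]) (auto simp: state_ok_def)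
  show "poly_length ?V (\<lambda>e. [0..<fst (fst (fst e))])"
    using sz by (simp add: poly_length_conv_size)
  show "ptime ?e ?V (\<lambda>e. [0..<fst (fst (fst e))]) (enc_list enc_nat)"
    by (rule ptime_upt[OF _ sz], (rule ptime_id ptime_fst ptime_snd)+)
  let ?W = "\<lambda>n e. ?V n (fst e) \<and> length (fst (snd e)) = n \<and> snd (snd e) \<in> set [0..<fst (fst (fst (fst e)))]"
  show "ptime (enc_pair ?e (enc_pair enc_rho enc_nat)) ?W
     (\<lambda>e. if fst (snd (fst (fst e)) ! snd (snd e)) = snd (snd (fst e))
          then set_var S (snd (fst (fst (fst e)))) (snd (fst (fst e))) (fst (snd e)) (snd (snd e)) else fst (snd e)) enc_rho"
  proof (intro ptime_if ptime_nat_eq)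
    show "ptime (enc_pair ?e (enc_pair enc_rho enc_nat)) ?W (\<lambda>e. set_var S (snd (fst (fst (fst e)))) (snd (fst (fst e))) (fst (snd e)) (snd (snd e))) enc_rho"
      by (rule ptime_comp[OF _ ptime_set_var[OF L, of k A S], where f = "\<lambda>e. (fst (fst e), snd e)", simplified])
       ((rule ptime_id ptime_fst ptime_snd ptime_Pair)+, auto simp: state_ok_def)
    have "poly_length ?W (\<lambda>e. snd (fst (fst e)))"
      unfolding poly_length_conv_size by (rule poly_sizeI[OF poly_bounded_id]) (auto simp: state_ok_def)
    then show "ptime (enc_pair ?e (enc_pair enc_rho enc_nat)) ?W (\<lambda>e. fst (snd (fst (fst e)) ! snd (snd e))) enc_nat"
      by (intro ptime_fst[OF ptime_nth]) ((rule ptime_id ptime_fst ptime_snd)+, auto simp: state_ok_def)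
    show "poly_size ?W (\<lambda>e. fst (snd (fst (fst e)) ! snd (snd e)))"
      by (rule poly_sizeI[OF poly_bounded_const[of A]])
        (auto simp: state_ok_def intro!: fst_nth_le)
  qed (rule ptime_id ptime_fst ptime_snd)+
qed ((rule ptime_id ptime_fst ptime_snd)+ | auto)+

lemma ptime_decode:
  assumes L: "poly_bounded L"
  shows "ptime enc_state (state_ok k L A)
    (\<lambda>e. decode S A (fst (fst e)) (snd (fst e)) (snd e)) enc_rho"
  unfolding decode_def
proof (rule ptime_foldl[where I = "\<lambda>n a \<rho>. length \<rho> = n" and ex = enc_nat])
  show "ptime enc_state (state_ok k L A) (\<lambda>e. replicate (fst (fst e)) None) enc_rho"
    by (rule ptime_replicate, (rule ptime_id ptime_fst ptime_snd)+,
        rule poly_sizeI[OF poly_bounded_id]) (auto simp: state_ok_def intro: ptime_const)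
  show "poly_length (state_ok k L A) (\<lambda>e. [S..<A])"
    unfolding poly_length_conv_size by (rule poly_sizeI[OF poly_bounded_const[of "A - S"]]) simp
  show "ptime (enc_pair enc_state (enc_pair enc_rho enc_nat))
     (\<lambda>n e. state_ok k L A n (fst e) \<and> length (fst (snd e)) = n \<and> snd (snd e) \<in> set [S..<A])
     (\<lambda>e. set_vars S (fst (fst (fst e))) (snd (fst (fst e))) (snd (fst e)) (fst (snd e)) (snd (snd e))) enc_rho"
    by (rule ptime_recode[OF ptime_set_vars[OF L, of k A S]]) auto
qed (auto simp: state_ok_def intro: ptime_const)

lemma ptime_sat_list:
  assumes L: "poly_bounded L"
  shows "ptime (enc_pair (enc_pair enc_nat (enc_list enc_clause)) (enc_list enc_bool))
    (\<lambda>n e. formula_ok k L n (snd (fst e)) \<and> length (snd e) = n)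
    (\<lambda>e. sat_list (snd (fst e)) (snd e)) enc_bool"
  (is "ptime ?e ?V _ _")
  unfolding sat_list_def
proof (intro ptime_list_all ptime_list_ex ptime_bool_eq ptime_nth)
  show "poly_length ?V (\<lambda>e. snd (fst e))"
    unfolding poly_length_conv_size by (rule poly_sizeI[OF L]) (auto simp: formula_ok_def)
  let ?W = "\<lambda>n e. ?V n (fst e) \<and> snd e \<in> set (snd (fst (fst e)))"
  show "poly_length ?W snd"
    unfolding poly_length_conv_size
    by (rule poly_sizeI[OF poly_bounded_const[of k]]) (auto simp: formula_ok_def clause_ok_def)
  show "poly_length (\<lambda>n e. ?W n (fst e) \<and> snd e \<in> set (snd (fst e))) (\<lambda>a. snd (fst (fst a)))"
    unfolding poly_length_conv_size by (rule poly_sizeI[OF poly_bounded_id]) auto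
qed ((rule ptime_id ptime_fst ptime_snd)+ | auto simp: formula_ok_def clause_ok_def)+

section \<open>Counting the good words\<close>

definition blocked :: "'a set \<Rightarrow> 'a set set \<Rightarrow> 'a set \<Rightarrow> 'a set" where
  "blocked V \<J> J = {x \<in> V - J. insert x J \<notin> \<J>}"

text \<open>Each member \<open>J\<close> avoiding the new element \<open>x\<close> gains a factor of
  at least \<open>1 + z\<close>. If \<open>insert x J\<close> is also a member, the two terms
  together carry \<open>1 + z\<close>, as adding \<open>x\<close> to \<open>J\<close> unblocks
  nothing. Otherwise \<open>x\<close> is blocked at \<open>J\<close>, which gives the factor
  \<open>G\<close>. Both extremes occur: the full power set without blocked elements, and
  \<open>{{}}\<close> with all elements blocked.\<close>

lemma downset_weight:
  fixes z G :: real
  assumes "finite V" and "0 \<le> z" and "1 + z \<le> G"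
    and "\<J> \<subseteq> Pow V" and "{} \<in> \<J>" and "\<And>J J'. J \<in> \<J> \<Longrightarrow> J' \<subseteq> J \<Longrightarrow> J' \<in> \<J>"
  shows "(1 + z) ^ card V \<le> (\<Sum>J\<in>\<J>. z ^ card J * G ^ card (blocked V \<J> J))"
  using assms(1,4-)
proof (induction V arbitrary: \<J>)
  case empty
  then have "\<J> = {{}}" by auto
  then show ?case by (simp add: blocked_def)
next
  case (insert x V)
  define \<J>0 where "\<J>0 = {J \<in> \<J>. x \<notin> J}"
  define \<J>1 where "\<J>1 = {J. x \<notin> J \<and> insert x J \<in> \<J>}"
  let ?t = "\<lambda>J. z ^ card J * G ^ card (blocked (insert x V) \<J> J)"
  let ?u = "\<lambda>J. z ^ card J * G ^ card (blocked V \<J>0 J)"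
  have "finite \<J>" using insert.hyps(1) by (intro finite_subset[OF insert.prems(1)]) simp
  then have fin: "finite \<J>" "finite \<J>0" by (simp_all add: \<J>0_def)
  have sub: "\<J>1 \<subseteq> \<J>0" unfolding \<J>0_def \<J>1_def using insert.prems(3) by blast
  have finJ: "finite J" if "J \<in> \<J>0" for J
    using that insert.prems(1) insert.hyps(1) finite_subset unfolding \<J>0_def by blast
  have J: "\<J> = \<J>0 \<union> insert x ` \<J>1"
  proof (intro equalityI subsetI)
    fix J assume J: "J \<in> \<J>"
    show "J \<in> \<J>0 \<union> insert x ` \<J>1"
    proof (cases "x \<in> J")
      case True
      then have "J - {x} \<in> \<J>1" "J = insert x (J - {x})" using J by (auto simp: \<J>1_def insert_absorb)
      then show ?thesis by blast
    qed (use J in \<open>simp add: \<J>0_def\<close>)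
  qed (auto simp: \<J>0_def \<J>1_def)
  have G: "1 \<le> G" "0 < G" using assms(2,3) by linarith+
  have "(1 + z) ^ card (insert x V) = (1 + z) * (1 + z) ^ card V"
    using insert.hyps by simp
  also have "\<dots> \<le> (1 + z) * (\<Sum>J\<in>\<J>0. ?u J)"
  proof (intro mult_left_mono insert.IH)
    show "\<J>0 \<subseteq> Pow V" using insert.prems(1) unfolding \<J>0_def by blast
    show "J' \<in> \<J>0" if "J \<in> \<J>0" "J' \<subseteq> J" for J J'
      using that insert.prems(3)[of J J'] by (auto simp: \<J>0_def)
  qed (use insert.prems assms(2) in \<open>auto simp: \<J>0_def\<close>)
  also have "\<dots> = (\<Sum>J\<in>\<J>0. (1 + z) * ?u J)" by (simp add: sum_distrib_left)
  also have "\<dots> \<le> (\<Sum>J\<in>\<J>0. ?t J + (if J \<in> \<J>1 then ?t (insert x J) else 0))"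
  proof (rule sum_mono)
    fix J assume J0: "J \<in> \<J>0"
    then have x: "x \<notin> J" and Jin: "J \<in> \<J>" by (auto simp: \<J>0_def)
    have fb: "finite (blocked V \<J>0 J)" "x \<notin> blocked V \<J>0 J" using insert.hyps by (auto simp: blocked_def)
    have fb': "finite (blocked (insert x V) \<J> (insert x J))" using insert.hyps by (auto simp: blocked_def)
    show "(1 + z) * ?u J \<le> ?t J + (if J \<in> \<J>1 then ?t (insert x J) else 0)"
    proof (cases "J \<in> \<J>1")
      case True
      have "blocked (insert x V) \<J> J = blocked V \<J>0 J"
        using True x insert.hyps(2) by (auto simp: blocked_def \<J>0_def \<J>1_def)
      \<comment> \<open>A direction that leaves the down-set at \<open>J\<close> also leaves it at
        the larger set \<open>insert x J\<close>, by closure under subsets.\<close>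
      moreover have "blocked V \<J>0 J \<subseteq> blocked (insert x V) \<J> (insert x J)"
      proof
        fix y assume "y \<in> blocked V \<J>0 J"
        then have y: "y \<in> V" "y \<notin> J" "insert y J \<notin> \<J>0" by (auto simp: blocked_def)
        then have "insert y J \<notin> \<J>" using x insert.hyps(2) by (auto simp: \<J>0_def)
        then have "insert y (insert x J) \<notin> \<J>" using insert.prems(3)[of "insert y (insert x J)" "insert y J"] by blast
        then show "y \<in> blocked (insert x V) \<J> (insert x J)"
          using y insert.hyps(2) by (auto simp: blocked_def)
      qed
      then have "G ^ card (blocked V \<J>0 J) \<le> G ^ card (blocked (insert x V) \<J> (insert x J))"
        using G fb' by (intro power_increasing card_mono)
      then have "z ^ Suc (card J) * G ^ card (blocked V \<J>0 J) \<le> ?t (insert x J)"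
        using x finJ[OF J0] assms(2) by (auto intro: mult_left_mono)
      ultimately show ?thesis using True by (simp add: algebra_simps)
    next
      case False
      have "blocked (insert x V) \<J> J = insert x (blocked V \<J>0 J)"
        using False x insert.hyps(2) by (auto simp: blocked_def \<J>0_def \<J>1_def)
      then have "?t J = G * ?u J" using fb by simp
      moreover have "(1 + z) * ?u J \<le> G * ?u J"
        using assms(2,3) G by (intro mult_right_mono) simp_all
      ultimately show ?thesis using False by (simp only: if_False add_0_right)
    qed
  qed
  also have "\<dots> = sum ?t \<J>0 + (\<Sum>J\<in>\<J>1. ?t (insert x J))"
    using sub fin by (simp add: sum.distrib sum.If_cases Int_absorb1)
  also have "(\<Sum>J\<in>\<J>1. ?t (insert x J)) = sum ?t (insert x ` \<J>1)"
    by (subst sum.reindex) (auto simp: inj_on_def \<J>1_def insert_ident)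
  also have "sum ?t \<J>0 + sum ?t (insert x ` \<J>1) = sum ?t \<J>"
    unfolding J by (rule sum.union_disjoint[symmetric])
      (use fin finite_subset[OF sub fin(2)] in \<open>auto simp: \<J>0_def\<close>)
  finally show ?case .
qed

text \<open>
  The probability that the first of \<open>k\<close> independent keys, uniform on \<open>K\<close> values, is strictly the
  largest; it tends to \<open>1 / k\<close> for \<open>K \<longrightarrow> \<infinity>\<close>.
\<close>

definition last_frac :: "nat \<Rightarrow> nat \<Rightarrow> real" where
  "last_frac k K = (\<Sum>i<K. real i ^ (k - 1)) / real K ^ k"

text \<open>The keys under which exactly the variables in \<open>J\<close> stay unassigned.\<close>

definition keys :: "nat \<Rightarrow> nat \<Rightarrow> nat \<Rightarrow> nat set \<Rightarrow> (nat \<Rightarrow> nat) set" where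
  "keys S A n J = PiE {..<n} (\<lambda>i. if i \<in> J then {..<S} else {S..<A})"

lemma finite_keys [simp]: "finite (keys S A n J)"
  by (auto simp: keys_def intro!: finite_PiE)

lemma card_keys:
  assumes "J \<subseteq> {..<n}"
  shows "card (keys S A n J) = S ^ card J * (A - S) ^ (n - card J)"
proof -
  have "card (keys S A n J) = (\<Prod>i<n. if i \<in> J then S else A - S)"
    unfolding keys_def by (subst card_PiE) (auto intro!: prod.cong)
  also have "\<dots> = S ^ card J * (A - S) ^ (n - card J)"
    using assms by (simp add: prod.If_cases Int_absorb1 Int_absorb2 card_Diff_subset
        finite_subset[OF assms] Diff_eq[symmetric] inf.absorb2)
  finally show ?thesis .
qed

text \<open>The keys are split by the value \<open>v\<close> at \<open>x\<close>. This gives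
  disjoint product sets \<open>B v\<close>, each a fraction
  \<open>(1 / K) * ((v - S) / K) ^ card Y\<close> of all keys, because \<open>Y\<close> lies outside
  \<open>J\<close> and its keys therefore range over \<open>{S..<A}\<close>. For
  \<open>card Y = k - 1\<close> these fractions add up to \<open>last_frac k K\<close>.\<close>

lemma card_keys_last:
  assumes "S < A" and "J \<subseteq> {..<n}" and x: "x < n" "x \<notin> J" and Y: "Y \<subseteq> {..<n} - J - {x}"
    and k: "card Y \<le> k - 1" "1 \<le> k"
  shows "last_frac k (A - S) * card (keys S A n J) \<le> card {\<kappa> \<in> keys S A n J. \<forall>y\<in>Y. \<kappa> y < \<kappa> x}"
proof -
  define K where "K = A - S"
  have K: "0 < K" using assms(1) by (simp add: K_def)
  define B where "B v = PiE {..<n} (\<lambda>i. if i = x then {v} else if i \<in> Y then {S..<v}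
    else if i \<in> J then {..<S} else {S..<A})" for v
  have finY: "finite Y" using Y finite_subset by blast
  have cardB: "real (card (B v)) = card (keys S A n J) * (1 / K * (real (v - S) / K) ^ card Y)"
    if v: "v \<in> {S..<A}" for v
  proof -
    let ?r = "\<lambda>i. if i = x then 1 / real K else if i \<in> Y then real (v - S) / K else 1"
    let ?c = "\<lambda>i. real (card (if i \<in> J then {..<S} else {S..<A}))"
    have "real (card (B v)) = (\<Prod>i<n. ?c i * ?r i)"
    proof -
      have "card (if i = x then {v} else if i \<in> Y then {S..<v} else if i \<in> J then {..<S} else {S..<A}) = ?c i * ?r i"
        for i
      proof -
        consider "i = x" | "i \<in> Y" "i \<noteq> x" "i \<notin> J" | "i \<notin> Y" "i \<noteq> x" using Y by blast
        then show ?thesis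
          by cases (use x K in \<open>simp_all add: K_def[symmetric]\<close>)
      qed
      then show ?thesis unfolding B_def by (simp add: card_PiE of_nat_prod)
    qed
    also have "\<dots> = (\<Prod>i<n. ?c i) * (\<Prod>i<n. ?r i)" by (rule prod.distrib)
    also have "(\<Prod>i<n. ?c i) = card (keys S A n J)"
      unfolding keys_def by (simp add: card_PiE)
    also have "(\<Prod>i<n. ?r i) = (\<Prod>i\<in>insert x Y. ?r i)"
      using x Y by (intro prod.mono_neutral_right) auto
    also have "\<dots> = 1 / K * (\<Prod>i\<in>Y. ?r i)" using finY Y by (subst prod.insert) auto
    also have "(\<Prod>i\<in>Y. ?r i) = (\<Prod>i\<in>Y. real (v - S) / K)" using Y by (intro prod.cong) auto
    finally show ?thesis by simp
  qed
  have sub: "(\<Union>v\<in>{S..<A}. B v) \<subseteq> {\<kappa> \<in> keys S A n J. \<forall>y\<in>Y. \<kappa> y < \<kappa> x}"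
  proof
    fix \<kappa> assume "\<kappa> \<in> (\<Union>v\<in>{S..<A}. B v)"
    then obtain v where v: "v \<in> {S..<A}" "\<kappa> \<in> B v" by blast
    have ev: "\<kappa> i \<in> (if i = x then {v} else if i \<in> Y then {S..<v} else if i \<in> J then {..<S} else {S..<A})"
      if "i < n" for i using PiE_mem[OF v(2)[unfolded B_def], of i] that by (simp only: lessThan_iff)
    have "\<kappa> i \<in> (if i \<in> J then {..<S} else {S..<A})" if "i < n" for i
    proof -
      consider "i = x" | "i \<in> Y" "i \<noteq> x" "i \<notin> J" | "i \<notin> Y" "i \<noteq> x" using Y by blast
      then show ?thesis by cases (use ev[OF that] v(1) x in auto)
    qed
    moreover have "\<kappa> x = v" using ev[of x] x by simp
    moreover have "\<kappa> y < v" if "y \<in> Y" for y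
    proof -
      have "y < n" "y \<noteq> x" using that Y by auto
      then show ?thesis using ev[of y] that by simp
    qed
    moreover have "\<kappa> \<in> extensional {..<n}" using v(2) unfolding B_def by (simp add: PiE_def)
    ultimately show "\<kappa> \<in> {\<kappa> \<in> keys S A n J. \<forall>y\<in>Y. \<kappa> y < \<kappa> x}"
      unfolding keys_def by (auto simp: PiE_def)
  qed
  have disj: "\<forall>v\<in>{S..<A}. \<forall>v'\<in>{S..<A}. v \<noteq> v' \<longrightarrow> B v \<inter> B v' = {}"
  proof (intro ballI impI)
    fix v v' :: nat assume ne: "v \<noteq> v'"
    have "\<kappa> x = v" if "\<kappa> \<in> B v" for \<kappa> v using PiE_mem[OF that[unfolded B_def], of x] x(1) by simp
    then show "B v \<inter> B v' = {}" using ne by blast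
  qed
  have finB: "finite (B v)" for v unfolding B_def by (intro finite_PiE) auto
  have "last_frac k K = (\<Sum>i<K. 1 / K * (real i / K) ^ (k - 1))"
    using k(2) by (cases k) (simp_all add: last_frac_def sum_divide_distrib power_divide)
  also have "\<dots> \<le> (\<Sum>i<K. 1 / K * (real i / K) ^ card Y)"
    using K k by (intro sum_mono mult_left_mono power_decreasing) auto
  also have "\<dots> = (\<Sum>v\<in>{S..<A}. 1 / K * (real (v - S) / K) ^ card Y)"
    by (rule sum.reindex_bij_witness[of _ "\<lambda>v. v - S" "\<lambda>i. i + S"]) (auto simp: K_def)
  finally have "last_frac k K * card (keys S A n J) \<le>
      (\<Sum>v\<in>{S..<A}. 1 / K * (real (v - S) / K) ^ card Y) * card (keys S A n J)"
    by (rule mult_right_mono) simp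
  also have "\<dots> = (\<Sum>v\<in>{S..<A}. real (card (B v)))"
    unfolding sum_distrib_right by (intro sum.cong refl) (simp only: cardB mult.commute)
  also have "\<dots> = real (card (\<Union>v\<in>{S..<A}. B v))"
    by (subst card_UN_disjoint) (use finB disj in auto)
  also have "\<dots> \<le> card {\<kappa> \<in> keys S A n J. \<forall>y\<in>Y. \<kappa> y < \<kappa> x}"
    using sub by (intro of_nat_mono card_mono) auto
  finally show ?thesis unfolding K_def .
qed

text \<open>Jensen's inequality for \<open>2 ^ h\<close>, by the tangent at the lower bound of the mean.\<close>

lemma sum_two_power_ge:
  fixes h :: "'a \<Rightarrow> nat" and m :: real
  assumes "m * card X \<le> (\<Sum>x\<in>X. real (h x))"
  shows "2 powr m * card X \<le> (\<Sum>x\<in>X. 2 ^ h x)"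
proof -
  have tangent: "2 powr m * (1 + ln 2 * (real (h x) - m)) \<le> 2 ^ h x" for x
  proof -
    have "2 powr m * (1 + ln 2 * (real (h x) - m)) \<le> 2 powr m * exp (ln 2 * (real (h x) - m))"
      by (intro mult_left_mono exp_ge_add_one_self) simp
    also have "\<dots> = 2 powr (m + (real (h x) - m))"
      unfolding powr_add by (simp add: powr_def mult.commute)
    also have "\<dots> = 2 ^ h x" by (simp add: powr_realpow)
    finally show ?thesis .
  qed
  have "2 powr m * card X \<le> 2 powr m * (card X + ln 2 * ((\<Sum>x\<in>X. real (h x)) - m * card X))"
    using assms by (intro mult_left_mono) auto
  also have "\<dots> = (\<Sum>x\<in>X. 2 powr m * (1 + ln 2 * (real (h x) - m)))"
    by (simp only: sum_distrib_left[symmetric] sum.distrib sum_subtractf sum_constant mult_1_right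
        mult.commute[of m])
  also have "\<dots> \<le> (\<Sum>x\<in>X. 2 ^ h x)" by (intro sum_mono tangent)
  finally show ?thesis .
qed

text \<open>A clause that forces a value at \<open>x\<close> has, by \<open>sat\<close>, a literal
  on an assigned variable that is true under \<open>a\<close>. Since \<open>\<rho>\<close> agrees
  with \<open>a\<close>, that literal is not falsified, so it can only be the forcing literal
  itself. Hence no wrong value is ever forced.\<close>

lemma set_var_correct:
  assumes x: "x < n" and w: "length \<rho> = n" and \<rho>: "\<And>j. j < n \<Longrightarrow> \<rho> ! j = None \<or> \<rho> ! j = Some (a ! j)"
    and xN: "\<rho> ! x = None" and xS: "S \<le> fst (w ! x)"
    and F: "\<And>c l. c \<in> set F \<Longrightarrow> l \<in> set c \<Longrightarrow> fst l < n"
    and sat: "\<And>c. c \<in> set F \<Longrightarrow> consistent c \<Longrightarrow> \<exists>l\<in>set c. S \<le> fst (w ! fst l) \<and> a ! fst l = snd l"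
    and x_ok: "forced S F w \<rho> x (a ! x) \<or> snd (w ! x) = a ! x"
  shows "set_var S F w \<rho> x = \<rho>[x := Some (a ! x)]"
proof -
  have "b = a ! x" if forced: "forced S F w \<rho> x b" for b
  proof -
    obtain c where c: "c \<in> set F" "consistent c"
      and u: "\<And>l. l \<in> set c \<Longrightarrow> (fst l = x \<and> snd l = b) \<or> fst (w ! fst l) < S \<or> \<rho> ! fst l = Some (\<not> snd l)"
      using forced unfolding forced_def unit_clause_def by blast
    obtain l where l: "l \<in> set c" "S \<le> fst (w ! fst l)" "a ! fst l = snd l" using sat[OF c] by blast
    have "\<rho> ! fst l \<noteq> Some (\<not> snd l)" using \<rho>[OF F[OF c(1) l(1)]] l(3) by auto
    with u[OF l(1)] l(2) have "fst l = x" "snd l = b" by auto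
    with l(3) show ?thesis by simp
  qed
  then have "(if forced S F w \<rho> x True then True else if forced S F w \<rho> x False then False else snd (w ! x)) = a ! x"
    using x_ok by (cases "a ! x") auto
  then show ?thesis unfolding set_var_def by simp
qed

text \<open>Induction along the processing order. The second alternative of \<open>ok\<close> asks
  for strictly smaller keys, so the falsified literals of the clause are already assigned when the
  turn of \<open>x\<close> comes, regardless of ties.\<close>

lemma decode_correct:
  assumes w: "length w = n" "\<And>i. i < n \<Longrightarrow> fst (w ! i) < A"
    and F: "\<And>c l. c \<in> set F \<Longrightarrow> l \<in> set c \<Longrightarrow> fst l < n"
    and sat: "\<And>c. c \<in> set F \<Longrightarrow> consistent c \<Longrightarrow> \<exists>l\<in>set c. S \<le> fst (w ! fst l) \<and> a ! fst l = snd l"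
    and ok: "\<And>x. x < n \<Longrightarrow> S \<le> fst (w ! x) \<Longrightarrow> snd (w ! x) = a ! x \<or>
      (\<exists>c\<in>set F. consistent c \<and> (x, a ! x) \<in> set c \<and> (\<forall>l\<in>set c. l = (x, a ! x) \<or> fst (w ! fst l) < S \<or>
         a ! fst l \<noteq> snd l \<and> fst (w ! fst l) < fst (w ! x)))"
  shows "decode S A n F w = map (\<lambda>j. if S \<le> fst (w ! j) then Some (a ! j) else None) [0..<n]"
proof -
  \<comment> \<open>Closed form of the state just before variable \<open>i\<close> in the sweep for
    key \<open>v\<close>.\<close>
  define st where "st v i = map (\<lambda>j. if S \<le> fst (w ! j) \<and> (fst (w ! j) < v \<or> fst (w ! j) = v \<and> j < i)
    then Some (a ! j) else None) [0..<n]" for v i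
  have st_nth: "st v i ! j = (if S \<le> fst (w ! j) \<and> (fst (w ! j) < v \<or> fst (w ! j) = v \<and> j < i)
    then Some (a ! j) else None)" if "j < n" for v i j using that by (simp add: st_def)
  have len: "length (st v i) = n" for v i by (simp add: st_def)
  have inner: "foldl (\<lambda>\<rho> i. if fst (w ! i) = v then set_var S F w \<rho> i else \<rho>) (st v 0) [0..<i] = st v i"
    if "i \<le> n" and vS: "S \<le> v" for v i
    using that(1)
  proof (induction i)
    case 0
    then show ?case by (simp add: st_def)
  next
    case (Suc i)
    have "(if fst (w ! i) = v then set_var S F w (st v i) i else st v i) = st v (Suc i)"
    proof (cases "fst (w ! i) = v")
      case True
      have "set_var S F w (st v i) i = (st v i)[i := Some (a ! i)]"
      proof (rule set_var_correct[OF _ len _ _ _ F sat])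
        show "forced S F w (st v i) i (a ! i) \<or> snd (w ! i) = a ! i"
        proof (rule disjCI)
          assume "snd (w ! i) \<noteq> a ! i"
          then obtain c where c: "c \<in> set F" "consistent c" "(i, a ! i) \<in> set c" and
            u: "\<And>l. l \<in> set c \<Longrightarrow> l = (i, a ! i) \<or> fst (w ! fst l) < S \<or>
               a ! fst l \<noteq> snd l \<and> fst (w ! fst l) < fst (w ! i)"
            using ok[of i] Suc.prems True vS by auto
          have "(fst l = i \<and> snd l = a ! i) \<or> fst (w ! fst l) < S \<or> st v i ! fst l = Some (\<not> snd l)"
            if l: "l \<in> set c" for l
            using u[OF l] F[OF c(1) l] True by (auto simp: st_nth)
          then show "forced S F w (st v i) i (a ! i)"
            unfolding forced_def unit_clause_def using c by (intro bexI[of _ c] conjI ballI bexI[of _ "(i, a ! i)"]) auto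
        qed
        show "i < n" using Suc.prems by simp
        show "st v i ! j = None \<or> st v i ! j = Some (a ! j)" if "j < n" for j
          using that by (simp add: st_nth)
        show "st v i ! i = None" using Suc.prems True by (simp add: st_nth)
        show "S \<le> fst (w ! i)" using True vS by simp
      qed
      also have "\<dots> = st v (Suc i)"
      proof (rule nth_equalityI)
        fix j assume "j < length ((st v i)[i := Some (a ! i)])"
        then have "j < n" by (simp add: len)
        then show "(st v i)[i := Some (a ! i)] ! j = st v (Suc i) ! j"
          using True vS by (cases "j = i") (simp_all add: len st_nth less_Suc_eq)
      qed (simp add: len)
      finally show ?thesis using True by simp
    next
      case False
      have "st v i ! j = st v (Suc i) ! j" if "j < n" for j
        using that False by (cases "j = i") (simp_all add: st_nth less_Suc_eq)
      then have "st v i = st v (Suc i)" by (intro nth_equalityI) (simp_all add: len)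
      then show ?thesis using False by simp
    qed
    then show ?case using Suc by simp
  qed
  have outer: "foldl (set_vars S n F w) (replicate n None) [S..<S + m] = st (S + m) 0" for m
  proof (induction m)
    case 0
    show ?case by (rule nth_equalityI) (simp_all add: len st_nth)
  next
    case (Suc m)
    have "set_vars S n F w (st (S + m) 0) (S + m) = st (S + m) n"
      unfolding set_vars_def by (rule inner) simp_all
    also have "\<dots> = st (S + Suc m) 0"
      by (rule nth_equalityI) (simp_all add: len st_nth less_Suc_eq)
    finally show ?case using Suc by simp
  qed
  show ?thesis
  proof (cases "S \<le> A")
    case True
    then have "decode S A n F w = st A 0" using outer[of "A - S"] by (simp add: decode_def)
    also have "\<dots> = map (\<lambda>j. if S \<le> fst (w ! j) then Some (a ! j) else None) [0..<n]"
      using w by (intro nth_equalityI) (simp_all add: len st_nth)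
    finally show ?thesis .
  next
    case False
    have "\<not> S \<le> fst (w ! j)" if "j < n" for j using w(2)[OF that] False by simp
    then show ?thesis using False by (intro nth_equalityI) (simp_all add: decode_def)
  qed
qed

text \<open>The call may return any extension that satisfies \<open>C\<close>, so every extension
  has to satisfy the formula. That \<open>a\<close> is one of the extensions guarantees that the
  call does not come back empty.\<close>

definition good_words :: "nat \<Rightarrow> nat \<Rightarrow> nat \<Rightarrow> literal list list \<Rightarrow> bool list \<Rightarrow> word list set" where
  "good_words S A n F a = {w. length w = n \<and> (\<forall>x\<in>set w. fst x < A) \<and> extends a (decode S A n F w) \<and>
     (\<forall>a'. extends a' (decode S A n F w) \<longrightarrow> sat_list F a')}"

lemma good_wordsI:
  assumes a: "length a = n"
    and w: "length w = n" "\<And>i. i < n \<Longrightarrow> fst (w ! i) < A"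
    and F: "\<And>c l. c \<in> set F \<Longrightarrow> l \<in> set c \<Longrightarrow> fst l < n"
    and sat: "\<And>c. c \<in> set F \<Longrightarrow> consistent c \<Longrightarrow> \<exists>l\<in>set c. S \<le> fst (w ! fst l) \<and> a ! fst l = snd l"
    and ok: "\<And>x. x < n \<Longrightarrow> S \<le> fst (w ! x) \<Longrightarrow> snd (w ! x) = a ! x \<or>
      (\<exists>c\<in>set F. consistent c \<and> (x, a ! x) \<in> set c \<and> (\<forall>l\<in>set c. l = (x, a ! x) \<or> fst (w ! fst l) < S \<or>
         a ! fst l \<noteq> snd l \<and> fst (w ! fst l) < fst (w ! x)))"
  shows "w \<in> good_words S A n F a"
proof -
  have d: "decode S A n F w = map (\<lambda>j. if S \<le> fst (w ! j) then Some (a ! j) else None) [0..<n]"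
    by (rule decode_correct[OF w F sat ok])
  have "extends a (decode S A n F w)" unfolding d extends_def using a by simp
  moreover have "sat_list F a'" if e: "extends a' (decode S A n F w)" for a'
    unfolding sat_list_def
  proof
    fix c assume c: "c \<in> set F"
    show "\<exists>l\<in>set c. a' ! fst l = snd l"
    proof (cases "consistent c")
      case True
      obtain l where l: "l \<in> set c" "S \<le> fst (w ! fst l)" "a ! fst l = snd l" using sat[OF c True] by blast
      have "a' ! fst l = a ! fst l"
        using e l(2) F[OF c l(1)] unfolding d extends_def by auto
      then show ?thesis using l by auto
    next
      \<comment> \<open>A clause with two complementary literals holds under every full
        assignment.\<close>
      case False
      then obtain l l' where "l \<in> set c" "l' \<in> set c" "fst l = fst l'" "snd l \<noteq> snd l'"
        unfolding consistent_def by blast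
      then show ?thesis by (metis (full_types))
    qed
  qed
  moreover have "fst x < A" if "x \<in> set w" for x using that w by (metis in_set_conv_nth)
  ultimately show ?thesis using w(1) by (simp add: good_words_def)
qed

text \<open>
  Fix a solution \<open>a\<close> and call \<open>J\<close> admissible if every consistent clause keeps a literal true under
  \<open>a\<close> whose variable is outside \<open>J\<close>.  If \<open>J\<close> is admissible but \<open>insert x J\<close> is not, some clause has
  \<open>x\<close> as its only remaining true literal, so \<open>x\<close> is forced once the other variables of this clause
  outside \<open>J\<close> have smaller keys.
\<close>

lemma card_good_words:
  assumes a: "length a = n" and sat: "sat_list F a" and k: "1 \<le> k" and SA: "S < A"
    and F: "\<And>c. c \<in> set F \<Longrightarrow> clause_ok k n c"
    and ratio: "real (A + S) \<le> real (A - S) * 2 powr last_frac k (A - S)"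
  shows "real (A + S) ^ n \<le> card (good_words S A n F a)"
proof -
  define K where "K = A - S"
  define G where "G = 2 powr last_frac k K"
  \<comment> \<open>An open variable has \<open>S\<close> keys and two guesses, an assigned one that
    is not forced has \<open>K\<close> keys and one guess; \<open>z\<close> is the quotient.\<close>
  define z where "z = 2 * real S / K"
  define \<J> where "\<J> = {J. J \<subseteq> {..<n} \<and> (\<forall>c\<in>set F. consistent c \<longrightarrow> (\<exists>l\<in>set c. fst l \<notin> J \<and> a ! fst l = snd l))}"
  have K: "0 < K" "A = S + K" using SA by (simp_all add: K_def)
  have Fn: "fst l < n" if "c \<in> set F" "l \<in> set c" for c l using F that by (auto simp: clause_ok_def)
  define B where "B = blocked {..<n} \<J>"
  define crit where "crit J x c \<longleftrightarrow> c \<in> set F \<and> consistent c \<and> (x, a ! x) \<in> set c \<and>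
      (\<forall>l\<in>set c. l = (x, a ! x) \<or> fst l \<in> J \<or> a ! fst l \<noteq> snd l \<and> fst l \<noteq> x)" for J x c
  define cl where "cl J x = (SOME c. crit J x c)" for J x
  have "\<exists>c. crit J x c" if J: "J \<in> \<J>" "x \<in> B J" for J x
  proof -
    have x: "x < n" "x \<notin> J" "insert x J \<notin> \<J>" using J(2) by (auto simp: B_def blocked_def)
    then obtain c where c: "c \<in> set F" "consistent c" and no: "\<not> (\<exists>l\<in>set c. fst l \<notin> insert x J \<and> a ! fst l = snd l)"
      using J(1) unfolding \<J>_def by auto
    obtain l where l: "l \<in> set c" "fst l \<notin> J" "a ! fst l = snd l" using J(1) c unfolding \<J>_def by blast
    have "fst l = x" using no l by auto
    with l(3) have "l = (x, a ! x)" by (simp add: prod_eq_iff)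
    with l(1) have xc: "(x, a ! x) \<in> set c" by simp
    have "l' = (x, a ! x) \<or> fst l' \<in> J \<or> a ! fst l' \<noteq> snd l' \<and> fst l' \<noteq> x" if l': "l' \<in> set c" for l'
    proof (cases "fst l' = x")
      case True
      then have "snd l' = a ! x" using c(2) xc l' unfolding consistent_def by fastforce
      then show ?thesis using True by (simp add: prod_eq_iff)
    next
      case False
      then show ?thesis using no l' by blast
    qed
    then show ?thesis using c xc unfolding crit_def by blast
  qed
  then have cl: "cl J x \<in> set F \<and> consistent (cl J x) \<and> (x, a ! x) \<in> set (cl J x) \<and>
      (\<forall>l\<in>set (cl J x). l = (x, a ! x) \<or> fst l \<in> J \<or> a ! fst l \<noteq> snd l \<and> fst l \<noteq> x)"
    if "J \<in> \<J>" "x \<in> B J" for J x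
    using someI_ex[of "crit J x"] that unfolding cl_def crit_def by blast
  \<comment> \<open>The variables that must precede \<open>x\<close> for its critical clause to
    become a unit clause. The variable \<open>x\<close> itself occurs in this clause, so at most
    \<open>k - 1\<close> remain.\<close>
  define Y where "Y J x = fst ` set (cl J x) - J - {x}" for J x
  define Fo where "Fo J \<kappa> = {x \<in> B J. \<forall>y\<in>Y J x. \<kappa> y < \<kappa> x}" for J and \<kappa> :: "nat \<Rightarrow> nat"
  \<comment> \<open>A guess matters only if its variable is neither open nor forced; then it has to
    agree with \<open>a\<close>.\<close>
  define Gs where "Gs J \<kappa> = PiE {..<n} (\<lambda>i. if i \<in> J \<union> Fo J \<kappa> then UNIV else {a ! i})" for J and \<kappa> :: "nat \<Rightarrow> nat"
  define word where "word = (\<lambda>(\<kappa> :: nat \<Rightarrow> nat, g :: nat \<Rightarrow> bool). map (\<lambda>i. (\<kappa> i, g i)) [0..<n])"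
  have Jn: "J \<subseteq> {..<n}" "finite J" if "J \<in> \<J>" for J
    using that finite_subset by (auto simp: \<J>_def)
  have finJ: "finite \<J>" by (rule finite_subset[of _ "Pow {..<n}"]) (auto simp: \<J>_def)
  have Bn: "B J \<subseteq> {..<n} - J" for J by (auto simp: B_def blocked_def)
  have finB: "finite (B J)" for J using Bn finite_subset by blast
  have FoB: "Fo J \<kappa> \<subseteq> B J" for J \<kappa> by (auto simp: Fo_def)

  have good: "word (\<kappa>, g) \<in> good_words S A n F a"
    if J: "J \<in> \<J>" and \<kappa>: "\<kappa> \<in> keys S A n J" and g: "g \<in> Gs J \<kappa>" for J \<kappa> g
  proof (rule good_wordsI[OF a])
    have \<kappa>J: "\<kappa> i \<in> (if i \<in> J then {..<S} else {S..<A})" if "i < n" for i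
      using PiE_mem[OF \<kappa>[unfolded keys_def], of i] that by simp
    have nth: "word (\<kappa>, g) ! i = (\<kappa> i, g i)" if "i < n" for i using that by (simp add: word_def)
    show "length (word (\<kappa>, g)) = n" by (simp add: word_def)
    show "fst (word (\<kappa>, g) ! i) < A" if "i < n" for i
      using \<kappa>J[OF that] SA that by (auto simp: nth split: if_splits)
    show "fst l < n" if "c \<in> set F" "l \<in> set c" for c l using Fn that .
    show "\<exists>l\<in>set c. S \<le> fst (word (\<kappa>, g) ! fst l) \<and> a ! fst l = snd l" if c: "c \<in> set F" "consistent c" for c
    proof -
      obtain l where l: "l \<in> set c" "fst l \<notin> J" "a ! fst l = snd l" using J c unfolding \<J>_def by blast
      then show ?thesis using \<kappa>J[OF Fn[OF c(1) l(1)]] Fn[OF c(1) l(1)] by (intro bexI[of _ l]) (auto simp: nth)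
    qed
    fix x assume x: "x < n" "S \<le> fst (word (\<kappa>, g) ! x)"
    then have xJ: "x \<notin> J" using \<kappa>J[of x] by (auto simp: nth)
    show "snd (word (\<kappa>, g) ! x) = a ! x \<or>
      (\<exists>c\<in>set F. consistent c \<and> (x, a ! x) \<in> set c \<and> (\<forall>l\<in>set c. l = (x, a ! x) \<or> fst (word (\<kappa>, g) ! fst l) < S \<or>
         a ! fst l \<noteq> snd l \<and> fst (word (\<kappa>, g) ! fst l) < fst (word (\<kappa>, g) ! x)))"
    proof (cases "x \<in> Fo J \<kappa>")
      case False
      then have "g x = a ! x" using PiE_mem[OF g[unfolded Gs_def], of x] x xJ by simp
      then show ?thesis using x by (simp add: nth)
    next
      case True
      then have xB: "x \<in> B J" and less: "\<And>y. y \<in> Y J x \<Longrightarrow> \<kappa> y < \<kappa> x" by (auto simp: Fo_def)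
      note c = cl[OF J xB]
      have "l = (x, a ! x) \<or> fst (word (\<kappa>, g) ! fst l) < S \<or>
         a ! fst l \<noteq> snd l \<and> fst (word (\<kappa>, g) ! fst l) < fst (word (\<kappa>, g) ! x)" if l: "l \<in> set (cl J x)" for l
      proof -
        have ln: "fst l < n" using Fn c l by blast
        consider "l = (x, a ! x)" | "fst l \<in> J" | "a ! fst l \<noteq> snd l" "fst l \<noteq> x" "fst l \<notin> J" using c l by blast
        then show ?thesis
        proof cases
          case 3
          then have "fst l \<in> Y J x" using l by (auto simp: Y_def)
          then show ?thesis using less ln x(1) 3 by (simp add: nth)
        qed (use \<kappa>J[OF ln] ln in \<open>auto simp: nth\<close>)
      qed
      then show ?thesis using c by blast
    qed
  qed

  have cardGs: "card (Gs J \<kappa>) = 2 ^ card J * 2 ^ card (Fo J \<kappa>)" if "J \<in> \<J>" for J \<kappa>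
  proof -
    have U: "J \<union> Fo J \<kappa> \<subseteq> {..<n}" using Jn(1)[OF that] FoB[of J \<kappa>] Bn[of J] by blast
    have "card (Gs J \<kappa>) = (\<Prod>i<n. if i \<in> J \<union> Fo J \<kappa> then 2 else 1)"
      unfolding Gs_def by (subst card_PiE) (auto intro!: prod.cong simp: card_UNIV_bool)
    also have "\<dots> = 2 ^ card (J \<union> Fo J \<kappa>)"
    proof -
      have "(\<Prod>i<n. if i \<in> D then 2 else 1) = (2::nat) ^ card D" if "D \<subseteq> {..<n}" for D
        using that by (simp add: prod.If_cases Int_absorb1)
      from this[OF U] show ?thesis .
    qed
    also have "card (J \<union> Fo J \<kappa>) = card J + card (Fo J \<kappa>)"
      using FoB[of J \<kappa>] Bn[of J] Jn[OF that] finB finite_subset by (intro card_Un_disjoint) blast+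
    finally show ?thesis by (simp add: power_add)
  qed

  \<comment> \<open>Exchanging the two sums bounds the mean number of forced variables: each
    \<open>x\<close> in \<open>B J\<close> is forced for at least the fraction
    \<open>last_frac k K\<close> of the keys. Convexity turns this into a bound on the mean of
    \<open>2 ^ card (Fo J \<kappa>)\<close>.\<close>
  have inner: "G ^ card (B J) * card (keys S A n J) \<le> (\<Sum>\<kappa>\<in>keys S A n J. 2 ^ card (Fo J \<kappa>))" if J: "J \<in> \<J>" for J
  proof -
    have "(\<Sum>\<kappa>\<in>keys S A n J. real (card (Fo J \<kappa>))) =
        (\<Sum>\<kappa>\<in>keys S A n J. \<Sum>x\<in>B J. if \<forall>y\<in>Y J x. \<kappa> y < \<kappa> x then 1 else 0)"
      by (intro sum.cong refl) (simp add: Fo_def finB sum.If_cases Int_def)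
    also have "\<dots> = (\<Sum>x\<in>B J. \<Sum>\<kappa>\<in>keys S A n J. if \<forall>y\<in>Y J x. \<kappa> y < \<kappa> x then 1 else 0)"
      by (rule sum.swap)
    also have "\<dots> = (\<Sum>x\<in>B J. real (card {\<kappa> \<in> keys S A n J. \<forall>y\<in>Y J x. \<kappa> y < \<kappa> x}))"
      by (intro sum.cong refl) (simp add: sum.If_cases Int_def)
    also have "\<dots> \<ge> (\<Sum>x\<in>B J. last_frac k K * card (keys S A n J))"
    proof (rule sum_mono)
      fix x assume x: "x \<in> B J"
      note c = cl[OF J x]
      have "Y J x \<subseteq> fst ` set (cl J x) - {x}" by (auto simp: Y_def)
      then have "card (Y J x) \<le> card (fst ` set (cl J x) - {x})" by (intro card_mono) auto
      also have "\<dots> = card (fst ` set (cl J x)) - 1" using c by (subst card_Diff_singleton) force+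
      also have "card (fst ` set (cl J x)) \<le> length (cl J x)"
        by (rule order_trans[OF card_image_le card_length]) simp
      also have "length (cl J x) \<le> k" using F c by (auto simp: clause_ok_def)
      finally have "card (Y J x) \<le> k - 1" by simp
      moreover have "Y J x \<subseteq> {..<n} - J - {x}" using c Fn by (auto simp: Y_def)
      ultimately show "last_frac k K * card (keys S A n J) \<le> real (card {\<kappa> \<in> keys S A n J. \<forall>y\<in>Y J x. \<kappa> y < \<kappa> x})"
        unfolding K_def using x Bn[of J] SA k Jn(1)[OF J] by (intro card_keys_last) auto
    qed
    finally have "(last_frac k K * card (B J)) * card (keys S A n J) \<le> (\<Sum>\<kappa>\<in>keys S A n J. real (card (Fo J \<kappa>)))"
      by (simp add: mult_ac)
    from sum_two_power_ge[OF this] show ?thesis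
      by (simp add: G_def powr_powr[symmetric] powr_realpow)
  qed

  have z: "0 \<le> z" "1 + z \<le> G"
  proof -
    have "1 + z = real (A + S) / K" using K by (simp add: z_def field_simps)
    also have "\<dots> \<le> G" using ratio K(1) by (simp add: G_def K_def[symmetric] field_simps)
    finally show "1 + z \<le> G" .
  qed (simp add: z_def)
  have "real (A + S) ^ n = real K ^ n * (1 + z) ^ card {..<n}"
  proof -
    have "real (A + S) = real K * (1 + z)" using K by (simp add: z_def field_simps)
    then show ?thesis by (simp add: power_mult_distrib)
  qed
  also have "\<dots> \<le> real K ^ n * (\<Sum>J\<in>\<J>. z ^ card J * G ^ card (B J))"
    unfolding B_def
  proof (intro mult_left_mono downset_weight z)
    show "{} \<in> \<J>" using sat by (auto simp: \<J>_def sat_list_def)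
    show "J' \<in> \<J>" if "J \<in> \<J>" "J' \<subseteq> J" for J J' using that unfolding \<J>_def by blast
  qed (auto simp: \<J>_def)
  also have "\<dots> = (\<Sum>J\<in>\<J>. real K ^ n * z ^ card J * G ^ card (B J))"
    by (simp add: sum_distrib_left mult.assoc)
  also have "\<dots> = (\<Sum>J\<in>\<J>. 2 ^ card J * (G ^ card (B J) * card (keys S A n J)))"
  proof (rule sum.cong[OF refl])
    fix J assume J: "J \<in> \<J>"
    have le: "card J \<le> n" using card_mono[OF _ Jn(1)[OF J]] by simp
    have "real K ^ n = real K ^ card J * real K ^ (n - card J)" unfolding power_add[symmetric] using le by simp
    moreover have "real K ^ card J * z ^ card J = (2 * real S) ^ card J"
      unfolding power_mult_distrib[symmetric] z_def using K(1) by simp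
    ultimately have "real K ^ n * z ^ card J = (2 * real S) ^ card J * real K ^ (n - card J)"
      by (metis mult.assoc mult.commute)
    then show "real K ^ n * z ^ card J * G ^ card (B J) = 2 ^ card J * (G ^ card (B J) * card (keys S A n J))"
      by (simp add: card_keys[OF Jn(1)[OF J]] K_def[symmetric] power_mult_distrib)
  qed
  also have "\<dots> \<le> (\<Sum>J\<in>\<J>. 2 ^ card J * (\<Sum>\<kappa>\<in>keys S A n J. 2 ^ card (Fo J \<kappa>)))"
    by (intro sum_mono mult_left_mono inner) simp_all
  also have "\<dots> = real (\<Sum>J\<in>\<J>. \<Sum>\<kappa>\<in>keys S A n J. card (Gs J \<kappa>))"
    by (simp add: cardGs sum_distrib_left)
  also have "(\<Sum>J\<in>\<J>. \<Sum>\<kappa>\<in>keys S A n J. card (Gs J \<kappa>)) =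
      card (SIGMA p : (SIGMA J : \<J>. keys S A n J). Gs (fst p) (snd p))"
    by (simp add: sum.Sigma finJ card_SigmaI Gs_def finite_PiE split_def)
  also have "\<dots> \<le> card (good_words S A n F a)"
  proof (rule card_inj_on_le[where f = "\<lambda>p. word (snd (fst p), snd p)"])
    have ext: "\<kappa> \<in> extensional {..<n}" if "\<kappa> \<in> keys S A n J" for \<kappa> J using that by (simp add: keys_def PiE_def)
    have extG: "g \<in> extensional {..<n}" if "g \<in> Gs J \<kappa>" for g J \<kappa> using that by (simp add: Gs_def PiE_def)
    \<comment> \<open>The open set can be read off from the keys, so no word is counted for two
      different sets \<open>J\<close>.\<close>
    have keyJ: "J = {i. i < n \<and> \<kappa> i < S}" if "J \<in> \<J>" "\<kappa> \<in> keys S A n J" for J \<kappa>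
    proof -
      have "\<kappa> i < S \<longleftrightarrow> i \<in> J" if "i < n" for i
        using PiE_mem[OF \<open>\<kappa> \<in> keys S A n J\<close>[unfolded keys_def], of i] that by (auto split: if_splits)
      then show ?thesis using Jn(1)[OF that(1)] by auto
    qed
    show "inj_on (\<lambda>p. word (snd (fst p), snd p)) (SIGMA p : (SIGMA J : \<J>. keys S A n J). Gs (fst p) (snd p))"
    proof (rule inj_onI, clarsimp)
      fix J \<kappa> g J' \<kappa>' g'
      assume *: "J \<in> \<J>" "\<kappa> \<in> keys S A n J" "g \<in> Gs J \<kappa>" "J' \<in> \<J>" "\<kappa>' \<in> keys S A n J'" "g' \<in> Gs J' \<kappa>'"
        and eq: "word (\<kappa>, g) = word (\<kappa>', g')"
      have "\<kappa> i = \<kappa>' i \<and> g i = g' i" if "i < n" for i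
        using arg_cong[OF eq, of "\<lambda>w. w ! i"] that by (simp add: word_def)
      then have "\<kappa> = \<kappa>'" "g = g'"
        using ext[OF *(2)] ext[OF *(5)] extG[OF *(3)] extG[OF *(6)] by (auto intro!: extensionalityI)
      then show "J = J' \<and> \<kappa> = \<kappa>' \<and> g = g'" using keyJ[OF *(1,2)] keyJ[OF *(4,5)] by simp
    qed
    show "(\<lambda>p. word (snd (fst p), snd p)) ` (SIGMA p : (SIGMA J : \<J>. keys S A n J). Gs (fst p) (snd p)) \<subseteq> good_words S A n F a"
      using good by auto
    have "good_words S A n F a \<subseteq> {w. set w \<subseteq> {..<A} \<times> UNIV \<and> length w = n}"
      by (auto simp: good_words_def)
    then show "finite (good_words S A n F a)"
      by (rule finite_subset) (intro finite_lists_length_eq; simp)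
  qed
  finally show ?thesis by simp
qed

section \<open>Choice of the parameters\<close>

text \<open>The linear terms of the two quadratic bounds cancel. The constant 1 at
  \<open>z\<^sup>2\<close> is good enough for the application, where \<open>z\<close> contains the
  factor \<open>ln 2 / 2\<close>.\<close>

lemma cosh_le_exp_square:
  fixes z :: real
  assumes "0 \<le> z" "z \<le> 1"
  shows "(exp z + exp (- z)) / 2 \<le> exp (z\<^sup>2)"
proof -
  \<comment> \<open>The product equals \<open>1 + z ^ 3\<close>.\<close>
  have "1 \<le> (1 + z) * (1 - z + z\<^sup>2)"
    using assms by (simp add: algebra_simps power2_eq_square)
  also have "\<dots> \<le> exp z * (1 - z + z\<^sup>2)"
    using assms by (intro mult_right_mono exp_ge_add_one_self) simp
  finally have "exp (- z) \<le> 1 - z + z\<^sup>2"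
    by (simp add: exp_minus field_simps)
  moreover have "exp z \<le> 1 + z + z\<^sup>2" using assms by (intro exp_bound)
  ultimately have "(exp z + exp (- z)) / 2 \<le> 1 + z\<^sup>2" by simp
  also have "\<dots> \<le> exp (z\<^sup>2)" by (rule exp_ge_add_one_self)
  finally show ?thesis .
qed

text \<open>For \<open>y = 1 / k\<close> the exponent \<open>(y - y\<^sup>2) / 2\<close> is the
  saving per variable claimed in the theorem. Dividing by \<open>exp z\<close> with
  \<open>z = ln 2 * y / 2\<close> makes the inequality symmetric and turns it into an upper bound on
  \<open>cosh z\<close>. Its strictness is the slack that later pays for rounding and ties.\<close>

lemma ratio_less:
  fixes y :: real
  assumes "0 < y" "y \<le> 1"
  shows "2 powr ((y - y\<^sup>2) / 2) * (1 + 2 powr y) < 2 * 2 powr y"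
proof -
  define l where "l = ln (2::real)"
  have l: "0 < l" "l \<le> 1" using ln_le_minus_one[of "2::real"] by (simp_all add: l_def)
  define z where "z = l * y / 2"
  have z: "0 \<le> z" "z \<le> 1" using assms l mult_mono[of l 1 y 1] by (simp_all add: z_def)
  have P: "2 powr x = exp (l * x)" for x by (simp add: powr_def l_def mult.commute)
  have "2 powr ((y - y\<^sup>2) / 2) * (1 + 2 powr y) = 2 * 2 powr y * (exp (- (l * y\<^sup>2 / 2)) * ((exp z + exp (- z)) / 2))"
  proof -
    have "2 powr ((y - y\<^sup>2) / 2) = exp (l * y) * exp (- z) * exp (- (l * y\<^sup>2 / 2))"
      unfolding P exp_add[symmetric] by (simp add: z_def field_simps)
    moreover have "1 + 2 powr y = exp z * (exp z + exp (- z))"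
      unfolding P by (simp add: distrib_left z_def flip: exp_add)
    moreover have "exp (- z) * exp z = 1" by (simp flip: exp_add)
    ultimately show ?thesis unfolding P by (simp add: algebra_simps)
  qed
  also have "\<dots> < 2 * 2 powr y * 1"
  proof (rule mult_strict_left_mono)
    have "exp (- (l * y\<^sup>2 / 2)) * ((exp z + exp (- z)) / 2) \<le> exp (- (l * y\<^sup>2 / 2)) * exp (z\<^sup>2)"
      by (intro mult_left_mono cosh_le_exp_square z) simp
    also have "\<dots> = exp (z\<^sup>2 - l * y\<^sup>2 / 2)" by (simp flip: exp_add)
    also have "\<dots> < 1"
    proof -
      have "z\<^sup>2 = l * (l * y\<^sup>2) / 4" by (simp add: z_def power2_eq_square)
      also have "\<dots> \<le> 1 * (l * y\<^sup>2) / 4" using l by (intro divide_right_mono mult_right_mono) simp_all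
      also have "\<dots> < l * y\<^sup>2 / 2" using l assms by simp
      finally show ?thesis by simp
    qed
    finally show "exp (- (l * y\<^sup>2 / 2)) * ((exp z + exp (- z)) / 2) < 1" .
  qed simp
  finally show ?thesis by simp
qed

text \<open>A discrete integral of \<open>x ^ (k - 1)\<close>: the differences of consecutive
  \<open>k\<close>-th powers are at most \<open>k\<close> times the larger base to the power
  \<open>k - 1\<close>, and they telescope.\<close>

lemma last_frac_ge:
  assumes "1 \<le> k" "1 \<le> K"
  shows "(1 - 1 / real K) ^ k / real k \<le> last_frac k K"
proof -
  have step: "real (Suc i) ^ k - real i ^ k \<le> real k * real (Suc i) ^ (k - 1)" for i
  proof -
    have "real (Suc i) ^ k - real i ^ k = (real (Suc i) - real i) * (\<Sum>j<k. real i ^ (k - Suc j) * real (Suc i) ^ j)"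
      by (rule power_diff_sumr2)
    also have "\<dots> = (\<Sum>j<k. real i ^ (k - Suc j) * real (Suc i) ^ j)" by simp
    also have "\<dots> \<le> (\<Sum>j<k. real (Suc i) ^ (k - 1))"
    proof (rule sum_mono)
      fix j assume "j \<in> {..<k}"
      then have "real (Suc i) ^ (k - 1) = real (Suc i) ^ (k - Suc j) * real (Suc i) ^ j"
        by (simp flip: power_add)
      then show "real i ^ (k - Suc j) * real (Suc i) ^ j \<le> real (Suc i) ^ (k - 1)"
        by (simp add: mult_right_mono power_mono)
    qed
    finally show ?thesis by simp
  qed
  have ind: "real m ^ k \<le> real k * (\<Sum>i<Suc m. real i ^ (k - 1))" for m
  proof (induction m)
    case 0
    show ?case using assms(1) by (simp add: power_0_left)
  next
    case (Suc m)
    then show ?case using step[of m] by (simp add: distrib_left)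
  qed
  have "(1 - 1 / real K) ^ k / real k = real (K - 1) ^ k / (real k * real K ^ k)"
  proof -
    have "1 - 1 / real K = real (K - 1) / K" using assms(2) by (simp add: of_nat_diff field_simps)
    then show ?thesis by (simp add: power_divide)
  qed
  also have "\<dots> \<le> (real k * (\<Sum>i<K. real i ^ (k - 1))) / (real k * real K ^ k)"
    using ind[of "K - 1"] assms(2) by (intro divide_right_mono) simp_all
  also have "\<dots> = last_frac k K" using assms(1) by (simp add: last_frac_def)
  finally show ?thesis .
qed

text \<open>\<open>b0 = 2 powr u - 1\<close> is the quotient \<open>S / A\<close> that would make
  the last claim an equality. By \<open>ratio_less\<close> the limit form of the second claim is
  strict at \<open>b0\<close>, and both errors, the rounding of \<open>S\<close> and the gap between
  \<open>last_frac\<close> and \<open>1 / k\<close>, vanish as \<open>m\<close> grows.\<close>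

lemma parameters_exist:
  assumes k: "1 \<le> k"
  obtains m S :: nat where "S < 2 ^ m"
    and "real (2 ^ m + S) \<le> real (2 ^ m - S) * 2 powr last_frac k (2 ^ m - S)"
    and "2 powr ((real k - 1) / (2 * (real k)\<^sup>2)) \<le> real (2 ^ m + S) / 2 ^ m"
proof -
  define y where "y = 1 / real k"
  have y: "0 < y" "y \<le> 1" using k by (simp_all add: y_def)
  define u where "u = (y - y\<^sup>2) / 2"
  have u: "u = (real k - 1) / (2 * (real k)\<^sup>2)"
    using k by (simp add: u_def y_def field_simps power2_eq_square)
  have "y\<^sup>2 \<le> y" using y by (simp add: power2_eq_square mult_left_le)
  then have u0: "0 \<le> u" by (simp add: u_def)
  have "u \<le> y / 2" by (simp add: u_def)
  then have u1: "u < 1" using y by simp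
  define b0 where "b0 = 2 powr u - 1"
  have b0: "0 \<le> b0" "b0 < 1"
    using powr_mono[of 0 u "2::real"] powr_less_mono[of u 1 "2::real"] u0 u1 by (simp_all add: b0_def)
  have lim_ratio: "(1 + b0) / (1 - b0) < 2 powr y"
    using ratio_less[OF y] b0 by (simp add: b0_def u_def field_simps)
  \<comment> \<open>Rounding up preserves the last claim exactly, so only the second one has to be
    rescued by a limit.\<close>
  define S where "S m = nat \<lceil>b0 * 2 ^ m\<rceil>" for m :: nat
  have S: "b0 * 2 ^ m \<le> real (S m)" "real (S m) < b0 * 2 ^ m + 1" for m
    using b0 by (simp_all add: S_def) linarith+
  define b where "b m = real (S m) / 2 ^ m" for m
  have pow0: "(\<lambda>m. (1 / 2 :: real) ^ m) \<longlonglongrightarrow> 0" by (rule LIMSEQ_power_zero) simp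
  have blim: "b \<longlonglongrightarrow> b0"
  proof (rule tendsto_sandwich)
    show "\<forall>\<^sub>F m in sequentially. b0 \<le> b m"
      using S(1) by (intro always_eventually) (simp add: b_def field_simps)
    show "\<forall>\<^sub>F m in sequentially. b m \<le> b0 + (1 / 2) ^ m"
      using S(2) by (intro always_eventually) (simp add: b_def field_simps less_imp_le)
    show "(\<lambda>m. b0 + (1 / 2) ^ m) \<longlonglongrightarrow> b0" using tendsto_add[OF tendsto_const pow0, of b0] by simp
  qed simp
  \<comment> \<open>Here \<open>(1 / 2) ^ m / (1 - b m)\<close> is \<open>1 / K\<close> for
    \<open>K = 2 ^ m - S m\<close>, so the exponent is the lower bound from
    \<open>last_frac_ge\<close>.\<close>
  have glim: "(\<lambda>m. 2 powr ((1 - (1 / 2) ^ m / (1 - b m)) ^ k / k)) \<longlonglongrightarrow> 2 powr ((1 - 0 / (1 - b0)) ^ k / k)"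
    using b0 k by (intro tendsto_intros blim pow0) auto
  have rlim: "(\<lambda>m. (1 + b m) / (1 - b m)) \<longlonglongrightarrow> (1 + b0) / (1 - b0)"
    using b0 by (intro tendsto_intros blim) auto
  have "(\<lambda>m. 2 powr ((1 - (1 / 2) ^ m / (1 - b m)) ^ k / k) - (1 + b m) / (1 - b m)) \<longlonglongrightarrow>
      2 powr y - (1 + b0) / (1 - b0)"
    using tendsto_diff[OF glim rlim] by (simp add: y_def)
  then have "\<forall>\<^sub>F m in sequentially. 0 < 2 powr ((1 - (1 / 2) ^ m / (1 - b m)) ^ k / k) - (1 + b m) / (1 - b m)"
    using lim_ratio by (intro order_tendstoD) auto
  moreover have "\<forall>\<^sub>F m in sequentially. b m < 1" using blim b0(2) by (rule order_tendstoD)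
  ultimately have "\<forall>\<^sub>F m in sequentially. 0 < 2 powr ((1 - (1 / 2) ^ m / (1 - b m)) ^ k / k) - (1 + b m) / (1 - b m) \<and> b m < 1"
    by (rule eventually_conj)
  then obtain m where m: "(1 + b m) / (1 - b m) < 2 powr ((1 - (1 / 2) ^ m / (1 - b m)) ^ k / k)" "b m < 1"
    by (auto simp: eventually_sequentially)
  have SA: "S m < 2 ^ m"
  proof -
    have "real (S m) < real (2 ^ m)" using m(2) by (simp add: b_def)
    then show ?thesis by (simp only: of_nat_less_iff)
  qed
  define K where "K = 2 ^ m - S m"
  have K: "1 \<le> K" "real K = 2 ^ m * (1 - b m)"
    using SA by (simp_all add: K_def b_def of_nat_diff less_imp_le field_simps)
  show thesis
  proof (rule that[OF SA])
    have "real (2 ^ m + S m) = 2 ^ m * (1 + b m)" by (simp add: b_def field_simps)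
    also have "\<dots> = real K * ((1 + b m) / (1 - b m))" using m(2) by (simp add: K(2))
    also have "\<dots> \<le> real K * 2 powr last_frac k K"
    proof (rule mult_left_mono)
      have "(1 - (1 / 2) ^ m / (1 - b m)) ^ k / k = (1 - 1 / real K) ^ k / k"
        by (simp add: K(2) power_one_over)
      also have "\<dots> \<le> last_frac k K" by (rule last_frac_ge[OF k K(1)])
      finally have "2 powr ((1 - (1 / 2) ^ m / (1 - b m)) ^ k / k) \<le> 2 powr last_frac k K"
        by (rule powr_mono) simp
      then show "(1 + b m) / (1 - b m) \<le> 2 powr last_frac k K" using m(1) by (rule order_trans[OF less_imp_le, rotated])
    qed simp
    finally show "real (2 ^ m + S m) \<le> real (2 ^ m - S m) * 2 powr last_frac k (2 ^ m - S m)"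
      by (simp add: K_def)
    have "2 powr u \<le> 1 + b m" using S(1)[of m] by (simp add: b0_def b_def field_simps)
    also have "\<dots> = real (2 ^ m + S m) / 2 ^ m" by (simp add: b_def field_simps)
    finally show "2 powr ((real k - 1) / (2 * (real k)\<^sup>2)) \<le> real (2 ^ m + S m) / 2 ^ m"
      unfolding u .
  qed
qed

section \<open>Randomized execution\<close>

definition pr :: "(store \<times> nat) spmf \<Rightarrow> (store \<Rightarrow> bool) \<Rightarrow> real" where
  "pr D X = measure (measure_spmf D) {x. X (fst x)}"

text \<open>Collects what holds for all coin flips. Losslessness is included because a bound on the
  outcomes in the support would not exclude divergence.\<close>

definition safe :: "(store \<times> nat) spmf \<Rightarrow> nat \<Rightarrow> (store \<Rightarrow> bool) \<Rightarrow> bool" where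
  "safe D \<tau> Q \<longleftrightarrow> lossless_spmf D \<and> (\<forall>x\<in>set_spmf D. Q (fst x) \<and> snd x \<le> \<tau>)"

lemma safe_return: "Q s \<Longrightarrow> t \<le> \<tau> \<Longrightarrow> safe (return_spmf (s, t)) \<tau> Q"
  by (simp add: safe_def)

lemma safe_mono: "safe D \<tau> Q \<Longrightarrow> \<tau> \<le> \<tau>' \<Longrightarrow> (\<And>s. Q s \<Longrightarrow> Q' s) \<Longrightarrow> safe D \<tau>' Q'"
  unfolding safe_def by (meson order_trans)

lemma safe_bind:
  assumes "safe D \<tau> R" and "\<And>s. R s \<Longrightarrow> safe (f s) \<tau>' Q"
  shows "safe (bind_time D f) (\<tau> + \<tau>') Q"
  unfolding safe_def
proof
  show "lossless_spmf (bind_time D f)"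
    using assms unfolding safe_def bind_time_def by (auto simp: split_def)
  show "\<forall>x\<in>set_spmf (bind_time D f). Q (fst x) \<and> snd x \<le> \<tau> + \<tau>'"
    using assms unfolding safe_def bind_time_def
    by (fastforce simp: set_bind_spmf split_def intro: add_mono)
qed

lemma pr_nonneg [simp]: "0 \<le> pr D X"
  by (simp add: pr_def)

lemma pr_mono: "(\<And>s. X s \<Longrightarrow> Y s) \<Longrightarrow> pr D X \<le> pr D Y"
  unfolding pr_def by (intro measure_spmf.finite_measure_mono) auto

lemma pr_return [simp]: "pr (return_spmf (s, t)) X = (if X s then 1 else 0)"
  by (simp add: pr_def measure_spmf_return_spmf measure_return)

lemma pr_conv_spmf: "pr D X = spmf (map_spmf (\<lambda>x. X (fst x)) D) True"
  unfolding pr_def by (simp add: spmf_map vimage_def)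

lemma pr_bind_time:
  "pr (bind_time D f) Y = (\<integral>x. pr (f (fst x)) Y \<partial>measure_spmf D)"
proof -
  have "map_spmf (\<lambda>x. Y (fst x)) (bind_time D f) = bind_spmf D (\<lambda>x. map_spmf (\<lambda>y. Y (fst y)) (f (fst x)))"
    unfolding bind_time_def
    by (simp add: map_spmf_bind_spmf split_def o_def map_spmf_conv_bind_spmf)
  then show ?thesis by (simp add: pr_conv_spmf spmf_bind)
qed

lemma pr_bind_return: "pr (bind_time (return_spmf (s, t)) f) Y = pr (f s) Y"
  by (simp add: pr_conv_spmf spmf.map_comp o_def split_def)

text \<open>The law of total probability for the event \<open>X\<close> after the first stage;
  losslessness gives its complement the weight \<open>1 - pr D X\<close>. The second bound
  \<open>\<beta>\<close> serves the loop rule, where a failed round leaves the chances of the later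
  ones.\<close>

lemma pr_bind_time_ge:
  assumes "lossless_spmf D" and "0 \<le> \<alpha>" "0 \<le> \<beta>"
    and X: "\<And>x. x \<in> set_spmf D \<Longrightarrow> X (fst x) \<Longrightarrow> \<alpha> \<le> pr (f (fst x)) Y"
    and nX: "\<And>x. x \<in> set_spmf D \<Longrightarrow> \<not> X (fst x) \<Longrightarrow> \<beta> \<le> pr (f (fst x)) Y"
  shows "\<alpha> * pr D X + \<beta> * (1 - pr D X) \<le> pr (bind_time D f) Y"
proof -
  interpret prob_space "measure_spmf D"
    by (rule prob_spaceI) (use assms(1) in \<open>simp add: measure_spmf.emeasure_eq_measure lossless_spmf_def weight_spmf_def\<close>)
  have int: "integrable (measure_spmf D) (indicator B :: _ \<Rightarrow> real)" for B
    by (rule measure_spmf.integrable_const_bound[of _ 1]) (simp_all add: indicator_def)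
  let ?A = "{x :: store \<times> nat. X (fst x)}"
  have "\<alpha> * pr D X + \<beta> * (1 - pr D X) = (\<integral>x. \<alpha> * indicator ?A x + \<beta> * indicator (- ?A) x \<partial>measure_spmf D)"
  proof -
    have "prob (- ?A) = 1 - prob ?A" using prob_compl[of ?A] by (simp add: Compl_eq_Diff_UNIV space_measure_spmf)
    then show ?thesis by (simp add: pr_def int)
  qed
  also have "\<dots> \<le> (\<integral>x. pr (f (fst x)) Y \<partial>measure_spmf D)"
  proof (rule integral_mono_AE)
    show "AE x in measure_spmf D. \<alpha> * indicator ?A x + \<beta> * indicator (- ?A) x \<le> pr (f (fst x)) Y"
      using X nX by (auto simp: AE_measure_spmf_iff split: split_indicator)
    show "integrable (measure_spmf D) (\<lambda>x. pr (f (fst x)) Y)"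
      by (rule measure_spmf.integrable_const_bound[of _ 1]) (simp_all add: pr_def measure_spmf.subprob_measure_le_1)
  qed (simp add: int)
  finally show ?thesis by (simp add: pr_bind_time)
qed

lemma pr_bind_ge:
  assumes "lossless_spmf D" and "0 \<le> \<alpha>"
    and "\<And>s. X s \<Longrightarrow> \<alpha> \<le> pr (f s) Y"
  shows "\<alpha> * pr D X \<le> pr (bind_time D f) Y"
  using pr_bind_time_ge[of D \<alpha> 0 X f Y] assms by simp

lemma pr_safe:
  assumes "safe D \<tau> Q"
  shows "pr D Q = 1"
proof -
  have "1 * pr D (\<lambda>_. True) + 0 * (1 - pr D (\<lambda>_. True)) = 1"
    using assms by (simp add: pr_def safe_def lossless_spmf_def weight_spmf_def space_measure_spmf)
  moreover have "measure (measure_spmf D) {x. Q (fst x)} = measure (measure_spmf D) UNIV"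
    using assms by (intro measure_spmf.finite_measure_eq_AE) (auto simp: safe_def AE_measure_spmf_iff)
  ultimately show ?thesis by (simp add: pr_def)
qed

text \<open>
  Loop rule: \<open>\<mu>\<close> is the exact number of remaining rounds, and a round that starts without success
  succeeds with probability at least \<open>\<epsilon>\<close>.
\<close>

lemma safe_While:
  assumes "I s"
    and guard: "\<And>s. I s \<Longrightarrow> val e s = Leaf \<longleftrightarrow> \<mu> s = 0"
    and body: "\<And>s. I s \<Longrightarrow> 0 < \<mu> s \<Longrightarrow> safe (exec q c s) \<tau> (\<lambda>s'. I s' \<and> Suc (\<mu> s') = \<mu> s)"
  shows "safe (exec q (While e c) s) (\<mu> s * (1 + cost e + \<tau>) + (1 + cost e)) (\<lambda>s'. I s' \<and> \<mu> s' = 0)"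
  using assms(1)
proof (induction "\<mu> s" arbitrary: s)
  case 0
  then have "val e s = Leaf" using guard[of s] by simp
  then have "exec q (While e c) s = return_spmf (s, 1 + cost e)" by (subst exec_While) simp
  then show ?case using 0 by (simp only: safe_return)
next
  case (Suc m)
  then have "val e s \<noteq> Leaf" using guard[of s] by simp
  then have ex: "exec q (While e c) s = bind_time (return_spmf (s, 1 + cost e)) (\<lambda>_. bind_time (exec q c s) (exec q (While e c)))"
    by (subst exec_While) simp
  have "safe (exec q (While e c) s) ((1 + cost e) + (\<tau> + (m * (1 + cost e + \<tau>) + (1 + cost e)))) (\<lambda>s'. I s' \<and> \<mu> s' = 0)"
    unfolding ex
  proof (rule safe_bind[where R = "\<lambda>_. True"], simp add: safe_return, rule safe_bind)
    show "safe (exec q c s) \<tau> (\<lambda>s'. I s' \<and> Suc (\<mu> s') = \<mu> s)" using Suc by (intro body) simp_all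
    show "safe (exec q (While e c) s') (m * (1 + cost e + \<tau>) + (1 + cost e)) (\<lambda>s'. I s' \<and> \<mu> s' = 0)"
      if "I s' \<and> Suc (\<mu> s') = \<mu> s" for s'
    proof -
      note I = that
      from I have "m = \<mu> s'" using Suc.hyps(2) by simp
      then show ?thesis using Suc.hyps(1)[of s'] I by blast
    qed
  qed
  then show ?case unfolding Suc.hyps(2)[symmetric] by (simp add: add_ac)
qed

lemma pr_While:
  assumes "I s" and \<epsilon>: "0 \<le> \<epsilon>" "\<epsilon> \<le> 1"
    and guard: "\<And>s. I s \<Longrightarrow> val e s = Leaf \<longleftrightarrow> \<mu> s = 0"
    and body: "\<And>s. I s \<Longrightarrow> 0 < \<mu> s \<Longrightarrow> safe (exec q c s) \<tau>
      (\<lambda>s'. I s' \<and> Suc (\<mu> s') = \<mu> s \<and> (G s \<longrightarrow> G s'))"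
    and success: "\<And>s. I s \<Longrightarrow> 0 < \<mu> s \<Longrightarrow> \<not> G s \<Longrightarrow> \<epsilon> \<le> pr (exec q c s) G"
  shows "1 - (1 - \<epsilon>) ^ \<mu> s \<le> pr (exec q (While e c) s) G"
  using assms(1)
proof (induction "\<mu> s" arbitrary: s)
  case 0
  then show ?case using 0 by (simp flip: 0(1))
next
  case (Suc m)
  let ?D = "exec q c s"
  let ?r = "1 - (1 - \<epsilon>) ^ m"
  have r: "0 \<le> ?r" "?r \<le> 1" using \<epsilon> by (simp_all add: power_le_one)
  have "val e s \<noteq> Leaf" using guard[of s] Suc by simp
  then have ex: "exec q (While e c) s = bind_time (return_spmf (s, 1 + cost e)) (\<lambda>_. bind_time ?D (exec q (While e c)))"
    by (subst exec_While) simp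
  have S: "safe ?D \<tau> (\<lambda>s'. I s' \<and> Suc (\<mu> s') = \<mu> s \<and> (G s \<longrightarrow> G s'))"
    using Suc by (intro body) simp_all
  \<comment> \<open>No round destroys success, so strengthening the loop invariant by
    \<open>G\<close> makes the outcome certain.\<close>
  have found: "1 \<le> pr (exec q (While e c) s') G" if "I s'" "G s'" for s'
  proof -
    have "safe (exec q (While e c) s') (\<mu> s' * (1 + cost e + \<tau>) + (1 + cost e)) (\<lambda>s''. (I s'' \<and> G s'') \<and> \<mu> s'' = 0)"
      using that by (intro safe_While guard safe_mono[OF body]) auto
    from pr_safe[OF this] pr_mono[of _ G] show ?thesis by (metis (no_types, lifting))
  qed
  have "1 - (1 - \<epsilon>) ^ Suc m \<le> pr (bind_time ?D (exec q (While e c))) G"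
  proof (cases "G s")
    case True
    have "1 * pr ?D (\<lambda>s'. I s' \<and> Suc (\<mu> s') = \<mu> s \<and> (G s \<longrightarrow> G s')) \<le> pr (bind_time ?D (exec q (While e c))) G"
      using S True found by (intro pr_bind_ge) (auto simp: safe_def)
    then have "1 \<le> pr (bind_time ?D (exec q (While e c))) G" using pr_safe[OF S] by simp
    then show ?thesis using \<epsilon> by (smt (verit) zero_le_power)
  next
    case False
    have "\<epsilon> \<le> pr ?D G" using Suc False by (intro success) simp_all
    \<comment> \<open>With \<open>p = pr ?D G\<close> the first round and the rest succeed with
      probability at least \<open>p + ?r * (1 - p)\<close>. This increases with \<open>p\<close>
      because \<open>?r \<le> 1\<close>, so \<open>p\<close> may be lowered to
      \<open>\<epsilon>\<close>.\<close>
    then have "\<epsilon> * (1 - ?r) \<le> pr ?D G * (1 - ?r)" using r by (intro mult_right_mono) simp_all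
    then have "1 - (1 - \<epsilon>) ^ Suc m \<le> 1 * pr ?D G + ?r * (1 - pr ?D G)" by (simp add: algebra_simps)
    also have "\<dots> \<le> pr (bind_time ?D (exec q (While e c))) G"
    proof (rule pr_bind_time_ge)
      show "lossless_spmf ?D" using S by (simp add: safe_def)
      fix x assume x: "x \<in> set_spmf ?D"
      then have Ix: "I (fst x)" "m = \<mu> (fst x)" using S Suc.hyps(2) by (auto simp: safe_def)
      show "1 \<le> pr (exec q (While e c) (fst x)) G" if "G (fst x)" using found Ix that by blast
      show "?r \<le> pr (exec q (While e c) (fst x)) G" using Suc.hyps(1)[OF Ix(2,1)] Ix(2) by simp
    qed (use r in simp_all)
    finally show ?thesis .
  qed
  then show ?case unfolding ex Suc.hyps(2)[symmetric]
    by (simp only: pr_bind_return)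
qed

section \<open>Rules for single commands\<close>

lemma safe_Assign: "Q (s(x := val e s)) \<Longrightarrow> safe (exec q (Assign x e) s) (1 + cost e) Q"
  by (simp add: safe_return)

lemma safe_Seq:
  "safe (exec q c s) \<tau> R \<Longrightarrow> (\<And>s'. R s' \<Longrightarrow> safe (exec q d s') \<tau>' Q) \<Longrightarrow>
     safe (exec q (Seq c d) s) (\<tau> + \<tau>') Q"
  by (simp add: safe_bind)

lemma safe_Flip:
  "(\<And>b. Q (s(x := enc_bool b))) \<Longrightarrow> safe (exec q (Flip x) s) 1 Q"
  by (auto simp: safe_def)

lemma safe_Cond:
  assumes "safe (exec q (if val e s \<noteq> Leaf then c else d) s) \<tau> Q"
  shows "safe (exec q (Cond e c d) s) (1 + cost e + \<tau>) Q"
proof -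
  have "exec q (Cond e c d) s = bind_time (return_spmf (s, 1 + cost e)) (\<lambda>_. exec q (if val e s \<noteq> Leaf then c else d) s)"
    by simp
  then show ?thesis using assms by (simp only:) (rule safe_bind[where R = "\<lambda>_. True"], auto intro: safe_return)
qed

lemma pr_Assign: "X (s(x := val e s)) \<Longrightarrow> pr (exec q (Assign x e) s) X = 1"
  by simp

lemma pr_Cond: "pr (exec q (Cond e c d) s) X = pr (exec q (if val e s \<noteq> Leaf then c else d) s) X"
  unfolding exec.simps pr_bind_return by simp

lemma pr_Seq:
  assumes "safe (exec q c s) \<tau> R" and "\<beta> \<le> pr (exec q c s) X" and "0 \<le> \<alpha>"
    and "\<And>s'. X s' \<Longrightarrow> \<alpha> \<le> pr (exec q d s') Y"
  shows "\<alpha> * \<beta> \<le> pr (exec q (Seq c d) s) Y"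
proof -
  have "\<alpha> * \<beta> \<le> \<alpha> * pr (exec q c s) X" using assms by (intro mult_left_mono)
  also have "\<dots> \<le> pr (exec q (Seq c d) s) Y"
    using assms by (simp add: pr_bind_ge safe_def)
  finally show ?thesis .
qed

lemma pr_Flip:
  assumes "X (s(x := enc_bool b))"
  shows "1 / 2 \<le> pr (exec q (Flip x) s) X"
proof -
  have "1 / 2 = measure (measure_spmf coin_spmf) {b}"
    by (simp add: spmf_conv_measure_spmf[symmetric] spmf_of_set)
  also have "\<dots> \<le> measure (measure_spmf coin_spmf) ((\<lambda>b. X (s(x := enc_bool b))) -` {True})"
    using assms by (intro measure_spmf.finite_measure_mono) auto
  also have "\<dots> = pr (exec q (Flip x) s) X"
    by (simp add: pr_conv_spmf spmf.map_comp o_def spmf_map)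
  finally show ?thesis .
qed

lemma pr_While_true:
  assumes "val e s \<noteq> Leaf"
  shows "pr (exec q (While e c) s) X = pr (exec q (Seq c (While e c)) s) X"
proof -
  have "exec q (While e c) s = bind_time (return_spmf (s, 1 + cost e)) (\<lambda>_. exec q (Seq c (While e c)) s)"
    using assms by (subst exec_While) simp
  then show ?thesis by (simp only: pr_bind_return)
qed

lemma pr_While_false:
  assumes "val e s = Leaf"
  shows "pr (exec q (While e c) s) X = (if X s then 1 else 0)"
proof -
  have "exec q (While e c) s = return_spmf (s, 1 + cost e)" using assms by (subst exec_While) simp
  then show ?thesis by simp
qed


text \<open>Drawing a uniform \<open>m\<close>-bit number, whose leading bits are \<open>v\<close>, into register 4.\<close>

primrec draw :: "nat \<Rightarrow> nat \<Rightarrow> com" where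
  "draw 0 v = Assign 4 (const_exp (enc_nat v))"
| "draw (Suc m) v = Seq (Flip 5) (Cond (Var 5) (draw m (2 * v + 1)) (draw m (2 * v)))"

definition same_except :: "nat set \<Rightarrow> store \<Rightarrow> store \<Rightarrow> bool" where
  "same_except R s s' \<longleftrightarrow> (\<forall>r. r \<notin> R \<longrightarrow> s' r = s r)"

text \<open>\<open>m\<close> depends on \<open>k\<close> only, so a draw takes constant time; the
  bound \<open>\<tau>\<close> is uniform in the store and in the subroutine.\<close>

lemma safe_draw:
  "\<exists>\<tau>. \<forall>q s. safe (exec q (draw m v) s) \<tau>
     (\<lambda>s'. (\<exists>j<2 ^ m. s' 4 = enc_nat (v * 2 ^ m + j)) \<and> same_except {4, 5} s s')"
proof (induction m arbitrary: v)
  case 0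
  show ?case by (auto simp: same_except_def intro!: exI safe_return)
next
  case (Suc m)
  let ?P = "\<lambda>v s s'. (\<exists>j<2 ^ m. s' 4 = enc_nat (v * 2 ^ m + j)) \<and> same_except {4, 5} s s'"
  obtain \<tau>1 where 1: "\<And>q s. safe (exec q (draw m (2 * v + 1)) s) \<tau>1 (?P (2 * v + 1) s)"
    using Suc[of "2 * v + 1"] by blast
  obtain \<tau>0 where 0: "\<And>q s. safe (exec q (draw m (2 * v)) s) \<tau>0 (?P (2 * v) s)"
    using Suc[of "2 * v"] by blast
  let ?Q = "\<lambda>s s'. (\<exists>j<2 ^ Suc m. s' 4 = enc_nat (v * 2 ^ Suc m + j)) \<and> same_except {4, 5} s s'"
  have P1: "?Q s s'" if P: "?P (2 * v + 1) s1 s'" "same_except {5} s s1" for s s1 s'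
  proof -
    obtain j where "j < 2 ^ m" "s' 4 = enc_nat ((2 * v + 1) * 2 ^ m + j)" using P(1) by blast
    then have "2 ^ m + j < 2 ^ Suc m \<and> s' 4 = enc_nat (v * 2 ^ Suc m + (2 ^ m + j))" by (simp add: algebra_simps)
    then show ?thesis using P unfolding same_except_def by fastforce
  qed
  have P0: "?Q s s'" if P: "?P (2 * v) s1 s'" "same_except {5} s s1" for s s1 s'
  proof -
    obtain j where "j < 2 ^ m" "s' 4 = enc_nat ((2 * v) * 2 ^ m + j)" using P(1) by blast
    then have "j < 2 ^ Suc m \<and> s' 4 = enc_nat (v * 2 ^ Suc m + j)" by (simp add: algebra_simps)
    then show ?thesis using P unfolding same_except_def by fastforce
  qed
  have "safe (exec q (draw (Suc m) v) s) (1 + (1 + cost (Var 5) + (\<tau>1 + \<tau>0))) (?Q s)" for q s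
    unfolding draw.simps
  proof (rule safe_Seq[OF safe_Flip[where Q = "\<lambda>s'. same_except {5} s s'"]])
    show "same_except {5} s (s(5 := enc_bool b))" for b by (simp add: same_except_def)
    fix s1 assume s1: "same_except {5} s s1"
    show "safe (exec q (Cond (Var 5) (draw m (2 * v + 1)) (draw m (2 * v))) s1) (1 + cost (Var 5) + (\<tau>1 + \<tau>0)) (?Q s)"
    proof (rule safe_Cond, cases "val (Var 5) s1 \<noteq> Leaf")
      case True
      show "safe (exec q (if val (Var 5) s1 \<noteq> Leaf then draw m (2 * v + 1) else draw m (2 * v)) s1) (\<tau>1 + \<tau>0) (?Q s)"
        unfolding if_P[OF True] by (rule safe_mono[OF 1]) (simp, rule P1[OF _ s1])
    next
      case False
      show "safe (exec q (if val (Var 5) s1 \<noteq> Leaf then draw m (2 * v + 1) else draw m (2 * v)) s1) (\<tau>1 + \<tau>0) (?Q s)"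
        unfolding if_not_P[OF False] by (rule safe_mono[OF 0]) (simp, rule P0[OF _ s1])
    qed
  qed
  then show ?case by blast
qed

lemma pr_draw:
  assumes "j < 2 ^ m"
  shows "(1 / 2) ^ m \<le> pr (exec q (draw m v) s) (\<lambda>s'. s' 4 = enc_nat (v * 2 ^ m + j) \<and> same_except {4, 5} s s')"
  using assms
proof (induction m arbitrary: v s j)
  case 0
  then show ?case by (simp add: same_except_def)
next
  case (Suc m)
  \<comment> \<open>The leading bit of \<open>j\<close> decides which branch produces it.\<close>
  define b where "b \<longleftrightarrow> 2 ^ m \<le> j"
  define v' where "v' = (if b then 2 * v + 1 else 2 * v)"
  define j' where "j' = (if b then j - 2 ^ m else j)"
  have j': "j' < 2 ^ m" "v' * 2 ^ m + j' = v * 2 ^ Suc m + j"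
    using Suc.prems by (auto simp: j'_def v'_def b_def algebra_simps)
  let ?Y = "\<lambda>s'. s' 4 = enc_nat (v * 2 ^ Suc m + j) \<and> same_except {4, 5} s s'"
  have "(1 / 2) ^ m * (1 / 2) \<le> pr (exec q (draw (Suc m) v) s) ?Y"
    unfolding draw.simps
  proof (rule pr_Seq[where X = "\<lambda>s'. s' = s(5 := enc_bool b)"])
    show "safe (exec q (Flip 5) s) 1 (\<lambda>_. True)" by (rule safe_Flip) simp
    show "1 / 2 \<le> pr (exec q (Flip 5) s) (\<lambda>s'. s' = s(5 := enc_bool b))" by (rule pr_Flip) simp
    fix s' assume s': "s' = s(5 := enc_bool b)"
    have "(1 / 2) ^ m \<le> pr (exec q (draw m v') s') (\<lambda>s''. s'' 4 = enc_nat (v' * 2 ^ m + j') \<and> same_except {4, 5} s' s'')"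
      by (rule Suc.IH[OF j'(1)])
    also have "\<dots> \<le> pr (exec q (draw m v') s') ?Y"
      unfolding j'(2) by (rule pr_mono) (auto simp: s' same_except_def)
    also have "\<dots> = pr (exec q (Cond (Var 5) (draw m (2 * v + 1)) (draw m (2 * v))) s') ?Y"
      unfolding pr_Cond by (simp add: s' v'_def)
    finally show "(1 / 2) ^ m \<le> pr (exec q (Cond (Var 5) (draw m (2 * v + 1)) (draw m (2 * v))) s') ?Y" .
  qed simp
  then show ?case by simp
qed

definition draw_word :: "nat \<Rightarrow> com" where
  "draw_word m = Seq (draw m 0) (Seq (Flip 5) (Assign 6 (NodeE (NodeE (Var 4) (Var 5)) (Var 6))))"

lemma safe_draw_word:
  "\<exists>\<tau>. \<forall>q s. safe (exec q (draw_word m) s) \<tau>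
     (\<lambda>s'. (\<exists>x. fst x < 2 ^ m \<and> s' 6 = Node (enc_word x) (s 6)) \<and> same_except {4, 5, 6} s s')"
proof -
  obtain \<tau> where \<tau>: "\<And>q s. safe (exec q (draw m 0) s) \<tau>
     (\<lambda>s'. (\<exists>j<2 ^ m. s' 4 = enc_nat (0 * 2 ^ m + j)) \<and> same_except {4, 5} s s')"
    using safe_draw[of m 0] by blast
  let ?Q = "\<lambda>s s'. (\<exists>x. fst x < 2 ^ m \<and> s' 6 = Node (enc_word x) (s 6)) \<and> same_except {4, 5, 6} s s'"
  let ?A = "Assign 6 (NodeE (NodeE (Var 4) (Var 5)) (Var 6))"
  have "safe (exec q (draw_word m) s) (\<tau> + (1 + (1 + cost (NodeE (NodeE (Var 4) (Var 5)) (Var 6))))) (?Q s)" for q s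
    unfolding draw_word_def
  proof (rule safe_Seq[OF \<tau>])
    fix s1 assume "(\<exists>j<2 ^ m. s1 4 = enc_nat (0 * 2 ^ m + j)) \<and> same_except {4, 5} s s1"
    then obtain j where j: "j < 2 ^ m" "s1 4 = enc_nat j" and s1: "same_except {4, 5} s s1" by auto
    show "safe (exec q (Seq (Flip 5) ?A) s1) (1 + (1 + cost (NodeE (NodeE (Var 4) (Var 5)) (Var 6)))) (?Q s)"
    proof (rule safe_Seq[OF safe_Flip[where Q = "\<lambda>s'. \<exists>b. s' = s1(5 := enc_bool b)"]], blast)
      fix s2 assume "\<exists>b. s2 = s1(5 := enc_bool b)"
      then obtain b where s2: "s2 = s1(5 := enc_bool b)" by blast
      show "safe (exec q ?A s2) (1 + cost (NodeE (NodeE (Var 4) (Var 5)) (Var 6))) (?Q s)"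
        by (rule safe_Assign) (use j s1 in \<open>auto simp: s2 same_except_def enc_pair_def intro!: exI[of _ "(j, b)"]\<close>)
    qed
  qed
  then show ?thesis by blast
qed

lemma pr_draw_word:
  assumes "fst x < 2 ^ m"
  shows "(1 / 2) ^ Suc m \<le> pr (exec q (draw_word m) s) (\<lambda>s'. s' 6 = Node (enc_word x) (s 6) \<and> same_except {4, 5, 6} s s')"
    (is "_ \<le> pr _ ?Y")
proof -
  obtain \<tau> where \<tau>: "safe (exec q (draw m 0) s) \<tau>
     (\<lambda>s'. (\<exists>j<2 ^ m. s' 4 = enc_nat (0 * 2 ^ m + j)) \<and> same_except {4, 5} s s')"
    using safe_draw[of m 0] by blast
  let ?A = "Assign 6 (NodeE (NodeE (Var 4) (Var 5)) (Var 6))"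
  have "1 / 2 * (1 / 2) ^ m \<le> pr (exec q (draw_word m) s) ?Y"
    unfolding draw_word_def
  proof (rule pr_Seq[OF \<tau> pr_draw[OF assms]])
    fix s1 assume s1: "s1 4 = enc_nat (0 * 2 ^ m + fst x) \<and> same_except {4, 5} s s1"
    have "1 * (1 / 2) \<le> pr (exec q (Seq (Flip 5) ?A) s1) ?Y"
    proof (rule pr_Seq[OF safe_Flip[where Q = "\<lambda>_. True"] pr_Flip[where b = "snd x" and X = "\<lambda>s'. s' = s1(5 := enc_bool (snd x))"]])
      fix s2 assume s2: "s2 = s1(5 := enc_bool (snd x))"
      have "?Y (s2(6 := val (NodeE (NodeE (Var 4) (Var 5)) (Var 6)) s2))"
        using s1 by (simp add: s2 same_except_def enc_pair_def)
      from pr_Assign[where X = ?Y, OF this] show "1 \<le> pr (exec q ?A s2) ?Y" by (simp only: order_refl)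
    qed simp_all
    then show "1 / 2 \<le> pr (exec q (Seq (Flip 5) ?A) s1) ?Y" by simp
  qed simp
  then show ?thesis by simp
qed

definition draw_words :: "nat \<Rightarrow> com" where
  "draw_words m = While (Var 3) (Seq (Assign 3 (RightE (Var 3))) (draw_word m))"

fun list_len :: "dat \<Rightarrow> nat" where
  "list_len Leaf = 0"
| "list_len (Node a b) = Suc (list_len b)"

lemma list_len_enc_nat [simp]: "list_len (enc_nat i) = i"
  by (induction i) simp_all

lemma list_len_eq_0: "list_len d = 0 \<longleftrightarrow> d = Leaf"
  by (cases d) simp_all

lemma right_enc_nat: "right (enc_nat i) = enc_nat (i - 1)"
  by (cases i) simp_all

definition words_ok :: "nat \<Rightarrow> nat \<Rightarrow> word list \<Rightarrow> bool" where
  "words_ok m n ws \<longleftrightarrow> length ws = n \<and> (\<forall>x\<in>set ws. fst x < 2 ^ m)"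

lemma safe_draw_words:
  "\<exists>\<tau>. \<forall>q s n. s 3 = enc_nat n \<longrightarrow> s 6 = Leaf \<longrightarrow> safe (exec q (draw_words m) s) (n * \<tau> + 2)
     (\<lambda>s'. (\<exists>ws. words_ok m n ws \<and> s' 6 = enc_list enc_word ws) \<and> same_except {3, 4, 5, 6} s s')"
proof -
  obtain \<tau> where \<tau>: "\<And>q s. safe (exec q (draw_word m) s) \<tau>
     (\<lambda>s'. (\<exists>x. fst x < 2 ^ m \<and> s' 6 = Node (enc_word x) (s 6)) \<and> same_except {4, 5, 6} s s')"
    using safe_draw_word[of m] by blast
  have "safe (exec q (draw_words m) s) (n * (1 + cost (Var 3) + (1 + cost (RightE (Var 3)) + \<tau>)) + 2)
     (\<lambda>s'. (\<exists>ws. words_ok m n ws \<and> s' 6 = enc_list enc_word ws) \<and> same_except {3, 4, 5, 6} s s')"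
    if s: "s 3 = enc_nat n" "s 6 = Leaf" for q s n
  proof -
    define I where "I s' \<longleftrightarrow> (\<exists>i ws. s' 3 = enc_nat i \<and> words_ok m (n - i) ws \<and> i \<le> n \<and> s' 6 = enc_list enc_word ws) \<and>
      same_except {3, 4, 5, 6} s s'" for s'
    have "safe (exec q (draw_words m) s) (list_len (s 3) * (1 + cost (Var 3) + (1 + cost (RightE (Var 3)) + \<tau>)) + (1 + cost (Var 3)))
       (\<lambda>s'. I s' \<and> list_len (s' 3) = 0)"
      unfolding draw_words_def
    proof (rule safe_While)
      show "I s" using s by (auto simp: I_def same_except_def words_ok_def)
      show "val (Var 3) s' = Leaf \<longleftrightarrow> list_len (s' 3) = 0" for s' by (simp add: list_len_eq_0)
      fix s' assume "I s'" and pos: "0 < list_len (s' 3)"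
      then obtain i ws where i: "s' 3 = enc_nat i" "words_ok m (n - i) ws" "i \<le> n" "s' 6 = enc_list enc_word ws"
        and sm: "same_except {3, 4, 5, 6} s s'" unfolding I_def by blast
      have "0 < i" using pos i(1) by simp
      show "safe (exec q (Seq (Assign 3 (RightE (Var 3))) (draw_word m)) s') (1 + cost (RightE (Var 3)) + \<tau>)
          (\<lambda>s''. I s'' \<and> Suc (list_len (s'' 3)) = list_len (s' 3))"
      proof (rule safe_Seq[OF safe_Assign[where Q = "\<lambda>s1. s1 = s'(3 := enc_nat (i - 1))"]])
        show "s'(3 := val (RightE (Var 3)) s') = s'(3 := enc_nat (i - 1))" by (simp add: i right_enc_nat)
        fix s1 assume s1: "s1 = s'(3 := enc_nat (i - 1))"
        show "safe (exec q (draw_word m) s1) \<tau> (\<lambda>s''. I s'' \<and> Suc (list_len (s'' 3)) = list_len (s' 3))"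
        proof (rule safe_mono[OF \<tau> order_refl])
          fix s2 assume *: "(\<exists>x. fst x < 2 ^ m \<and> s2 6 = Node (enc_word x) (s1 6)) \<and> same_except {4, 5, 6} s1 s2"
          then obtain x where x: "fst x < 2 ^ m" "s2 6 = Node (enc_word x) (s1 6)" by blast
          have s2: "s2 3 = enc_nat (i - 1)" using * by (simp add: same_except_def s1)
          have "words_ok m (n - (i - 1)) (x # ws)" "s2 6 = enc_list enc_word (x # ws)" "i - 1 \<le> n"
            using i x \<open>0 < i\<close> by (auto simp: words_ok_def s1)
          moreover have "same_except {3, 4, 5, 6} s s2" using * sm by (auto simp: same_except_def s1)
          ultimately have "I s2" using s2 unfolding I_def by blast
          then show "I s2 \<and> Suc (list_len (s2 3)) = list_len (s' 3)"
            using s2 \<open>0 < i\<close> by (simp add: i(1))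
        qed
      qed
    qed
    then show ?thesis
    proof (rule safe_mono)
      fix s' assume "I s' \<and> list_len (s' 3) = 0"
      then obtain i ws where i: "s' 3 = enc_nat i" "words_ok m (n - i) ws" "s' 6 = enc_list enc_word ws"
        and sm: "same_except {3, 4, 5, 6} s s'" and "list_len (s' 3) = 0" unfolding I_def by blast
      then have "i = 0" by simp
      then show "(\<exists>ws. words_ok m n ws \<and> s' 6 = enc_list enc_word ws) \<and> same_except {3, 4, 5, 6} s s'"
        using i sm by auto
    qed (simp add: s)
  qed
  then show ?thesis by blast
qed

text \<open>Words are pushed onto register 6, so they end up in reverse order; the stack
  \<open>vs\<close> generalizes the claim for the induction.\<close>

lemma pr_draw_words:
  assumes "\<forall>x\<in>set ws. fst x < 2 ^ m" and "s 3 = enc_nat (length ws)" and "s 6 = enc_list enc_word vs"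
  shows "((1 / 2) ^ Suc m) ^ length ws \<le> pr (exec q (draw_words m) s)
     (\<lambda>s'. s' 6 = enc_list enc_word (rev ws @ vs) \<and> same_except {3, 4, 5, 6} s s')"
  using assms
proof (induction ws arbitrary: s vs)
  case Nil
  then show ?case unfolding draw_words_def by (subst pr_While_false) (simp_all add: same_except_def)
next
  case (Cons x ws)
  let ?Y = "\<lambda>s'. s' 6 = enc_list enc_word (rev (x # ws) @ vs) \<and> same_except {3, 4, 5, 6} s s'"
  let ?c = "Seq (Assign 3 (RightE (Var 3))) (draw_word m)"
  let ?s1 = "s(3 := enc_nat (length ws))"
  obtain \<tau> where \<tau>: "\<And>q s. safe (exec q (draw_word m) s) \<tau>
     (\<lambda>s'. (\<exists>x. fst x < 2 ^ m \<and> s' 6 = Node (enc_word x) (s 6)) \<and> same_except {4, 5, 6} s s')"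
    using safe_draw_word[of m] by blast
  have c: "exec q ?c s = bind_time (return_spmf (?s1, 1 + cost (RightE (Var 3)))) (exec q (draw_word m))"
    using Cons.prems(2) by simp
  have "safe (exec q ?c s) (1 + cost (RightE (Var 3)) + \<tau>) (\<lambda>_. True)"
    unfolding c by (rule safe_bind[where R = "\<lambda>_. True"]) (auto intro: safe_return safe_mono[OF \<tau>])
  then have "((1 / 2) ^ Suc m) ^ length ws * (1 / 2) ^ Suc m \<le> pr (exec q (Seq ?c (draw_words m)) s) ?Y"
  proof (rule pr_Seq)
    show "(1 / 2) ^ Suc m \<le> pr (exec q ?c s) (\<lambda>s'. s' 6 = Node (enc_word x) (?s1 6) \<and> same_except {4, 5, 6} ?s1 s')"
      unfolding c pr_bind_return using Cons.prems(1) by (intro pr_draw_word) simp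
    fix s2 assume s2: "s2 6 = Node (enc_word x) (?s1 6) \<and> same_except {4, 5, 6} ?s1 s2"
    have "((1 / 2) ^ Suc m) ^ length ws \<le> pr (exec q (draw_words m) s2)
        (\<lambda>s'. s' 6 = enc_list enc_word (rev ws @ x # vs) \<and> same_except {3, 4, 5, 6} s2 s')"
      using Cons.prems s2 by (intro Cons.IH) (auto simp: same_except_def)
    also have "\<dots> \<le> pr (exec q (draw_words m) s2) ?Y"
      by (rule pr_mono) (use s2 in \<open>auto simp: same_except_def\<close>)
    finally show "((1 / 2) ^ Suc m) ^ length ws \<le> pr (exec q (draw_words m) s2) ?Y" .
  qed simp
  moreover have "pr (exec q (draw_words m) s) ?Y = pr (exec q (Seq ?c (draw_words m)) s) ?Y"
    unfolding draw_words_def by (rule pr_While_true) (simp add: Cons.prems(2))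
  ultimately show ?case by (simp add: mult.commute)
qed

lemma enc_nat_inject [simp]: "enc_nat i = enc_nat j \<longleftrightarrow> i = j"
  by (metis list_len_enc_nat)

lemma enc_bool_inject [simp]: "enc_bool b = enc_bool c \<longleftrightarrow> b = c"
  by (cases b; cases c) simp_all

lemma enc_words_inject: "enc_list enc_word ws = enc_list enc_word vs \<Longrightarrow> ws = vs"
proof (induction ws arbitrary: vs)
  case (Cons x ws)
  then show ?case by (cases vs) (auto simp: enc_pair_def prod_eq_iff)
qed (auto dest: sym)

lemma pr_draw_words_set:
  assumes G: "G \<subseteq> {ws. words_ok m n ws}" and s: "s 3 = enc_nat n" "s 6 = Leaf"
  shows "card G * ((1 / 2) ^ Suc m) ^ n \<le> pr (exec q (draw_words m) s)
     (\<lambda>s'. (\<exists>ws\<in>G. s' 6 = enc_list enc_word ws) \<and> same_except {3, 4, 5, 6} s s')"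
proof -
  let ?D = "measure_spmf (exec q (draw_words m) s)"
  let ?E = "\<lambda>ws. {x. fst x 6 = enc_list enc_word ws \<and> same_except {3, 4, 5, 6} s (fst x)}"
  have "{ws. words_ok m n ws} \<subseteq> {ws. set ws \<subseteq> {..<2 ^ m} \<times> UNIV \<and> length ws = n}"
    by (auto simp: words_ok_def)
  then have fin: "finite G"
    using G by (intro finite_subset[OF _ finite_lists_length_eq[of "{..<2 ^ m} \<times> UNIV" n]]) auto
  have "card G * ((1 / 2) ^ Suc m) ^ n = (\<Sum>ws\<in>G. ((1 / 2) ^ Suc m) ^ n)" by simp
  also have "\<dots> \<le> (\<Sum>ws\<in>G. measure ?D (?E ws))"
  proof (rule sum_mono)
    fix ws assume "ws \<in> G"
    \<comment> \<open>To find \<open>ws\<close> on the stack, its words have to be drawn in the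
      order of \<open>rev ws\<close>.\<close>
    then have ws: "length (rev ws) = n" "\<forall>x\<in>set (rev ws). fst x < 2 ^ m" using G by (auto simp: words_ok_def)
    show "((1 / 2) ^ Suc m) ^ n \<le> measure ?D (?E ws)"
      using pr_draw_words[OF ws(2), of s "[]" q] ws(1) s by (simp add: pr_def)
  qed
  also have "\<dots> = measure ?D (\<Union>ws\<in>G. ?E ws)"
    by (rule measure_spmf.finite_measure_finite_Union[symmetric])
      (auto simp: fin disjoint_family_on_def dest!: enc_words_inject)
  also have "\<dots> = pr (exec q (draw_words m) s)
     (\<lambda>s'. (\<exists>ws\<in>G. s' 6 = enc_list enc_word ws) \<and> same_except {3, 4, 5, 6} s s')"
    unfolding pr_def by (rule arg_cong[where f = "measure ?D"]) auto
  finally show ?thesis .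
qed

section \<open>The clock\<close>

text \<open>Shared subtrees are counted with multiplicity, so this can be exponential in the memory
  that the tree occupies.\<close>

primrec nodes :: "dat \<Rightarrow> nat" where
  "nodes Leaf = 1"
| "nodes (Node a b) = 1 + nodes a + nodes b"

fun clock_ticks :: "dat \<Rightarrow> nat" where
  "clock_ticks Leaf = 0"
| "clock_ticks (Node t r) = nodes t + clock_ticks r"

text \<open>
  The clock is a stack of trees in register 2: a tick pops a tree and pushes its two subtrees.
  A full binary tree, of which only one path has to be built, thus gives exponentially many ticks.
\<close>

definition tick :: com where
  "tick = Seq (Assign 3 (LeftE (Var 2))) (Seq (Assign 2 (RightE (Var 2)))
     (Cond (Var 3) (Assign 2 (NodeE (LeftE (Var 3)) (NodeE (RightE (Var 3)) (Var 2)))) (Assign 2 (Var 2))))"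

lemma nodes_pos [simp]: "0 < nodes t"
  by (cases t) simp_all

lemma clock_ticks_eq_0: "clock_ticks d = 0 \<longleftrightarrow> d = Leaf"
  by (cases d) simp_all

text \<open>Replacing a tree by its two subtrees removes its root, and a popped \<open>Leaf\<close>
  is itself one node, so either way the total drops by exactly one.\<close>

lemma safe_tick:
  assumes "s 2 \<noteq> Leaf"
  shows "safe (exec q tick s) 16 (\<lambda>s'. Suc (clock_ticks (s' 2)) = clock_ticks (s 2) \<and> same_except {2, 3} s s')"
proof -
  obtain t r where s: "s 2 = Node t r" using assms by (cases "s 2") auto
  show ?thesis unfolding tick_def
    by (cases t) (auto simp: s same_except_def intro!: safe_return)
qed

text \<open>Doubles the tree in \<open>B\<close> out of every \<open>Q\<close> steps. A counter
  modulo \<open>Q\<close> thus yields about \<open>B * n / Q\<close> doublings without any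
  division.\<close>

definition clock_step :: "nat \<Rightarrow> nat \<Rightarrow> nat \<times> dat \<Rightarrow> nat \<times> dat" where
  "clock_step B Q p = (if Suc (fst p) = Q then 0 else Suc (fst p), if fst p < B then Node (snd p) (snd p) else snd p)"

definition clock_tree :: "nat \<Rightarrow> nat \<Rightarrow> nat \<Rightarrow> dat" where
  "clock_tree B Q n = snd ((clock_step B Q ^^ n) (0, Node Leaf Leaf))"

text \<open>The tree has exponentially many nodes, but doubling it is a single pointer operation,
  and \<open>ptime\<close> restricts the time and not the size of the values.\<close>

lemma ptime_clock_tree:
  "ptime (enc_pair enc_nat eb) (\<lambda>n e. fst e = n) (\<lambda>e. clock_tree B Q (fst e)) (\<lambda>d. d)"
  (is "ptime ?e ?V _ _")
  unfolding clock_tree_def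
proof (rule ptime_snd, rule ptime_iterate)
  show "poly_size ?V fst" by (rule poly_sizeI[OF poly_bounded_id]) simp
  let ?p = "enc_pair enc_nat (\<lambda>d::dat. d)"
  show "ptime (enc_pair ?e ?p) (\<lambda>n e. ?V n (fst e)) (\<lambda>e. clock_step B Q (snd e)) ?p"
    unfolding clock_step_def
  proof (intro ptime_Pair ptime_if ptime_const ptime_Suc ptime_less_const)
    \<comment> \<open>The constant stands on the left, since \<open>ptime_nat_eq\<close> wants a
      bound for that side and the iteration provides none for the counter.\<close>
    have Q: "ptime (enc_pair ?e ?p) (\<lambda>n e. ?V n (fst e)) (\<lambda>e. Q = Suc (fst (snd e))) enc_bool"
      by (rule ptime_nat_eq[OF ptime_const ptime_Suc], (rule ptime_fst ptime_snd ptime_id)+,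
          rule poly_sizeI[OF poly_bounded_const[of Q]], simp)
    then show "ptime (enc_pair ?e ?p) (\<lambda>n e. ?V n (fst e)) (\<lambda>e. Suc (fst (snd e)) = Q) enc_bool"
      by (simp only: eq_commute[of Q])
    have "ptime (enc_pair ?e ?p) (\<lambda>n e. ?V n (fst e)) (\<lambda>e. (snd (snd e), snd (snd e))) (enc_pair (\<lambda>d. d) (\<lambda>d. d))"
      by (rule ptime_Pair; (rule ptime_fst ptime_snd ptime_id)+)
    then show "ptime (enc_pair ?e ?p) (\<lambda>n e. ?V n (fst e)) (\<lambda>e. Node (snd (snd e)) (snd (snd e))) (\<lambda>d. d)"
      by (rule ptime_recode) (simp add: enc_pair_def)
  qed ((rule ptime_fst ptime_snd ptime_id)+)
qed (rule ptime_projections ptime_const)+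

text \<open>The initial tree has 3 nodes, and \<open>nodes D + 1\<close> doubles when
  \<open>D\<close> is replaced by \<open>Node D D\<close>. The two inequalities place the number
  \<open>b\<close> of doublings between \<open>B * n / Q\<close> and
  \<open>B * n / Q + B\<close>.\<close>

lemma clock_tree_nodes:
  assumes B: "B \<le> Q" "0 < Q"
  obtains b where "nodes (clock_tree B Q n) + 1 = 4 * 2 ^ b" "B * n \<le> Q * b" "Q * b \<le> B * n + Q * B"
proof -
  \<comment> \<open>After \<open>p\<close> full periods and \<open>c\<close> further steps,
    \<open>n = Q * p + c\<close> and \<open>b = B * p + min c B\<close>; the equation eliminates
    \<open>p\<close>.\<close>
  have "\<exists>b. fst ((clock_step B Q ^^ n) (0, Node Leaf Leaf)) < Q \<and>
     nodes (snd ((clock_step B Q ^^ n) (0, Node Leaf Leaf))) + 1 = 4 * 2 ^ b \<and>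
     B * n + Q * min (fst ((clock_step B Q ^^ n) (0, Node Leaf Leaf))) B =
       Q * b + B * fst ((clock_step B Q ^^ n) (0, Node Leaf Leaf))"
  proof (induction n)
    case 0
    show ?case using B by (intro exI[of _ 0]) simp
  next
    case (Suc n)
    obtain c D where cD: "(clock_step B Q ^^ n) (0, Node Leaf Leaf) = (c, D)" by fastforce
    obtain b where b: "c < Q" "nodes D + 1 = 4 * 2 ^ b" "B * n + Q * min c B = Q * b + B * c"
      using Suc cD by auto
    have st: "(clock_step B Q ^^ Suc n) (0, Node Leaf Leaf) =
        (if Suc c = Q then 0 else Suc c, if c < B then Node D D else D)"
      by (simp add: cD clock_step_def)
    show ?case
    proof (cases "c < B")
      case True
      have "nodes (Node D D) + 1 = 4 * 2 ^ Suc b" using b(2) by simp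
      moreover have "B * Suc n + Q * min (if Suc c = Q then 0 else Suc c) B =
          Q * Suc b + B * (if Suc c = Q then 0 else Suc c)"
      proof (cases "Suc c = Q")
        case eq: True
        then have "B = Q" using True B by simp
        then show ?thesis using b(3) eq True by (simp add: algebra_simps)
      qed (use b(3) True in \<open>simp add: algebra_simps\<close>)
      ultimately show ?thesis unfolding st using True b(1) B by (intro exI[of _ "Suc b"]) simp
    next
      case False
      have "B * Suc n + Q * min (if Suc c = Q then 0 else Suc c) B =
          Q * b + B * (if Suc c = Q then 0 else Suc c)"
      proof (cases "Suc c = Q")
        case eq: True
        have "B * n + Q * B = Q * b + B * c" using b(3) False by simp
        then have "B * n + B + B * c = Q * b + B * c" unfolding eq[symmetric] by (simp add: algebra_simps)
        then show ?thesis using eq by simp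
      qed (use b(3) False in \<open>simp add: algebra_simps\<close>)
      then show ?thesis unfolding st using False b(1,2) B by (intro exI[of _ b]) simp
    qed
  qed
  then obtain b c where b: "c < Q" "nodes (clock_tree B Q n) + 1 = 4 * 2 ^ b"
      "B * n + Q * min c B = Q * b + B * c" unfolding clock_tree_def by blast
  have "B * c \<le> Q * min c B"
    using b(1) B by (cases "c \<le> B") (simp_all add: mult.commute mult_le_mono)
  moreover have "Q * min c B \<le> Q * B" by simp
  ultimately show thesis using b by (intro that[of b]) linarith+
qed


section \<open>The search\<close>

text \<open>Only the formula is checked here: that the answer satisfies \<open>C\<close> is
  guaranteed by the call. A found solution in register 1 is never erased.\<close>

definition finish :: "com \<Rightarrow> com \<Rightarrow> com" where
  "finish dec chk = Seq (Assign 7 (NodeE (Var 0) (Var 6))) (Seq dec (Seq (Call 7 (Var 7))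
     (Cond (Var 7)
       (Seq (Assign 8 (NodeE (Var 0) (LeftE (Var 7)))) (Seq chk (Cond (Var 8) (Assign 1 (Var 7)) (Assign 7 LeafE))))
       (Assign 7 LeafE))))"

definition search_round :: "nat \<Rightarrow> com \<Rightarrow> com \<Rightarrow> com" where
  "search_round m dec chk = Seq tick (Seq (Assign 3 (LeftE (Var 0))) (Seq (Assign 6 LeafE) (Seq (draw_words m) (finish dec chk))))"

text \<open>
  Register 0 holds the input, 1 the result, 2 the clock and 6 the drawn words; the registers from 7 on
  belong to the deterministic parts.
\<close>

definition search_prog :: "com \<Rightarrow> nat \<Rightarrow> com \<Rightarrow> com \<Rightarrow> com" where
  "search_prog clk m dec chk = Seq (Assign 2 (Var 0)) (Seq clk (Seq (Assign 2 (NodeE (Var 2) LeafE))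
     (Seq (Assign 1 LeafE) (Seq (While (Var 2) (search_round m dec chk)) (Assign 0 (Var 1))))))"

text \<open>Fixes one input, so that the polynomial bounds of the deterministic parts become plain
  numbers.\<close>

locale constraint_search =
  fixes q :: "dat \<Rightarrow> (dat \<times> nat) spmf" and n S m \<tau>q :: nat and F :: "literal list list"
    and C :: "bool list \<Rightarrow> bool" and dec chk :: com and \<tau>dec \<tau>chk :: nat
  assumes ext_call: "length \<rho> = n \<Longrightarrow> \<exists>r u. q (enc_partial \<rho>) = return_spmf (enc_result r, u) \<and> u \<le> \<tau>q \<and>
      (case r of Some a \<Rightarrow> extends a \<rho> \<and> C a | None \<Rightarrow> \<not> (\<exists>a. extends a \<rho> \<and> C a))"
    and dec: "words_ok m n ws \<Longrightarrow> s 7 = enc_state ((n, F), ws) \<Longrightarrow>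
      \<exists>s' t. det_exec dec s s' t \<and> s' 7 = enc_partial (decode S (2 ^ m) n F ws) \<and> (\<forall>j<7. s' j = s j) \<and> t \<le> \<tau>dec"
    and chk: "length a = n \<Longrightarrow> s 8 = enc_pair (enc_pair enc_nat (enc_list enc_clause)) (enc_list enc_bool) ((n, F), a) \<Longrightarrow>
      \<exists>s' t. det_exec chk s s' t \<and> s' 8 = enc_bool (sat_list F a) \<and> (\<forall>j<8. s' j = s j) \<and> t \<le> \<tau>chk"
begin

definition solutions :: "bool list set" where
  "solutions = {a. length a = n \<and> sat_list F a \<and> C a}"

definition input :: dat where
  "input = enc_pair enc_nat (enc_list enc_clause) (n, F)"

text \<open>Once the words are drawn nothing is random any more, the call included, so the outcome
  is a point mass.\<close>

lemma exec_finish: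
  assumes s: "s 0 = input" "s 6 = enc_list enc_word ws" and ws: "words_ok m n ws"
  obtains s' t where "exec q (finish dec chk) s = return_spmf (s', t)" "t \<le> \<tau>dec + \<tau>q + \<tau>chk + 24"
    "s' 0 = s 0" "s' 2 = s 2" "s' 1 = s 1 \<or> (\<exists>a\<in>solutions. s' 1 = enc_result (Some a))"
    "(\<exists>a\<in>solutions. ws \<in> good_words S (2 ^ m) n F a) \<Longrightarrow> s' 1 \<noteq> Leaf"
proof -
  let ?\<rho> = "decode S (2 ^ m) n F ws"
  let ?s1 = "s(7 := enc_state ((n, F), ws))"
  have a1: "exec q (Assign 7 (NodeE (Var 0) (Var 6))) s = return_spmf (?s1, 4)"
    using s by (simp add: input_def enc_pair_def)
  obtain s2 t2 where 2: "exec q dec ?s1 = return_spmf (s2, t2)" "s2 7 = enc_partial ?\<rho>"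
      "\<And>j. j < 7 \<Longrightarrow> s2 j = ?s1 j" "t2 \<le> \<tau>dec"
    using dec[OF ws, of ?s1] unfolding det_exec_def by auto
  obtain r u where r: "q (enc_partial ?\<rho>) = return_spmf (enc_result r, u)" "u \<le> \<tau>q"
      "case r of Some a \<Rightarrow> extends a ?\<rho> \<and> C a | None \<Rightarrow> \<not> (\<exists>a. extends a ?\<rho> \<and> C a)"
    using ext_call[of ?\<rho>] by auto
  let ?s3 = "s2(7 := enc_result r)"
  have a3: "exec q (Call 7 (Var 7)) s2 = return_spmf (?s3, 2 + u)" by (simp add: 2(2) r(1))
  let ?c1 = "Cond (Var 8) (Assign 1 (Var 7)) (Assign 7 LeafE)"
  let ?c2 = "Cond (Var 7) (Seq (Assign 8 (NodeE (Var 0) (LeftE (Var 7)))) (Seq chk ?c1)) (Assign 7 LeafE)"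
  have eq: "exec q (finish dec chk) s = map_spmf (\<lambda>(b, v). (b, 4 + (t2 + ((2 + u) + v)))) (exec q ?c2 ?s3)"
    unfolding finish_def exec.simps(4) a1 2(1) a3 bind_time_return spmf.map_comp
    by (simp add: o_def split_def)
  show thesis
  proof (cases r)
    case None
    then have "exec q ?c2 ?s3 = return_spmf (?s3(7 := Leaf), 4)" by (simp add: enc_result_def)
    then have "exec q (finish dec chk) s = return_spmf (?s3(7 := Leaf), 4 + (t2 + ((2 + u) + 4)))" unfolding eq by simp
    \<comment> \<open>A good word admits \<open>a\<close> itself as an extension satisfying
      \<open>C\<close>, so a call that finds nothing shows that the word was not good.\<close>
    moreover have "\<not> (\<exists>a\<in>solutions. ws \<in> good_words S (2 ^ m) n F a)"
      using None r(3) by (auto simp: good_words_def solutions_def)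
    ultimately show thesis using 2(3)[of 0] 2(3)[of 1] 2(3)[of 2] 2(4) r(2)
      by (intro that[of "?s3(7 := Leaf)" "4 + (t2 + ((2 + u) + 4))"]) auto
  next
    case (Some a)
    have a: "extends a ?\<rho>" "C a" using r(3) Some by auto
    then have len: "length a = n" by (simp add: extends_def)
    let ?s4 = "?s3(8 := enc_pair (enc_pair enc_nat (enc_list enc_clause)) (enc_list enc_bool) ((n, F), a))"
    have a4: "exec q (Assign 8 (NodeE (Var 0) (LeftE (Var 7)))) ?s3 = return_spmf (?s4, 5)"
      using 2(3)[of 0] s Some by (simp add: input_def enc_pair_def enc_result_def)
    obtain s5 t5 where 5: "exec q chk ?s4 = return_spmf (s5, t5)" "s5 8 = enc_bool (sat_list F a)"
        "\<And>j. j < 8 \<Longrightarrow> s5 j = ?s4 j" "t5 \<le> \<tau>chk"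
      using chk[OF len, of ?s4] unfolding det_exec_def by auto
    let ?s6 = "if sat_list F a then s5(1 := s5 7) else s5(7 := Leaf)"
    have a6: "exec q ?c1 s5 = return_spmf (?s6, 4)" by (simp add: 5(2))
    have "exec q (Seq (Assign 8 (NodeE (Var 0) (LeftE (Var 7)))) (Seq chk ?c1)) ?s3 = return_spmf (?s6, 5 + (t5 + 4))"
      unfolding exec.simps(4) a4 bind_time_return 5(1) a6 by simp
    moreover have "val (Var 7) ?s3 \<noteq> Leaf" using Some by (simp add: enc_result_def)
    ultimately have "exec q ?c2 ?s3 = return_spmf (?s6, 2 + (5 + (t5 + 4)))"
      by (simp only: exec.simps(5) bind_time_return if_True not_False_eq_True) simp
    then have ex: "exec q (finish dec chk) s = return_spmf (?s6, 4 + (t2 + ((2 + u) + (2 + (5 + (t5 + 4))))))"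
      unfolding eq by simp
    have s5: "s5 0 = s 0" "s5 1 = s 1" "s5 2 = s 2" "s5 7 = enc_result (Some a)"
      using 5(3)[of 0] 5(3)[of 1] 5(3)[of 2] 5(3)[of 7] 2(3)[of 0] 2(3)[of 1] 2(3)[of 2] Some by simp_all
    \<comment> \<open>The bound \<open>a\<close> is the solution for which \<open>ws\<close> is
      good, the outer \<open>a\<close> is the answer of the call; goodness covers every
      extension.\<close>
    have good: "sat_list F a" if "\<exists>a\<in>solutions. ws \<in> good_words S (2 ^ m) n F a"
      using that a(1) by (auto simp: good_words_def)
    show thesis
      by (rule that[OF ex]) (use s5 5(4) 2(4) r(2) len a(2) good in \<open>auto simp: solutions_def enc_result_def\<close>)
  qed
qed

definition search_inv :: "store \<Rightarrow> bool" where
  "search_inv s \<longleftrightarrow> s 0 = input \<and> (s 1 = Leaf \<or> (\<exists>a\<in>solutions. s 1 = enc_result (Some a)))"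

text \<open>A round succeeds whenever the drawn words are good for the fixed solution, and every
  list of words has probability at least \<open>2 ^ (Suc m * n)\<close> to the power
  \<open>-1\<close>. Of the constant 47, the parts 16, 5, 2 and 24 belong to the clock, the two
  assignments, the drawing loop and \<open>finish\<close>.\<close>

lemma search_round_correct:
  assumes \<tau>w: "\<And>q s n. s 3 = enc_nat n \<Longrightarrow> s 6 = Leaf \<Longrightarrow> safe (exec q (draw_words m) s) (n * \<tau>w + 2)
     (\<lambda>s'. (\<exists>ws. words_ok m n ws \<and> s' 6 = enc_list enc_word ws) \<and> same_except {3, 4, 5, 6} s s')"
    and s: "search_inv s" "s 2 \<noteq> Leaf"
  shows "safe (exec q (search_round m dec chk) s) (n * \<tau>w + \<tau>dec + \<tau>q + \<tau>chk + 47)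
      (\<lambda>s'. search_inv s' \<and> Suc (clock_ticks (s' 2)) = clock_ticks (s 2) \<and> (s 1 \<noteq> Leaf \<longrightarrow> s' 1 \<noteq> Leaf))"
    and "\<And>a. a \<in> solutions \<Longrightarrow>
      card (good_words S (2 ^ m) n F a) * ((1 / 2) ^ Suc m) ^ n \<le> pr (exec q (search_round m dec chk) s) (\<lambda>s'. s' 1 \<noteq> Leaf)"
proof -
  let ?c4 = "Seq (draw_words m) (finish dec chk)"
  let ?c3 = "Seq (Assign 6 LeafE) ?c4"
  let ?c2 = "Seq (Assign 3 (LeftE (Var 0))) ?c3"
  let ?R1 = "\<lambda>s1. Suc (clock_ticks (s1 2)) = clock_ticks (s 2) \<and> same_except {2, 3} s s1"
  let ?T = "\<lambda>s'. Suc (clock_ticks (s' 2)) = clock_ticks (s 2) \<and> s' 0 = s 0 \<and> s' 1 = s 1"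
  let ?Q = "\<lambda>s'. search_inv s' \<and> Suc (clock_ticks (s' 2)) = clock_ticks (s 2) \<and> (s 1 \<noteq> Leaf \<longrightarrow> s' 1 \<noteq> Leaf)"
  have c2: "exec q ?c2 s1 = bind_time (return_spmf (s1(3 := enc_nat n, 6 := Leaf), 5)) (exec q ?c4)"
    if "?R1 s1" for s1
  proof -
    have a: "exec q (Assign 3 (LeftE (Var 0))) s1 = return_spmf (s1(3 := enc_nat n), 3)"
      using that s(1) by (simp add: same_except_def search_inv_def input_def enc_pair_def)
    have b: "exec q (Assign 6 LeafE) s' = return_spmf (s'(6 := Leaf), 2)" for s' by simp
    show ?thesis unfolding exec.simps(4) a b bind_time_return spmf.map_comp
      by (rule map_spmf_cong[OF refl]) (simp add: split_def)
  qed
  have tk: "safe (exec q tick s) 16 ?R1" by (rule safe_tick) (rule s(2))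
  have words: "safe (exec q (draw_words m) s2) (n * \<tau>w + 2)
      (\<lambda>s'. (\<exists>ws. words_ok m n ws \<and> s' 6 = enc_list enc_word ws) \<and> ?T s')"
    if "?R1 s1" "s2 = s1(3 := enc_nat n, 6 := Leaf)" for s1 s2
    by (rule safe_mono[OF \<tau>w]) (use that in \<open>auto simp: same_except_def\<close>)
  have fin: "safe (exec q (finish dec chk) s3) (\<tau>dec + \<tau>q + \<tau>chk + 24) ?Q"
    if s3: "(\<exists>ws. words_ok m n ws \<and> s3 6 = enc_list enc_word ws) \<and> ?T s3" for s3
  proof -
    obtain ws where ws: "words_ok m n ws" "s3 6 = enc_list enc_word ws" using s3 by blast
    have "s3 0 = input" using s3 s(1) by (simp add: search_inv_def)
    then obtain s' t where e: "exec q (finish dec chk) s3 = return_spmf (s', t)" "t \<le> \<tau>dec + \<tau>q + \<tau>chk + 24"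
      "s' 0 = s3 0" "s' 2 = s3 2" "s' 1 = s3 1 \<or> (\<exists>a\<in>solutions. s' 1 = enc_result (Some a))"
      by (rule exec_finish[of s3 ws, OF _ ws(2,1)]) (rule that)
    have "?Q s'" using e(3-5) s3 s(1) by (auto simp: search_inv_def enc_result_def)
    then show ?thesis unfolding e(1) using e(2) by (rule safe_return)
  qed
  have "safe (exec q (search_round m dec chk) s) (16 + (5 + ((n * \<tau>w + 2) + (\<tau>dec + \<tau>q + \<tau>chk + 24)))) ?Q"
    unfolding search_round_def
  proof (rule safe_Seq[OF tk])
    fix s1 assume s1: "?R1 s1"
    show "safe (exec q ?c2 s1) (5 + ((n * \<tau>w + 2) + (\<tau>dec + \<tau>q + \<tau>chk + 24))) ?Q"
      unfolding c2[OF s1]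
    proof (rule safe_bind[where R = "\<lambda>s2. s2 = s1(3 := enc_nat n, 6 := Leaf)"])
      fix s2 assume "s2 = s1(3 := enc_nat n, 6 := Leaf)"
      from safe_Seq[OF words[OF s1 this] fin] show "safe (exec q ?c4 s2) ((n * \<tau>w + 2) + (\<tau>dec + \<tau>q + \<tau>chk + 24)) ?Q" .
    qed (simp add: safe_return)
  qed
  then show "safe (exec q (search_round m dec chk) s) (n * \<tau>w + \<tau>dec + \<tau>q + \<tau>chk + 47) ?Q"
    by (rule safe_mono) simp_all

  fix a assume a: "a \<in> solutions"
  let ?G = "good_words S (2 ^ m) n F a"
  let ?p = "card ?G * ((1 / 2 :: real) ^ Suc m) ^ n"
  have G: "?G \<subseteq> {ws. words_ok m n ws}" by (auto simp: good_words_def words_ok_def)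
  have "?p * 1 \<le> pr (exec q (search_round m dec chk) s) (\<lambda>s'. s' 1 \<noteq> Leaf)"
    unfolding search_round_def
  proof (rule pr_Seq[OF tk])
    show "1 \<le> pr (exec q tick s) ?R1" using pr_safe[OF tk] by (simp only: order_refl)
    fix s1 assume s1: "?R1 s1"
    define s2 where "s2 = s1(3 := enc_nat n, 6 := Leaf)"
    have s2: "s2 3 = enc_nat n" "s2 6 = Leaf" by (simp_all add: s2_def)
    have "1 * ?p \<le> pr (exec q ?c4 s2) (\<lambda>s'. s' 1 \<noteq> Leaf)"
    proof (rule pr_Seq[OF words[OF s1 s2_def] pr_draw_words_set[OF G s2]])
      fix s3 assume s3: "(\<exists>ws\<in>?G. s3 6 = enc_list enc_word ws) \<and> same_except {3, 4, 5, 6} s2 s3"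
      then obtain ws where ws: "ws \<in> ?G" "s3 6 = enc_list enc_word ws" by blast
      have "s3 0 = input" using s3 s1 s(1) by (simp add: same_except_def search_inv_def s2_def)
      moreover have "words_ok m n ws" using ws(1) G by blast
      ultimately obtain s' t where "exec q (finish dec chk) s3 = return_spmf (s', t)" "s' 1 \<noteq> Leaf"
        by (rule exec_finish[of s3 ws, OF _ ws(2)]) (rule that, assumption, use a ws(1) in blast)
      then show "1 \<le> pr (exec q (finish dec chk) s3) (\<lambda>s'. s' 1 \<noteq> Leaf)" by simp
    qed simp
    then show "?p \<le> pr (exec q ?c2 s1) (\<lambda>s'. s' 1 \<noteq> Leaf)"
      unfolding c2[OF s1] pr_bind_return by (simp add: s2_def)
  qed simp
  then show "?p \<le> pr (exec q (search_round m dec chk) s) (\<lambda>s'. s' 1 \<noteq> Leaf)" by simp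
qed

text \<open>The loop always exhausts the clock, also after a success, so the number of rounds is
  exactly \<open>nodes D\<close>. Each of them contains one call, hence the product with
  \<open>\<tau>q\<close> in the time bound.\<close>

lemma search_correct:
  fixes s0 :: store and \<epsilon> :: real
  defines "s0 \<equiv> (\<lambda>_. Leaf)(0 := input)"
  assumes \<tau>w: "\<And>q s n. s 3 = enc_nat n \<Longrightarrow> s 6 = Leaf \<Longrightarrow> safe (exec q (draw_words m) s) (n * \<tau>w + 2)
     (\<lambda>s'. (\<exists>ws. words_ok m n ws \<and> s' 6 = enc_list enc_word ws) \<and> same_except {3, 4, 5, 6} s s')"
    and clk: "\<And>s. s 2 = input \<Longrightarrow> \<exists>s' t. det_exec clk s s' t \<and> s' 2 = D \<and> (\<forall>j<2. s' j = s j) \<and> t \<le> \<tau>clk"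
    and \<epsilon>: "0 \<le> \<epsilon>" "\<epsilon> \<le> 1" "2 \<le> \<epsilon> * nodes D"
    and good: "\<And>a. a \<in> solutions \<Longrightarrow> \<epsilon> \<le> card (good_words S (2 ^ m) n F a) * ((1 / 2) ^ Suc m) ^ n"
  shows "safe (exec q (search_prog clk m dec chk) s0)
      ((nodes D + 1) * (\<tau>clk + n * \<tau>w + \<tau>dec + \<tau>chk + 60 + \<tau>q))
      (\<lambda>s. s 0 = Leaf \<or> (\<exists>a\<in>solutions. s 0 = enc_result (Some a)))"
    and "solutions \<noteq> {} \<Longrightarrow>
      2 / 3 \<le> pr (exec q (search_prog clk m dec chk) s0) (\<lambda>s. \<exists>a\<in>solutions. s 0 = enc_result (Some a))"
proof -
  let ?\<tau> = "n * \<tau>w + \<tau>dec + \<tau>q + \<tau>chk + 47"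
  let ?loop = "While (Var 2) (search_round m dec chk)"
  let ?\<mu> = "\<lambda>s. clock_ticks (s 2)"
  obtain s1 t1 where 1: "exec q clk (s0(2 := input)) = return_spmf (s1, t1)" "s1 2 = D"
      "\<And>j. j < 2 \<Longrightarrow> s1 j = (s0(2 := input)) j" "t1 \<le> \<tau>clk"
    using clk[of "s0(2 := input)"] unfolding det_exec_def by auto
  define s2 where "s2 = s1(2 := Node D Leaf, 1 := Leaf)"
  have a: "exec q (Assign 2 (Var 0)) s0 = return_spmf (s0(2 := input), 2)" by (simp add: s0_def)
  have b: "exec q (Assign 2 (NodeE (Var 2) LeafE)) s1 = return_spmf (s1(2 := Node D Leaf), 4)" by (simp add: 1(2))
  have c: "exec q (Assign 1 LeafE) s = return_spmf (s(1 := Leaf), 2)" for s by simp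
  have prog: "exec q (search_prog clk m dec chk) s0 =
      bind_time (return_spmf (s2, t1 + 8)) (\<lambda>s. bind_time (exec q ?loop s) (exec q (Assign 0 (Var 1))))"
    unfolding search_prog_def exec.simps(4) a 1(1) b c bind_time_return spmf.map_comp s2_def
    by (rule map_spmf_cong[OF refl]) (simp add: split_def)
  have s2: "search_inv s2" "?\<mu> s2 = nodes D" using 1(3)[of 0] by (simp_all add: s2_def search_inv_def s0_def)
  have guard: "val (Var 2) s = Leaf \<longleftrightarrow> ?\<mu> s = 0" for s by (simp add: clock_ticks_eq_0)
  have rnd: "safe (exec q (search_round m dec chk) s) ?\<tau>
      (\<lambda>s'. search_inv s' \<and> Suc (?\<mu> s') = ?\<mu> s \<and> (s 1 \<noteq> Leaf \<longrightarrow> s' 1 \<noteq> Leaf))" if "search_inv s" "0 < ?\<mu> s" for s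
    using that clock_ticks_eq_0[of "s 2"] by (intro search_round_correct(1)[OF \<tau>w]) auto
  have loop: "safe (exec q ?loop s2) (nodes D * (2 + ?\<tau>) + 2) (\<lambda>s'. search_inv s' \<and> ?\<mu> s' = 0)"
    using safe_While[of search_inv s2 "Var 2" ?\<mu> q "search_round m dec chk" ?\<tau>, OF s2(1) guard safe_mono[OF rnd order_refl]]
    by (simp add: s2(2))
  have out: "safe (exec q (Assign 0 (Var 1)) s) 2 (\<lambda>s. s 0 = Leaf \<or> (\<exists>a\<in>solutions. s 0 = enc_result (Some a)))"
    if "search_inv s \<and> ?\<mu> s = 0" for s
    using that by (auto intro!: safe_return simp: search_inv_def)
  have "safe (exec q (search_prog clk m dec chk) s0) ((t1 + 8) + ((nodes D * (2 + ?\<tau>) + 2) + 2))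
      (\<lambda>s. s 0 = Leaf \<or> (\<exists>a\<in>solutions. s 0 = enc_result (Some a)))"
    unfolding prog
    by (rule safe_bind[where R = "\<lambda>s. s = s2"], simp add: safe_return, simp only:, rule safe_bind[OF loop out])
  then show "safe (exec q (search_prog clk m dec chk) s0)
      ((nodes D + 1) * (\<tau>clk + n * \<tau>w + \<tau>dec + \<tau>chk + 60 + \<tau>q))
      (\<lambda>s. s 0 = Leaf \<or> (\<exists>a\<in>solutions. s 0 = enc_result (Some a)))"
  proof (rule safe_mono)
    have "nodes D * (2 + ?\<tau>) \<le> nodes D * (\<tau>clk + n * \<tau>w + \<tau>dec + \<tau>chk + 60 + \<tau>q)"
      by (rule mult_le_mono2) simp
    then show "t1 + 8 + (nodes D * (2 + ?\<tau>) + 2 + 2) \<le> (nodes D + 1) * (\<tau>clk + n * \<tau>w + \<tau>dec + \<tau>chk + 60 + \<tau>q)"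
      using 1(4) unfolding add_mult_distrib mult_1 by linarith
  qed
  assume "solutions \<noteq> {}"
  then obtain a where a: "a \<in> solutions" by blast
  have "1 - (1 - \<epsilon>) ^ ?\<mu> s2 \<le> pr (exec q ?loop s2) (\<lambda>s. s 1 \<noteq> Leaf)"
  proof (rule pr_While[where I = search_inv and \<mu> = ?\<mu> and \<tau> = ?\<tau>])
    show "search_inv s2" "0 \<le> \<epsilon>" "\<epsilon> \<le> 1" by (fact s2(1) \<epsilon>(1,2))+
    show "val (Var 2) s = Leaf \<longleftrightarrow> ?\<mu> s = 0" for s by (rule guard)
    show "safe (exec q (search_round m dec chk) s) ?\<tau>
        (\<lambda>s'. search_inv s' \<and> Suc (?\<mu> s') = ?\<mu> s \<and> (s 1 \<noteq> Leaf \<longrightarrow> s' 1 \<noteq> Leaf))" if "search_inv s" "0 < ?\<mu> s" for s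
      using that by (rule rnd)
    show "\<epsilon> \<le> pr (exec q (search_round m dec chk) s) (\<lambda>s. s 1 \<noteq> Leaf)" if "search_inv s" "0 < ?\<mu> s" for s
      using that clock_ticks_eq_0[of "s 2"] search_round_correct(2)[OF \<tau>w, of s a] a good[OF a] by force
  qed
  \<comment> \<open>This is where \<open>\<epsilon> * nodes D\<close> has to reach 2: the estimate
    \<open>exp 2 \<ge> 1 + 2\<close> gives the failure probability 1/3.\<close>
  moreover have "(1 - \<epsilon>) ^ nodes D \<le> 1 / 3"
  proof -
    have "(1 - \<epsilon>) ^ nodes D \<le> exp (- \<epsilon>) ^ nodes D"
      using \<epsilon> exp_ge_add_one_self[of "- \<epsilon>"] by (intro power_mono) simp_all
    also have "\<dots> = exp (- (\<epsilon> * nodes D))" by (simp add: exp_of_nat_mult[symmetric] mult.commute)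
    also have "\<dots> \<le> exp (- 2)" using \<epsilon>(3) by simp
    also have "\<dots> \<le> 1 / 3" using exp_ge_add_one_self[of "2::real"] by (simp add: exp_minus field_simps)
    finally show ?thesis .
  qed
  ultimately have found: "2 / 3 \<le> pr (exec q ?loop s2) (\<lambda>s. s 1 \<noteq> Leaf)" by (simp add: s2(2))
  let ?D = "bind_time (exec q ?loop s2) (exec q (Assign 0 (Var 1)))"
  let ?Y = "\<lambda>s. \<exists>a\<in>solutions. s 0 = enc_result (Some a)"
  have "1 * pr (exec q ?loop s2) (\<lambda>s. s 1 \<noteq> Leaf) + 0 * (1 - pr (exec q ?loop s2) (\<lambda>s. s 1 \<noteq> Leaf)) \<le> pr ?D ?Y"
  proof (rule pr_bind_time_ge)
    show "lossless_spmf (exec q ?loop s2)" using loop by (simp add: safe_def)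
    fix x assume "x \<in> set_spmf (exec q ?loop s2)" "fst x 1 \<noteq> Leaf"
    then have "\<exists>a\<in>solutions. fst x 1 = enc_result (Some a)" using loop by (auto simp: safe_def search_inv_def)
    then show "1 \<le> pr (exec q (Assign 0 (Var 1)) (fst x)) ?Y" by simp
  qed simp_all
  then show "2 / 3 \<le> pr (exec q (search_prog clk m dec chk) s0) ?Y"
    unfolding prog pr_bind_return using found by linarith
qed

end


section \<open>The main theorem\<close>

text \<open>Clauses that differ as sets differ as lists, so the length of \<open>F\<close> is at
  most the number of lists of at most \<open>k\<close> of the \<open>2 * n\<close> literals.\<close>

lemma formula_ok_if_lists_cnf:
  assumes "is_kcnf k n \<Phi>" and "lists_cnf F \<Phi>"
  shows "formula_ok k (\<lambda>n. (k + 1) * (2 * n + 1) ^ k) n F"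
proof -
  have ok: "clause_ok k n c" if "c \<in> set F" for c
  proof -
    have "set c \<in> \<Phi>" "distinct c" using that assms(2) by (auto simp: lists_cnf_def)
    then show ?thesis using assms(1) by (fastforce simp: is_kcnf_def clause_ok_def distinct_card)
  qed
  let ?L = "{..<n} \<times> (UNIV :: bool set)"
  have "length F = card (set F)"
    using assms(2) by (simp add: lists_cnf_def distinct_map distinct_card)
  also have "\<dots> \<le> card {c. set c \<subseteq> ?L \<and> length c \<le> k}"
    using ok by (intro card_mono finite_lists_length_le) (force simp: clause_ok_def)+
  also have "\<dots> = (\<Sum>i\<le>k. card ?L ^ i)" by (rule card_lists_length_le) simp
  \<comment> \<open>The base \<open>2 * n + 1\<close> is positive even for \<open>n = 0\<close>, so
    its powers increase with the exponent.\<close>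
  also have "\<dots> \<le> (\<Sum>i\<le>k. (2 * n + 1) ^ k)"
  proof (rule sum_mono)
    fix i assume "i \<in> {..k}"
    then have "(2 * n) ^ i \<le> (2 * n + 1) ^ i" "(2 * n + 1) ^ i \<le> (2 * n + 1) ^ k"
      by (intro power_mono power_increasing; simp)+
    then show "card ?L ^ i \<le> (2 * n + 1) ^ k" by (simp add: card_cartesian_product mult.commute)
  qed
  finally show ?thesis using ok by (simp add: formula_ok_def)
qed

lemma satisfies_conv_sat_list: "lists_cnf F \<Phi> \<Longrightarrow> satisfies a \<Phi> \<longleftrightarrow> sat_list F a"
  by (auto simp: lists_cnf_def satisfies_def sat_list_def split_def)

lemma exec_time_pos: "x \<in> set_spmf (exec q c s) \<Longrightarrow> 1 \<le> snd x"
proof (induction c arbitrary: s x)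
  case (While e c)
  then show ?case by (subst (asm) exec_While) (auto simp: split_def)
qed (force simp: bind_time_def set_bind_spmf split_def)+

lemma randomized_search_if_safe:
  assumes safe: "safe (exec q P ((\<lambda>_. Leaf)(0 := v))) t (\<lambda>s. s 0 = Leaf \<or> (\<exists>a\<in>A. s 0 = enc_result (Some a)))"
    and t: "real t \<le> t'"
    and pr: "A \<noteq> {} \<Longrightarrow> 2 / 3 \<le> pr (exec q P ((\<lambda>_. Leaf)(0 := v))) (\<lambda>s. \<exists>a\<in>A. s 0 = enc_result (Some a))"
  shows "randomized_search (run q P v) t' A"
  unfolding randomized_search_def
proof (intro conjI impI)
  show "lossless_spmf (run q P v)" using safe by (simp add: run_def safe_def)
  show "\<forall>(v, u)\<in>set_spmf (run q P v). real u \<le> t' \<and> (v = enc_result None \<or> (\<exists>a\<in>A. v = enc_result (Some a)))"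
  proof clarify
    fix w u assume "(w, u) \<in> set_spmf (run q P v)"
    then obtain s where "(s, u) \<in> set_spmf (exec q P ((\<lambda>_. Leaf)(0 := v)))" "w = s 0"
      by (auto simp: run_def)
    then have "(w = Leaf \<or> (\<exists>a\<in>A. w = enc_result (Some a))) \<and> u \<le> t"
      using safe unfolding safe_def by fastforce
    then show "real u \<le> t' \<and> (w = enc_result None \<or> (\<exists>a\<in>A. w = enc_result (Some a)))"
      using t by (auto simp: enc_result_def)
  qed
  assume "A \<noteq> {}"
  have "measure (measure_spmf (run q P v)) {(v, u). \<exists>a\<in>A. v = enc_result (Some a)} =
      pr (exec q P ((\<lambda>_. Leaf)(0 := v))) (\<lambda>s. \<exists>a\<in>A. s 0 = enc_result (Some a))"
    unfolding run_def pr_def measure_map_spmf by (rule arg_cong[where f = "measure _"]) auto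
  then show "2 / 3 \<le> measure (measure_spmf (run q P v)) {(v, u). \<exists>a\<in>A. v = enc_result (Some a)}"
    using pr[OF \<open>A \<noteq> {}\<close>] by simp
qed

text \<open>Every execution costs at least one unit, and the empty partial assignment is an
  admissible query. The bound lets polynomial overhead be multiplied by \<open>T n\<close> instead
  of added to it.\<close>

lemma extension_search_time:
  assumes "extension_search t n C Q"
  shows "1 \<le> t"
proof -
  obtain r u where r: "run_det Q (enc_partial (replicate n None)) = return_spmf (enc_result r, u)" "real u \<le> t"
    using assms unfolding extension_search_def by (metis length_replicate)
  have "(enc_result r, u) \<in> set_spmf (run_det Q (enc_partial (replicate n None)))" by (simp add: r(1))
  then obtain s where "(s, u) \<in> set_spmf (exec (\<lambda>_. return_pmf None) Q ((\<lambda>_. Leaf)(0 := enc_partial (replicate n None))))"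
    by (auto simp: run_det_def run_def)
  from exec_time_pos[OF this] r(2) show ?thesis by simp
qed

theorem theorem13:
  fixes k :: nat
  assumes "k \<ge> 1"
  shows "\<exists>(P :: com) (c :: nat) (d :: nat).
    \<forall>(T :: nat \<Rightarrow> real) (n :: nat) (\<Phi> :: cnf) (F :: literal list list)
      (C :: bool list \<Rightarrow> bool) (Q :: com).
      is_kcnf k n \<Phi> \<longrightarrow> lists_cnf F \<Phi> \<longrightarrow> extension_search (T n) n C Q \<longrightarrow>
      randomized_search
        (run (run_det Q) P (enc_input n F))
        (real c * real (n + 1) ^ d *
           (2 powr (real n - real n / (2 * real k) + real n / (2 * (real k)\<^sup>2)) * T n))
        {a. length a = n \<and> satisfies a \<Phi> \<and> C a}"
proof -
  obtain m S :: nat where S: "S < 2 ^ m"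
    and ratio: "real (2 ^ m + S) \<le> real (2 ^ m - S) * 2 powr last_frac k (2 ^ m - S)"
    and gain: "2 powr ((real k - 1) / (2 * (real k)\<^sup>2)) \<le> real (2 ^ m + S) / 2 ^ m"
    by (rule parameters_exist[OF assms])
  \<comment> \<open>\<open>B / M\<close> is the exponent per variable of the theorem,
    \<open>1 - (k - 1) / (2 * k\<^sup>2)\<close>, written as a fraction for the clock.\<close>
  define M where "M = 2 * k\<^sup>2"
  define B where "B = M - (k - 1)"
  define \<alpha> where "\<alpha> = real B / real M"
  have "k \<le> M" using assms by (simp add: M_def power2_eq_square)
  then have M: "B \<le> M" "0 < M" "real B = real M - (real k - 1)"
    using assms by (simp_all add: B_def of_nat_diff)
  have \<alpha>: "\<alpha> = 1 - (real k - 1) / (2 * (real k)\<^sup>2)"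
    using M by (simp add: \<alpha>_def diff_divide_distrib) (simp add: M_def)
  define L where "L = (\<lambda>n::nat. (k + 1) * (2 * n + 1) ^ k)"
  have L: "poly_bounded L" unfolding L_def by (intro poly_bounded_intros)
  \<comment> \<open>The base registers are chosen so that nothing needed is lost: \<open>dec\<close>
    at 7 preserves input, result, clock and words, \<open>chk\<close> at 8 also preserves the answer
    of the call, and \<open>clk\<close> at 2 runs before the higher registers are used.\<close>
  obtain dec pd where pd: "poly_bounded pd" and dec: "\<And>n e s. state_ok k L (2 ^ m) n e \<Longrightarrow> s 7 = enc_state e \<Longrightarrow>
      \<exists>s' t. det_exec dec s s' t \<and> s' 7 = enc_rho (decode S (2 ^ m) (fst (fst e)) (snd (fst e)) (snd e)) \<and>
        (\<forall>j<7. s' j = s j) \<and> t \<le> pd n"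
    by (rule ptimeE[OF ptime_decode[OF L, of k "2 ^ m" S], of 7]) (rule that)
  obtain chk pk where pk: "poly_bounded pk" and chk: "\<And>n e s. formula_ok k L n (snd (fst e)) \<and> length (snd e) = n \<Longrightarrow>
      s 8 = enc_pair (enc_pair enc_nat (enc_list enc_clause)) (enc_list enc_bool) e \<Longrightarrow>
      \<exists>s' t. det_exec chk s s' t \<and> s' 8 = enc_bool (sat_list (snd (fst e)) (snd e)) \<and>
        (\<forall>j<8. s' j = s j) \<and> t \<le> pk n"
    by (rule ptimeE[OF ptime_sat_list[OF L, of k], of 8]) (rule that)
  obtain clk pc where pc: "poly_bounded pc" and clk: "\<And>n e s. fst e = n \<Longrightarrow>
      s 2 = enc_pair enc_nat (enc_list enc_clause) e \<Longrightarrow>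
      \<exists>s' t. det_exec clk s s' t \<and> s' 2 = clock_tree B M (fst e) \<and> (\<forall>j<2. s' j = s j) \<and> t \<le> pc n"
    by (rule ptimeE[OF ptime_clock_tree[of "enc_list enc_clause" B M], of 2]) (rule that)
  obtain \<tau>w where \<tau>w: "\<And>q s n. s 3 = enc_nat n \<Longrightarrow> s 6 = Leaf \<Longrightarrow> safe (exec q (draw_words m) s) (n * \<tau>w + 2)
     (\<lambda>s'. (\<exists>ws. words_ok m n ws \<and> s' 6 = enc_list enc_word ws) \<and> same_except {3, 4, 5, 6} s s')"
    using safe_draw_words[of m] by blast
  define p where "p n = pc n + n * \<tau>w + pd n + pk n + 60" for n
  \<comment> \<open>The summand 1 absorbs the call: \<open>p n + T n \<le> (p n + 1) * T n\<close>
    because \<open>1 \<le> T n\<close>.\<close>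
  have "poly_bounded (\<lambda>n. p n + 1)" unfolding p_def using pc pd pk by (intro poly_bounded_intros)
  then obtain c d where cd: "\<And>n. p n + 1 \<le> c * (n + 1) ^ d" unfolding poly_bounded_def by blast

  have main: "randomized_search (run (run_det Q) (search_prog clk m dec chk) (enc_input n F))
        (real (4 * 2 ^ B * c) * real (n + 1) ^ d *
           (2 powr (real n - real n / (2 * real k) + real n / (2 * (real k)\<^sup>2)) * T n))
        {a. length a = n \<and> satisfies a \<Phi> \<and> C a}"
    if cnf: "is_kcnf k n \<Phi>" "lists_cnf F \<Phi>" and ext: "extension_search (T n) n C Q" for T :: "nat \<Rightarrow> real" and n \<Phi> F C Q
  proof -
    have F: "formula_ok k L n F" unfolding L_def by (rule formula_ok_if_lists_cnf[OF cnf])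
    have T: "1 \<le> T n" by (rule extension_search_time[OF ext])
    \<comment> \<open>Running times are integers, so rounding the real bound down loses
      nothing.\<close>
    interpret constraint_search "run_det Q" n S m "nat \<lfloor>T n\<rfloor>" F C dec chk "pd n" "pk n"
    proof
      fix \<rho> :: "bool option list" assume "length \<rho> = n"
      then obtain r u where "run_det Q (enc_partial \<rho>) = return_spmf (enc_result r, u)" "real u \<le> T n"
        "case r of Some a \<Rightarrow> extends a \<rho> \<and> C a | None \<Rightarrow> \<not> (\<exists>a. extends a \<rho> \<and> C a)"
        using ext unfolding extension_search_def by blast
      moreover from this(2) have "u \<le> nat \<lfloor>T n\<rfloor>" by (simp add: le_nat_floor)
      ultimately show "\<exists>r u. run_det Q (enc_partial \<rho>) = return_spmf (enc_result r, u) \<and> u \<le> nat \<lfloor>T n\<rfloor> \<and>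
        (case r of Some a \<Rightarrow> extends a \<rho> \<and> C a | None \<Rightarrow> \<not> (\<exists>a. extends a \<rho> \<and> C a))" by blast
    next
      fix ws and s :: store assume "words_ok m n ws" "s 7 = enc_state ((n, F), ws)"
      then show "\<exists>s' t. det_exec dec s s' t \<and> s' 7 = enc_partial (decode S (2 ^ m) n F ws) \<and> (\<forall>j<7. s' j = s j) \<and> t \<le> pd n"
        using dec[of n "((n, F), ws)" s] F by (simp add: state_ok_def words_ok_def enc_partial_def)
    next
      fix a and s :: store assume "length a = n"
        "s 8 = enc_pair (enc_pair enc_nat (enc_list enc_clause)) (enc_list enc_bool) ((n, F), a)"
      then show "\<exists>s' t. det_exec chk s s' t \<and> s' 8 = enc_bool (sat_list F a) \<and> (\<forall>j<8. s' j = s j) \<and> t \<le> pk n"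
        using chk[of n "((n, F), a)" s] F by simp
    qed
    obtain b where b: "nodes (clock_tree B M n) + 1 = 4 * 2 ^ b" "B * n \<le> M * b" "M * b \<le> B * n + M * B"
      using clock_tree_nodes[OF M(1,2)] by blast
    have b_ge: "\<alpha> * n \<le> b"
    proof -
      have "real (B * n) \<le> real (M * b)" using b(2) by (rule of_nat_mono)
      then show ?thesis using M(2) by (simp add: \<alpha>_def field_simps)
    qed
    \<comment> \<open>The clock may be ahead by up to \<open>B\<close> doublings, which costs the
      constant factor \<open>2 ^ B\<close> in the running time.\<close>
    have b_le: "b \<le> \<alpha> * n + B"
    proof -
      have "real (M * b) \<le> real (B * n + M * B)" using b(3) by (rule of_nat_mono)
      then show ?thesis using M(2) by (simp add: \<alpha>_def field_simps)
    qed
    \<comment> \<open>A lower bound for \<open>((A + S) / (2 * A)) ^ n\<close> with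
      \<open>A = 2 ^ m\<close>, the success probability of a round.\<close>
    define \<epsilon> where "\<epsilon> = 2 powr (- (\<alpha> * n))"
    have "0 \<le> \<alpha>" by (simp add: \<alpha>_def)
    then have \<epsilon>: "0 \<le> \<epsilon>" "\<epsilon> \<le> 1" using powr_mono[of "- (\<alpha> * n)" 0 "2::real"] by (simp_all add: \<epsilon>_def)
    \<comment> \<open>The clock has \<open>4 * 2 ^ b - 1\<close> ticks, which is at least
      \<open>2 * 2 ^ b\<close> and hence at least \<open>2 / \<epsilon>\<close>.\<close>
    have rounds: "2 \<le> \<epsilon> * nodes (clock_tree B M n)"
    proof -
      have "2 = \<epsilon> * (2 * 2 powr (\<alpha> * n))" by (simp add: \<epsilon>_def powr_minus)
      also have "\<dots> \<le> \<epsilon> * (2 * 2 powr b)" using b_ge \<epsilon>(1) by (intro mult_left_mono powr_mono) simp_all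
      also have "\<dots> = \<epsilon> * real (2 * 2 ^ b)" by (simp add: powr_realpow)
      also have "\<dots> \<le> \<epsilon> * nodes (clock_tree B M n)"
      proof (intro mult_left_mono of_nat_mono \<epsilon>(1))
        have "(1::nat) \<le> 2 ^ b" by simp
        then show "2 * 2 ^ b \<le> nodes (clock_tree B M n)" using b(1) by linarith
      qed
      finally show ?thesis .
    qed
    have good: "\<epsilon> \<le> card (good_words S (2 ^ m) n F a) * ((1 / 2) ^ Suc m) ^ n" if "a \<in> solutions" for a
    proof -
      have "\<epsilon> = (2 powr (- \<alpha>)) ^ n" by (simp add: \<epsilon>_def powr_realpow[symmetric] powr_powr)
      also have "\<dots> \<le> (real (2 ^ m + S) * (1 / 2) ^ Suc m) ^ n"
      proof (rule power_mono)
        have "2 powr (- \<alpha>) = 2 powr ((real k - 1) / (2 * (real k)\<^sup>2)) / 2"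
          by (simp add: \<alpha> powr_diff)
        also have "\<dots> \<le> real (2 ^ m + S) / 2 ^ m / 2" using gain by (rule divide_right_mono) simp
        also have "\<dots> = real (2 ^ m + S) * (1 / 2) ^ Suc m" by (simp add: power_one_over field_simps)
        finally show "2 powr (- \<alpha>) \<le> real (2 ^ m + S) * (1 / 2) ^ Suc m" .
      qed simp
      also have "\<dots> = real (2 ^ m + S) ^ n * ((1 / 2) ^ Suc m) ^ n" by (rule power_mult_distrib)
      also have "\<dots> \<le> card (good_words S (2 ^ m) n F a) * ((1 / 2) ^ Suc m) ^ n"
        using that F assms S ratio
        by (intro mult_right_mono card_good_words) (auto simp: solutions_def formula_ok_def)
      finally show ?thesis .
    qed
    have clk': "\<exists>s' t. det_exec clk s s' t \<and> s' 2 = clock_tree B M n \<and> (\<forall>j<2. s' j = s j) \<and> t \<le> pc n"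
      if "s 2 = input" for s
      using clk[of "(n, F)" n s] that by (simp add: input_def)
    have inp: "enc_input n F = input"
      by (simp add: enc_input_def input_def enc_pair_def enc_literal_conv_pair)
    have sol: "{a. length a = n \<and> satisfies a \<Phi> \<and> C a} = solutions"
      using satisfies_conv_sat_list[OF cnf(2)] by (simp add: solutions_def)
    have time: "real ((nodes (clock_tree B M n) + 1) * (pc n + n * \<tau>w + pd n + pk n + 60 + nat \<lfloor>T n\<rfloor>)) \<le>
        real (4 * 2 ^ B * c) * real (n + 1) ^ d *
           (2 powr (real n - real n / (2 * real k) + real n / (2 * (real k)\<^sup>2)) * T n)"
    proof -
      have e: "real n - real n / (2 * real k) + real n / (2 * (real k)\<^sup>2) = \<alpha> * n"
        using assms by (simp add: \<alpha> field_simps power2_eq_square)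
      have "real (nodes (clock_tree B M n) + 1) = 4 * 2 powr b" unfolding b(1) by (simp add: powr_realpow)
      also have "\<dots> \<le> 4 * 2 powr (\<alpha> * n + B)" using b_le by (intro mult_left_mono powr_mono) simp_all
      finally have 1: "real (nodes (clock_tree B M n) + 1) \<le> 4 * 2 ^ B * 2 powr (\<alpha> * n)"
        by (simp add: powr_add powr_realpow mult_ac)
      have "real (pc n + n * \<tau>w + pd n + pk n + 60 + nat \<lfloor>T n\<rfloor>) \<le> real (p n) * 1 + T n"
        using T by (simp add: p_def)
      also have "\<dots> \<le> real (p n) * T n + T n" using T by (intro add_right_mono mult_left_mono) simp_all
      also have "\<dots> = real (p n + 1) * T n" by (simp add: algebra_simps)
      also have "\<dots> \<le> real (c * (n + 1) ^ d) * T n" using T cd[of n] by (intro mult_right_mono of_nat_mono) simp_all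
      finally have 2: "real (pc n + n * \<tau>w + pd n + pk n + 60 + nat \<lfloor>T n\<rfloor>) \<le> real (c * (n + 1) ^ d) * T n" .
      have "real ((nodes (clock_tree B M n) + 1) * (pc n + n * \<tau>w + pd n + pk n + 60 + nat \<lfloor>T n\<rfloor>)) \<le>
          (4 * 2 ^ B * 2 powr (\<alpha> * n)) * (real (c * (n + 1) ^ d) * T n)"
        unfolding of_nat_mult[of "nodes _ + 1"] using 1 2 by (rule mult_mono) simp_all
      also have "\<dots> = real (4 * 2 ^ B * c) * real (n + 1) ^ d * (2 powr (\<alpha> * n) * T n)" by simp
      finally show ?thesis unfolding e .
    qed
    show ?thesis
      unfolding inp sol
      by (rule randomized_search_if_safe[OF search_correct(1)[OF \<tau>w clk' \<epsilon> rounds good] time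
            search_correct(2)[OF \<tau>w clk' \<epsilon> rounds good]])
  qed
  show ?thesis by (intro exI allI impI) (rule main)
qed

end
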